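(* Let $\mathcal{W}'$ be an $(\mathcal{H},\mathcal{F}_{\mathcal{H}})$-valued random variable. The distribution of $\mathcal{W}'$ equals that of the standard Brownian web $\overline{\mathcal{W}}$ if the following conditions hold: (o) For any deterministic point $(x,t)\in\mathbb{R}^2$, there is almost surely a unique path $W'_{x,t}$ in $\mathcal{W}'$ starting from $(x,t)$. (i) For any deterministic $n$ and $(x_1,t_1),\ldots,(x_n,t_n)\in\mathbb{R}^2$, the joint distribution of $W'_{x_1,t_1},\ldots,W'_{x_n,t_n}$ is that of coalescing (standard) Brownian motions starting from these points. (ii$''$) For all $t_0\in\mathbb{R}$, $t>0$ and $a<b$ in $\mathbb{R}$, $\hat\eta_{\mathcal{W}'}(t_0,t;a,b)$ is equidistributed with $\hat\eta_{\overline{\mathcal{W}}}(t_0,t;a,b)$.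
   Context: Path space. For $x,t\in[-\infty,\infty]$ let $\Phi(x,t)=\frac{\tanh(x)}{1+|t|}$ and $\Psi(t)=\tanh(t)$ (with $\tanh(\pm\infty)=\pm1$ and $\Phi(x,\pm\infty)=0$). For $t_0\in[-\infty,\infty]$ let $C[t_0]$ be the set of functions $f:[t_0,\infty]\to[-\infty,\infty]$ such that $t\mapsto\Phi(f(t),t)$ is continuous, and let $\Pi=\bigcup_{t_0\in[-\infty,\infty]}C[t_0]\times\{t_0\}$. An element $(f,t_0)\in\Pi$ is a path starting at (from) $(f(t_0),t_0)$; it touches a point $(x,s)$ if $s\ge t_0$ and $f(s)=x$. Let $\hat f$ be the extension of $f$ to $[-\infty,\infty]$ equal to $f(t_0)$ for $t<t_0$. Set $$d((f_1,t_1),(f_2,t_2))=\Big(\sup_t|\Phi(\hat f_1(t),t)-\Phi(\hat f_2(t),t)|\Big)\vee|\Psi(t_1)-\Psi(t_2)|$$ (paths at $d$-distance zero are identified); $(\Pi,d)$ is a complete separable metric space. $\mathcal{H}$ is the set of (nonempty) compact subsets of $(\Pi,d)$, with the Hausdorff metric $d_{\mathcal{H}}$ induced by $d$, and $\mathcal{F}_{\mathcal{H}}$ is its Borel $\sigma$-field. Counting variables. For an $(\mathcal{H},\mathcal{F}_{\mathcal{H}})$-valued random variable $\mathcal{X}$, $t>0$ and $t_0,a,b\in\mathbb{R}$ with $a<b$, $\eta_{\mathcal{X}}(t_0,t;a,b)$ is the number of distinct points in $\mathbb{R}\times\{t_0+t\}$ that are touched by paths in $\mathcal{X}$ which also touch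 some point in $[a,b]\times\{t_0\}$; $\hat\eta_{\mathcal{X}}=\eta_{\mathcal{X}}-1$. Coalescing Brownian motions (unit diffusion constant, zero drift) starting from $(x_1,t_1),\ldots,(x_n,t_n)$: take independent standard Brownian motions $B_1,\dots,B_n$ and paths $W_j(t)=x_j+B_j(t-t_j)$, $t\ge t_j$; when two paths meet for the first time they coalesce into a single path, which is that of the Brownian motion with the lower index. Standard Brownian web $\overline{\mathcal{W}}$: the $(\mathcal{H},\mathcal{F}_{\mathcal{H}})$-valued random variable whose distribution is uniquely determined by: from any deterministic $(x,t)\in\mathbb{R}^2$ there is almost surely a unique path $W_{x,t}$ in $\overline{\mathcal{W}}$ starting from $(x,t)$; for any deterministic $(x_1,t_1),\ldots,(x_n,t_n)$, the joint distribution of $W_{x_1,t_1},\ldots,W_{x_n,t_n}$ is that of coalescing Brownian motions; and for any deterministic countable dense $\mathcal{D}'\subset\mathbb{R}^2$, almost surely $\overline{\mathcal{W}}$ is the closure in $(\Pi,d)$ of $\{W_{x,t}:(x,t)\in\mathcal{D}'\}$. *)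

theory Defs
  imports "HOL-Probability.Probability"
begin

section \<open>Path space\<close>

definition tanh_ereal :: "ereal \<Rightarrow> real" where
  "tanh_ereal x = (case x of ereal r \<Rightarrow> tanh r | PInfty \<Rightarrow> 1 | MInfty \<Rightarrow> -1)"

definition Phi :: "ereal \<Rightarrow> ereal \<Rightarrow> real" where
  "Phi x t = (case t of ereal r \<Rightarrow> tanh_ereal x / (1 + \<bar>r\<bar>) | _ \<Rightarrow> 0)"

definition Psi :: "ereal \<Rightarrow> real" where
  "Psi t = tanh_ereal t"

text \<open>A pair \<open>(f, t\<^sub>0)\<close> represents a path with domain \<open>{t\<^sub>0..}\<close>; the values of the total
  function \<open>f\<close> before \<open>t\<^sub>0\<close> are junk, to be ignored by everything below.\<close>

type_synonym raw_path = "(ereal \<Rightarrow> ereal) \<times> ereal"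

definition raw_paths :: "raw_path set" where
  "raw_paths = {(f, t0). continuous_on {t0..} (\<lambda>t. Phi (f t) t)}"

definition hat :: "raw_path \<Rightarrow> ereal \<Rightarrow> ereal" where
  "hat = (\<lambda>(f, t0) t. if t < t0 then f t0 else f t)"

definition raw_dist :: "raw_path \<Rightarrow> raw_path \<Rightarrow> real" where
  "raw_dist p q =
     max (SUP t. \<bar>Phi (hat p t) t - Phi (hat q t) t\<bar>) \<bar>Psi (snd p) - Psi (snd q)\<bar>"

definition raw_touches :: "raw_path \<Rightarrow> real \<times> real \<Rightarrow> bool" where
  "raw_touches = (\<lambda>(f, t0) (x, s). t0 \<le> ereal s \<and> f (ereal s) = ereal x)"

definition raw_starts_at :: "raw_path \<Rightarrow> real \<times> real \<Rightarrow> bool" where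
  "raw_starts_at = (\<lambda>(f, t0) (x, t). t0 = ereal t \<and> f t0 = ereal x)"

definition path_equiv :: "raw_path \<Rightarrow> raw_path \<Rightarrow> bool" where
  "path_equiv p q \<longleftrightarrow> p \<in> raw_paths \<and> q \<in> raw_paths \<and> raw_dist p q = 0"

lemma tanh_ereal_simps [simp]:
  "tanh_ereal (ereal r) = tanh r" "tanh_ereal \<infinity> = 1" "tanh_ereal (-\<infinity>) = -1"
  by (simp_all add: tanh_ereal_def)

lemma abs_tanh_ereal_le: "\<bar>tanh_ereal x\<bar> \<le> 1"
proof (cases x)
  case (real r)
  then show ?thesis
    using tanh_real_lt_1[of r] tanh_real_gt_neg1[of r] by (simp add: abs_le_iff)
qed simp_all

lemma tanh_ereal_inj [simp]: "tanh_ereal x = tanh_ereal y \<longleftrightarrow> x = y"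
proof -
  have "tanh r \<noteq> 1" "tanh r \<noteq> -1" for r :: real
    using tanh_real_lt_1[of r] tanh_real_gt_neg1[of r] by auto
  from this this[symmetric] show ?thesis
    by (cases x; cases y) auto
qed

lemma abs_Phi_le: "\<bar>Phi x t\<bar> \<le> 1"
proof (cases t)
  case (real r)
  have "\<bar>tanh_ereal x\<bar> \<le> 1 + \<bar>r\<bar>"
    using abs_tanh_ereal_le[of x] by linarith
  then show ?thesis
    by (simp add: Phi_def real abs_divide divide_le_eq)
qed (simp_all add: Phi_def)

lemma Phi_real_eq_iff [simp]: "Phi x (ereal r) = Phi y (ereal r) \<longleftrightarrow> x = y"
proof -
  have "1 + \<bar>r\<bar> \<noteq> 0"
    by linarith
  then show ?thesis
    by (simp add: Phi_def)
qed

lemma bdd_above_raw_dist: "bdd_above (range (\<lambda>t. \<bar>Phi (hat p t) t - Phi (hat q t) t\<bar>))"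
proof (rule bdd_aboveI[of _ 2])
  fix u assume "u \<in> range (\<lambda>t. \<bar>Phi (hat p t) t - Phi (hat q t) t\<bar>)"
  then obtain t where "u = \<bar>Phi (hat p t) t - Phi (hat q t) t\<bar>" by auto
  then show "u \<le> 2"
    using abs_Phi_le[of "hat p t" t] abs_Phi_le[of "hat q t" t] by linarith
qed

lemma raw_dist_ge: "\<bar>Phi (hat p t) t - Phi (hat q t) t\<bar> \<le> raw_dist p q"
  unfolding raw_dist_def by (intro max.coboundedI1 cSUP_upper bdd_above_raw_dist) auto

lemma raw_dist_ge': "\<bar>Psi (snd p) - Psi (snd q)\<bar> \<le> raw_dist p q"
  unfolding raw_dist_def by simp

lemma raw_dist_le:
  assumes "\<And>t. \<bar>Phi (hat p t) t - Phi (hat q t) t\<bar> \<le> c" "\<bar>Psi (snd p) - Psi (snd q)\<bar> \<le> c"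
  shows "raw_dist p q \<le> c"
  unfolding raw_dist_def using assms by (auto intro!: cSUP_least)

lemma raw_dist_refl [simp]: "raw_dist p p = 0"
  by (simp add: raw_dist_def)

lemma raw_dist_commute: "raw_dist p q = raw_dist q p"
  by (simp add: raw_dist_def abs_minus_commute)

lemma raw_dist_triangle: "raw_dist p r \<le> raw_dist p q + raw_dist q r"
proof (rule raw_dist_le)
  fix t show "\<bar>Phi (hat p t) t - Phi (hat r t) t\<bar> \<le> raw_dist p q + raw_dist q r"
    using raw_dist_ge[of p t q] raw_dist_ge[of q t r] by linarith
next
  show "\<bar>Psi (snd p) - Psi (snd r)\<bar> \<le> raw_dist p q + raw_dist q r"
    using raw_dist_ge'[of p q] raw_dist_ge'[of q r] by linarith
qed

lemma raw_dist_nonneg: "0 \<le> raw_dist p q"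
  using raw_dist_ge'[of p q] by linarith

lemma raw_dist_eq_0D:
  assumes "raw_dist p q = 0"
  shows "snd p = snd q" "hat p (ereal r) = hat q (ereal r)"
proof -
  show "snd p = snd q"
    using raw_dist_ge'[of p q] assms by (simp add: Psi_def)
  show "hat p (ereal r) = hat q (ereal r)"
    using raw_dist_ge[of p "ereal r" q] assms by simp
qed

lemma raw_dist_0_cong:
  assumes "raw_dist p p' = 0" "raw_dist q q' = 0"
  shows "raw_dist p q = raw_dist p' q'"
proof (rule antisym)
  show "raw_dist p q \<le> raw_dist p' q'"
    using raw_dist_triangle[of p q p'] raw_dist_triangle[of p' q q'] assms
    by (simp add: raw_dist_commute)
  show "raw_dist p' q' \<le> raw_dist p q"
    using raw_dist_triangle[of p' q' p] raw_dist_triangle[of p q' q] assms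
    by (simp add: raw_dist_commute)
qed

lemma const_in_raw_paths: "(\<lambda>_. 0, t0) \<in> raw_paths"
proof -
  have "(\<lambda>t. Phi 0 t) = (\<lambda>_. 0)"
    by (auto simp: Phi_def zero_ereal_def split: ereal.split)
  then show ?thesis
    by (simp add: raw_paths_def)
qed

quotient_type path = raw_path / partial: path_equiv
proof (rule part_equivpI)
  show "\<exists>p. path_equiv p p"
    using const_in_raw_paths by (auto simp: path_equiv_def)
  show "symp path_equiv"
    by (auto intro!: sympI simp: path_equiv_def raw_dist_commute)
  show "transp path_equiv"
    unfolding path_equiv_def by (intro transpI) (metis raw_dist_0_cong raw_dist_refl)
qed

text \<open>Since \<open>\<Phi>(x, \<plusminus>\<infinity>) = 0\<close>, identified paths may differ at the times \<open>\<plusminus>\<infinity>\<close>, but not at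
  real times, so both of the following predicates are well defined on \<open>path\<close>.\<close>

lift_definition touches :: "path \<Rightarrow> real \<times> real \<Rightarrow> bool" is raw_touches
proof -
  fix p q assume "path_equiv p q"
  then have *: "snd p = snd q" "\<And>r. hat p (ereal r) = hat q (ereal r)"
    using raw_dist_eq_0D by (auto simp: path_equiv_def)
  have "raw_touches p (x, s) \<longleftrightarrow> snd p \<le> ereal s \<and> hat p (ereal s) = ereal x" for p x s
    by (auto simp: raw_touches_def hat_def split: prod.splits)
  note this[of p] this[of q]
  with * show "raw_touches p = raw_touches q"
    by (simp add: fun_eq_iff)
qed

lift_definition starts_at :: "path \<Rightarrow> real \<times> real \<Rightarrow> bool" is raw_starts_at
proof -
  fix p q assume "path_equiv p q"
  then have *: "snd p = snd q" "\<And>r. hat p (ereal r) = hat q (ereal r)"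
    using raw_dist_eq_0D by (auto simp: path_equiv_def)
  have "raw_starts_at p (x, t) \<longleftrightarrow> snd p = ereal t \<and> hat p (ereal t) = ereal x" for p x t
    by (auto simp: raw_starts_at_def hat_def split: prod.splits)
  note this[of p] this[of q]
  with * show "raw_starts_at p = raw_starts_at q"
    by (simp add: fun_eq_iff)
qed

instantiation path :: metric_space
begin

lift_definition dist_path :: "path \<Rightarrow> path \<Rightarrow> real" is raw_dist
  unfolding path_equiv_def by (blast intro: raw_dist_0_cong)

definition uniformity_path :: "(path \<times> path) filter" where
  "uniformity_path = (INF e\<in>{0<..}. principal {(x, y). dist x y < e})"

definition open_path :: "path set \<Rightarrow> bool" where
  "open_path U \<longleftrightarrow> (\<forall>x\<in>U. eventually (\<lambda>(x', y). x' = x \<longrightarrow> y \<in> U) uniformity)"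

instance
proof
  fix p q r :: path
  show "dist p q = 0 \<longleftrightarrow> p = q"
    by transfer (simp add: path_equiv_def)
  show "dist p q \<le> dist p r + dist q r"
    by transfer (metis raw_dist_commute raw_dist_triangle)
qed (simp_all add: uniformity_path_def open_path_def)

end

section \<open>Compact sets of paths with the Hausdorff metric\<close>

definition hausdorff_dist :: "'a::metric_space set \<Rightarrow> 'a set \<Rightarrow> real" where
  "hausdorff_dist K L = max (SUP p\<in>K. infdist p L) (SUP q\<in>L. infdist q K)"

lemma hausdorff_dist_commute: "hausdorff_dist K L = hausdorff_dist L K"
  by (simp add: hausdorff_dist_def max.commute)

lemma bdd_above_infdist:
  assumes "compact K"
  shows "bdd_above ((\<lambda>p. infdist p L) ` K)"
  by (intro bounded_imp_bdd_above compact_imp_bounded compact_continuous_image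
        continuous_intros assms)

lemma infdist_le_hausdorff_dist:
  assumes "compact K" "p \<in> K"
  shows "infdist p L \<le> hausdorff_dist K L"
  unfolding hausdorff_dist_def
  by (intro max.coboundedI1 cSUP_upper bdd_above_infdist assms)

lemma infdist_le_hausdorff_dist':
  assumes "compact L" "q \<in> L"
  shows "infdist q K \<le> hausdorff_dist K L"
  using infdist_le_hausdorff_dist[OF assms, of K] by (simp add: hausdorff_dist_commute)

lemma hausdorff_dist_le:
  assumes "K \<noteq> {}" "L \<noteq> {}" "\<And>p. p \<in> K \<Longrightarrow> infdist p L \<le> c" "\<And>q. q \<in> L \<Longrightarrow> infdist q K \<le> c"
  shows "hausdorff_dist K L \<le> c"
  unfolding hausdorff_dist_def using assms by (auto intro!: cSUP_least)

lemma hausdorff_dist_nonneg: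
  assumes "compact K" "K \<noteq> {}"
  shows "0 \<le> hausdorff_dist K L"
proof -
  obtain p where "p \<in> K" using assms by auto
  then show ?thesis
    using infdist_le_hausdorff_dist[OF assms(1), of p L] infdist_nonneg[of p L] by linarith
qed

lemma hausdorff_dist_eq_0:
  assumes "compact K" "compact L" "K \<noteq> {}" "L \<noteq> {}"
  shows "hausdorff_dist K L = 0 \<longleftrightarrow> K = L"
proof
  have sub: "A \<subseteq> B" if "compact A" "compact B" "B \<noteq> {}" "hausdorff_dist A B = 0" for A B :: "'a set"
  proof
    fix p assume "p \<in> A"
    then have "infdist p B = 0"
      using infdist_le_hausdorff_dist[OF that(1), of p B] infdist_nonneg[of p B] that by simp
    then show "p \<in> B"
      using that in_closed_iff_infdist_zero[of B p] compact_imp_closed by auto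
  qed
  assume "hausdorff_dist K L = 0"
  then show "K = L"
    using sub[of K L] sub[of L K] assms by (auto simp: hausdorff_dist_commute)
next
  assume "K = L"
  then show "hausdorff_dist K L = 0"
    using assms by (intro antisym hausdorff_dist_le hausdorff_dist_nonneg) auto
qed

lemma hausdorff_dist_triangle:
  assumes "compact K" "compact L" "compact M" "K \<noteq> {}" "L \<noteq> {}" "M \<noteq> {}"
  shows "hausdorff_dist K M \<le> hausdorff_dist K L + hausdorff_dist L M"
proof -
  have *: "infdist p C \<le> hausdorff_dist A B + hausdorff_dist B C"
    if "compact A" "compact B" "B \<noteq> {}" "p \<in> A" for A B C :: "'a set" and p
  proof -
    have "infdist p C - hausdorff_dist B C \<le> infdist p B"
    proof (unfold infdist_notempty[OF \<open>B \<noteq> {}\<close>], intro cINF_greatest)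
      fix q assume "q \<in> B"
      then show "infdist p C - hausdorff_dist B C \<le> dist p q"
        using infdist_triangle[of p C q] infdist_le_hausdorff_dist[OF that(2), of q C] by linarith
    qed (use that in auto)
    then show ?thesis
      using infdist_le_hausdorff_dist[OF that(1,4), of B] by linarith
  qed
  show ?thesis
  proof (rule hausdorff_dist_le)
    fix q assume "q \<in> M"
    then show "infdist q K \<le> hausdorff_dist K L + hausdorff_dist L M"
      using *[of M L q K] assms by (simp add: hausdorff_dist_commute)
  qed (use * assms in auto)
qed

typedef path_set = "{K :: path set. compact K \<and> K \<noteq> {}}"
  morphisms paths_of Abs_path_set
  by (rule exI[of _ "{undefined}"]) simp

setup_lifting type_definition_path_set

text \<open>The \<open>\<sigma>\<close>-field on \<open>path_set\<close> is the library's \<^const>\<open>borel\<close> for the topology of this metric.\<close>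

instantiation path_set :: metric_space
begin

lift_definition dist_path_set :: "path_set \<Rightarrow> path_set \<Rightarrow> real" is hausdorff_dist .

definition uniformity_path_set :: "(path_set \<times> path_set) filter" where
  "uniformity_path_set = (INF e\<in>{0<..}. principal {(x, y). dist x y < e})"

definition open_path_set :: "path_set set \<Rightarrow> bool" where
  "open_path_set U \<longleftrightarrow> (\<forall>x\<in>U. eventually (\<lambda>(x', y). x' = x \<longrightarrow> y \<in> U) uniformity)"

instance
proof
  fix K L M :: path_set
  show "dist K L = 0 \<longleftrightarrow> K = L"
    by transfer (simp add: hausdorff_dist_eq_0)
  show "dist K L \<le> dist K M + dist L M"
    by transfer (metis hausdorff_dist_commute hausdorff_dist_triangle)
qed (simp_all add: uniformity_path_set_def open_path_set_def)

end

text \<open>The path of \<open>K\<close> starting from \<open>z\<close>, when there is exactly one. The fixed default in the other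
  case makes \<open>\<lambda>K. path_from K z\<close> a total Borel function.\<close>

definition path_from :: "path_set \<Rightarrow> real \<times> real \<Rightarrow> path" where
  "path_from K z =
     (if \<exists>!p. p \<in> paths_of K \<and> starts_at p z
      then THE p. p \<in> paths_of K \<and> starts_at p z else undefined)"

section \<open>Counting variables\<close>

definition touched_points :: "path_set \<Rightarrow> real \<Rightarrow> real \<Rightarrow> real \<Rightarrow> real \<Rightarrow> (real \<times> real) set" where
  "touched_points K t0 t a b =
     {z \<in> UNIV \<times> {t0 + t}. \<exists>p \<in> paths_of K. touches p z \<and> (\<exists>y \<in> {a..b} \<times> {t0}. touches p y)}"

definition eta :: "path_set \<Rightarrow> real \<Rightarrow> real \<Rightarrow> real \<Rightarrow> real \<Rightarrow> enat" where
  "eta K t0 t a b =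
     (if finite (touched_points K t0 t a b) then enat (card (touched_points K t0 t a b)) else \<infinity>)"

text \<open>Taken in \<^typ>\<open>ereal\<close>, so that subtracting 1 neither truncates at \<open>0\<close> nor loses \<open>\<infinity>\<close>.\<close>

definition eta_hat :: "path_set \<Rightarrow> real \<Rightarrow> real \<Rightarrow> real \<Rightarrow> real \<Rightarrow> ereal" where
  "eta_hat K t0 t a b = ereal_of_enat (eta K t0 t a b) - 1"

section \<open>Coalescing Brownian motions\<close>

definition standard_BM :: "'a measure \<Rightarrow> (real \<Rightarrow> 'a \<Rightarrow> real) \<Rightarrow> bool" where
  "standard_BM N B \<longleftrightarrow>
     (\<forall>s\<ge>0. B s \<in> borel_measurable N) \<and>
     (\<forall>\<omega>\<in>space N. B 0 \<omega> = 0 \<and> continuous_on {0..} (\<lambda>s. B s \<omega>)) \<and>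
     (\<forall>s t. 0 \<le> s \<and> s < t \<longrightarrow>
        distributed N lborel (\<lambda>\<omega>. B t \<omega> - B s \<omega>) (normal_density 0 (sqrt (t - s)))) \<and>
     (\<forall>(k::nat) r. 0 \<le> r 0 \<and> (\<forall>i<k. r i < r (Suc i)) \<longrightarrow>
        prob_space.indep_vars N (\<lambda>_. borel) (\<lambda>i \<omega>. B (r (Suc i)) \<omega> - B (r i) \<omega>) {..<k})"

definition independent_BMs :: "nat \<Rightarrow> 'a measure \<Rightarrow> (nat \<Rightarrow> real \<Rightarrow> 'a \<Rightarrow> real) \<Rightarrow> bool" where
  "independent_BMs n N B \<longleftrightarrow>
     prob_space N \<and> (\<forall>j<n. standard_BM N (B j)) \<and>
     prob_space.indep_vars N (\<lambda>_. Pi\<^sub>M {0..} (\<lambda>_. borel))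
       (\<lambda>j \<omega>. \<lambda>s\<in>{0..}. B j s \<omega>) {..<n}"

text \<open>\<open>merge t C k w\<close> follows \<open>w\<close> (started at time \<open>t k\<close>) until it first meets one of the paths
  \<open>C 0, \<dots>, C (k - 1)\<close>, and from then on the path it met. (If it meets several at that time, these have
  already merged, so the choice of the least index is immaterial.)\<close>

definition meeting_times :: "(nat \<Rightarrow> real) \<Rightarrow> (nat \<Rightarrow> real \<Rightarrow> real) \<Rightarrow> nat \<Rightarrow> (real \<Rightarrow> real) \<Rightarrow> real set" where
  "meeting_times t C k w = {u. t k \<le> u \<and> (\<exists>j<k. t j \<le> u \<and> C j u = w u)}"

definition merge :: "(nat \<Rightarrow> real) \<Rightarrow> (nat \<Rightarrow> real \<Rightarrow> real) \<Rightarrow> nat \<Rightarrow> (real \<Rightarrow> real) \<Rightarrow> real \<Rightarrow> real" where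
  "merge t C k w s =
     (let T = meeting_times t C k w; \<tau> = Inf T
      in if T \<noteq> {} \<and> \<tau> \<le> s then C (LEAST j. j < k \<and> t j \<le> \<tau> \<and> C j \<tau> = w \<tau>) s else w s)"

text \<open>\<open>coalesce t W n\<close> coalesces the paths \<open>W 0, \<dots>, W (n - 1)\<close> started at times \<open>t 0, \<dots>, t (n - 1)\<close>.
  As the path of lower index survives each meeting, a path is never affected by those of higher
  index, and the paths can be processed in the order of their indices.\<close>

primrec coalesce :: "(nat \<Rightarrow> real) \<Rightarrow> (nat \<Rightarrow> real \<Rightarrow> real) \<Rightarrow> nat \<Rightarrow> nat \<Rightarrow> real \<Rightarrow> real" where
  "coalesce t W 0 = W"
| "coalesce t W (Suc k) = (coalesce t W k)(k := merge t (coalesce t W k) k (W k))"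

text \<open>The path with values \<open>g s\<close> at the real times \<open>s \<ge> t\<close>; its value at time \<open>\<infinity>\<close> is
  immaterial.\<close>

definition mk_path :: "(real \<Rightarrow> real) \<Rightarrow> real \<Rightarrow> path" where
  "mk_path g t = abs_path (\<lambda>s. ereal (g (real_of_ereal s)), ereal t)"

lemma raw_paths_ereal:
  assumes g: "continuous_on {t..} g"
  shows "(\<lambda>s. ereal (g (real_of_ereal s)), ereal t) \<in> raw_paths"
proof -
  let ?h = "\<lambda>s. Phi (ereal (g (real_of_ereal s))) s"
  have "(?h \<longlongrightarrow> ?h s) (at s within {ereal t..})" if s: "s \<in> {ereal t..}" for s
  proof (cases s)
    case (real r)
    have lim: "((\<lambda>u. tanh (g u) / (1 + \<bar>u\<bar>)) \<longlongrightarrow> tanh (g r) / (1 + \<bar>r\<bar>)) (at r within {t..})"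
    proof -
      have "continuous_on {t..} (\<lambda>u. tanh (g u) / (1 + \<bar>u\<bar>))"
        by (intro continuous_intros g) (auto simp: add_nonneg_eq_0_iff)
      then show ?thesis
        using s real by (auto simp: continuous_on_def)
    qed
    have re: "filterlim real_of_ereal (at r within {t..}) (at s within {ereal t..})"
      unfolding filterlim_at
    proof
      show "(real_of_ereal \<longlongrightarrow> r) (at s within {ereal t..})"
        by (rule tendsto_within_subset[of _ _ _ UNIV]) (auto simp: real lim_real_of_ereal)
      have "\<forall>\<^sub>F x in at s within {ereal t..}. x < \<infinity>"
        by (rule order_tendstoD[OF tendsto_ident_at]) (simp add: real)
      moreover have "\<forall>\<^sub>F x in at s within {ereal t..}. x \<in> {ereal t..} \<and> x \<noteq> s"
        by (simp add: eventually_at_topological) (use open_UNIV in blast)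
      ultimately show "\<forall>\<^sub>F x in at s within {ereal t..}. real_of_ereal x \<in> {t..} \<and> real_of_ereal x \<noteq> r"
      proof eventually_elim
        case (elim x)
        then show ?case by (cases x) (auto simp: real)
      qed
    qed
    have "\<forall>\<^sub>F x in at s within {ereal t..}. x < \<infinity>"
      by (rule order_tendstoD[OF tendsto_ident_at]) (simp add: real)
    moreover have "\<forall>\<^sub>F x in at s within {ereal t..}. x \<in> {ereal t..} \<and> x \<noteq> s"
      by (simp add: eventually_at_topological) (use open_UNIV in blast)
    ultimately have "\<forall>\<^sub>F x in at s within {ereal t..}.
        tanh (g (real_of_ereal x)) / (1 + \<bar>real_of_ereal x\<bar>) = ?h x"
    proof eventually_elim
      case (elim x)
      then show ?case by (cases x) (auto simp: Phi_def)
    qed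
    with filterlim_compose[OF lim re] show ?thesis
      by (auto simp: real Phi_def intro: Lim_transform_eventually)
  next
    case PInf
    have "(?h \<longlongrightarrow> 0) (at s within {ereal t..})"
    proof (rule tendstoI)
      fix e :: real assume e: "0 < e"
      have "\<forall>\<^sub>F x in at s within {ereal t..}. ereal (1 / e) < x"
        by (rule order_tendstoD[OF tendsto_ident_at]) (simp add: PInf)
      then show "\<forall>\<^sub>F x in at s within {ereal t..}. dist (?h x) 0 < e"
      proof eventually_elim
        case (elim x)
        show ?case
        proof (cases x)
          case (real r)
          have "1 < r * e" "0 < 1 / e"
            using elim e by (auto simp: real field_simps)
          moreover have "r * e \<le> \<bar>r\<bar> * e" using e by (simp add: mult_right_mono)
          moreover have "\<bar>tanh (g r)\<bar> \<le> 1" using abs_tanh_ereal_le[of "ereal (g r)"] by simp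
          ultimately have "\<bar>tanh (g r)\<bar> < e + \<bar>r\<bar> * e" using e by linarith
          then have "\<bar>tanh (g r)\<bar> < (1 + \<bar>r\<bar>) * e" by (simp only: distrib_right mult_1)
          then show ?thesis
            by (simp add: Phi_def real abs_divide divide_less_eq mult.commute abs_of_pos add_pos_nonneg)
        qed (use e in \<open>simp_all add: Phi_def\<close>)
      qed
    qed
    then show ?thesis by (simp add: PInf Phi_def)
  qed (use s in auto)
  then show ?thesis
    by (simp add: raw_paths_def continuous_on_def)
qed

lemma touches_mk_path:
  assumes "continuous_on {t..} g"
  shows "touches (mk_path g t) (x, s) \<longleftrightarrow> t \<le> s \<and> g s = x"
  using raw_paths_ereal[OF assms] unfolding mk_path_def
  by (subst touches.abs_eq) (auto simp: path_equiv_def raw_touches_def eq_onp_def)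

lemma starts_at_mk_path:
  assumes "continuous_on {t..} g"
  shows "starts_at (mk_path g t) (x, s) \<longleftrightarrow> s = t \<and> g t = x"
  using raw_paths_ereal[OF assms] unfolding mk_path_def
  by (subst starts_at.abs_eq) (auto simp: path_equiv_def raw_starts_at_def eq_onp_def)

definition coalescing_paths ::
    "nat \<Rightarrow> (nat \<Rightarrow> real \<times> real) \<Rightarrow> (nat \<Rightarrow> real \<Rightarrow> 'a \<Rightarrow> real) \<Rightarrow> 'a \<Rightarrow> nat \<Rightarrow> path" where
  "coalescing_paths n z B \<omega> =
     (\<lambda>j\<in>{..<n}. mk_path
        (coalesce (\<lambda>i. snd (z i)) (\<lambda>i s. fst (z i) + B i (s - snd (z i)) \<omega>) n j) (snd (z j)))"

text \<open>\<open>\<mu>\<close> is the law of coalescing Brownian motions started from \<open>z 0, \<dots>, z (n - 1)\<close>. The sample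
  space type is fixed only because a definition cannot quantify over types; it is no restriction,
  as every finite family of continuous processes has a version on this path space.\<close>

definition coalescing_BM_law ::
    "nat \<Rightarrow> (nat \<Rightarrow> real \<times> real) \<Rightarrow> (nat \<Rightarrow> path) measure \<Rightarrow> bool" where
  "coalescing_BM_law n z \<mu> \<longleftrightarrow>
     (\<exists>(N :: (nat \<Rightarrow> real \<Rightarrow> real) measure) B. independent_BMs n N B \<and>
        \<mu> = distr N (Pi\<^sub>M {..<n} (\<lambda>_. borel)) (coalescing_paths n z B))"

section \<open>The Brownian web\<close>

definition random_path_set :: "'a measure \<Rightarrow> ('a \<Rightarrow> path_set) \<Rightarrow> bool" where
  "random_path_set M X \<longleftrightarrow> prob_space M \<and> X \<in> borel_measurable M"

definition unique_paths :: "'a measure \<Rightarrow> ('a \<Rightarrow> path_set) \<Rightarrow> bool" where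
  "unique_paths M X \<longleftrightarrow>
     (\<forall>z. AE \<omega> in M. \<exists>!p. p \<in> paths_of (X \<omega>) \<and> starts_at p z)"

definition coalescing_BM_marginals :: "'a measure \<Rightarrow> ('a \<Rightarrow> path_set) \<Rightarrow> bool" where
  "coalescing_BM_marginals M X \<longleftrightarrow>
     (\<forall>n z. coalescing_BM_law n z
        (distr M (Pi\<^sub>M {..<n} (\<lambda>_. borel)) (\<lambda>\<omega>. \<lambda>j\<in>{..<n}. path_from (X \<omega>) (z j))))"

definition brownian_web :: "'a measure \<Rightarrow> ('a \<Rightarrow> path_set) \<Rightarrow> bool" where
  "brownian_web M X \<longleftrightarrow>
     random_path_set M X \<and> unique_paths M X \<and> coalescing_BM_marginals M X \<and>
     (\<forall>D. countable D \<and> closure D = UNIV \<longrightarrow>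
        (AE \<omega> in M. paths_of (X \<omega>) = closure (path_from (X \<omega>) ` D)))"

end

theory Submission
  imports Defs
begin

text \<open>
  Let \<open>\<X>\<close> be the closure of the countable skeleton of the paths in \<open>\<W>'\<close> that start from rational points.
  It is contained in \<open>\<W>'\<close>, and its law is that of the Brownian web: both sets are Hausdorff limits of
  finite sets of skeleton paths, and the joint law of finitely many such paths is prescribed
  (\<open>coalescing_BM_law_unique\<close>, \<open>distr_limit_eq\<close>). Hence the counting variables of \<open>\<W>'\<close> and of \<open>\<X>\<close> have the
  same law. Those of \<open>\<W>'\<close> are at least as large, so they agree almost surely
  (\<open>AE_eq_if_le_and_same_law\<close>), and where they are finite the sets of touched points agree. It remains
  to see that \<open>\<W>'\<close> then contains no path outside \<open>\<X>\<close>.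

  This is a statement about single realizations (\<open>web_sample_unique\<close>) which uses the following almost
  sure properties of the skeleton. Its paths are finite, coalesce when they meet, and become
  arbitrarily high or low when their starting points do (\<open>AE_unbounded\<close>). A path that passes through a
  point at a rational time has merged at any later time with skeleton paths that started on either
  side of that point (\<open>AE_merged_with_neighbour\<close>). The skeleton paths from a bounded interval at a
  rational time occupy only finitely many points at a later rational time
  (\<open>AE_finitely_many_survivors\<close>). So all touched points at rational times lie on skeleton
  paths, and every path of \<open>\<X>\<close> through such a point is squeezed onto that skeleton path. If a path of
  \<open>\<W>'\<close> is finite at two rational times, its position at the second one is touched by \<open>\<X>\<close>, hence lies on a
  skeleton path; the same comparison at all later rational times shows that it follows this skeleton
  path forever. Letting the two times decrease to the starting time identifies the whole path as a
  limit of skeleton paths. The paths that are infinite at all real times, and those that start at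
  time \<open>\<infinity>\<close>, are limits of skeleton paths as well.

  The quantitative input is the bound \<open>\<delta> / sqrt (\<pi> t)\<close> for the probability that two independent Brownian
  motions at distance at most \<open>\<delta>\<close> do not meet within time \<open>t\<close> (\<open>meeting_estimate\<close>). It is linear in \<open>\<delta>\<close>, so
  that it can be summed over the \<open>1 / \<delta>\<close> cells of a grid. It comes from the reflection principle, applied
  on finite time grids (\<open>reflection_step\<close>) that become finer.

  The remaining work is measurability. The path space is separable, the distance of two paths is
  determined by their starting times and their values at rational times, and all Borel functions of a compact set of paths that occur are
  built from the closed conditions that the set meets a given closed set (\<open>closed_hit\<close>).
\<close>


section \<open>Paths as continuous functions on the real line\<close>

lift_definition start :: "path \<Rightarrow> ereal" is snd
  by (auto simp: path_equiv_def dest: raw_dist_eq_0D)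

text \<open>The hyperbolic tangent of the position, extended to times before the start as in the metric.
  Positions \<open>\<plusminus>\<infinity>\<close> become \<open>\<plusminus>1\<close>, so a path turns into a real-valued continuous function together with a
  starting time, whether it is finite or not.\<close>

lift_definition tv :: "path \<Rightarrow> real \<Rightarrow> real" is "\<lambda>p t. tanh_ereal (hat p (ereal t))"
  by (auto simp: path_equiv_def fun_eq_iff dest: raw_dist_eq_0D)

lemma Phi_real: "Phi x (ereal r) = tanh_ereal x / (1 + \<bar>r\<bar>)"
  by (simp add: Phi_def)

lemma abs_tv_le: "\<bar>tv p t\<bar> \<le> 1"
  by transfer (rule abs_tanh_ereal_le)

lemma tv_dist: "\<bar>tv p t - tv q t\<bar> \<le> (1 + \<bar>t\<bar>) * dist p q"
proof transfer
  fix p q :: raw_path and t :: real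
  have "\<bar>Phi (hat p (ereal t)) (ereal t) - Phi (hat q (ereal t)) (ereal t)\<bar> \<le> raw_dist p q"
    by (rule raw_dist_ge)
  then have "\<bar>tanh_ereal (hat p (ereal t)) - tanh_ereal (hat q (ereal t))\<bar> / (1 + \<bar>t\<bar>) \<le> raw_dist p q"
    by (simp add: Phi_real diff_divide_distrib[symmetric] abs_divide)
  then show "\<bar>tanh_ereal (hat p (ereal t)) - tanh_ereal (hat q (ereal t))\<bar> \<le> (1 + \<bar>t\<bar>) * raw_dist p q"
    by (simp add: divide_le_eq mult.commute add_pos_nonneg split: if_splits)
qed

lemma start_dist: "\<bar>Psi (start p) - Psi (start q)\<bar> \<le> dist p q"
  by transfer (rule raw_dist_ge')

text \<open>The times \<open>\<plusminus>\<infinity>\<close> do not contribute to the distance, because \<open>\<Phi>\<close> vanishes there.\<close>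

lemma dist_path_leI:
  assumes "\<And>t. \<bar>tv p t - tv q t\<bar> \<le> c * (1 + \<bar>t\<bar>)" "\<bar>Psi (start p) - Psi (start q)\<bar> \<le> c"
  shows "dist p q \<le> c"
  using assms
proof transfer
  fix p q :: raw_path and c :: real
  assume 1: "\<And>t. \<bar>tanh_ereal (hat p (ereal t)) - tanh_ereal (hat q (ereal t))\<bar> \<le> c * (1 + \<bar>t\<bar>)"
    and 2: "\<bar>Psi (snd p) - Psi (snd q)\<bar> \<le> c"
  have "0 \<le> c" using 2 by linarith
  show "raw_dist p q \<le> c"
  proof (rule raw_dist_le[OF _ 2])
    fix t :: ereal
    show "\<bar>Phi (hat p t) t - Phi (hat q t) t\<bar> \<le> c"
    proof (cases t)
      case (real r)
      then show ?thesis using 1[of r]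
        by (simp add: Phi_real diff_divide_distrib[symmetric] abs_divide divide_le_eq add_pos_nonneg)
    qed (use \<open>0 \<le> c\<close> in \<open>simp_all add: Phi_def\<close>)
  qed
qed

lemma Psi_inj: "Psi s = Psi t \<longleftrightarrow> s = t"
  by (simp add: Psi_def)

text \<open>The domain before the start and the one after it are closed, and the function is constant on
  the first; multiplying by \<open>1 + \<bar>t\<bar>\<close> recovers it from \<open>\<Phi>\<close> on the second.\<close>

lemma continuous_tv: "continuous_on UNIV (tv p)"
proof transfer
  fix p :: raw_path assume p: "path_equiv p p"
  obtain f t0 where pf: "p = (f, t0)" by (cases p)
  have c: "continuous_on {t0..} (\<lambda>t. Phi (f t) t)"
    using p by (simp add: path_equiv_def raw_paths_def pf)
  let ?h = "\<lambda>t. tanh_ereal (hat p (ereal t))"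
  let ?A = "{r. t0 \<le> ereal r}" and ?B = "{r. ereal r \<le> t0}"
  have cA: "closed ?A" and cB: "closed ?B"
    by (intro closed_Collect_le continuous_intros)+
  have "continuous_on ?A (\<lambda>r. Phi (f (ereal r)) (ereal r))"
    using continuous_on_compose2[OF c, of ?A ereal] by (auto simp: continuous_on_ereal)
  then have "continuous_on ?A (\<lambda>r. Phi (f (ereal r)) (ereal r) * (1 + \<bar>r\<bar>))"
    by (intro continuous_intros)
  then have 1: "continuous_on ?A ?h"
    by (rule continuous_on_eq) (auto simp: Phi_real hat_def pf add_nonneg_eq_0_iff)
  have "continuous_on ?B (\<lambda>r. tanh_ereal (f t0))"
    by simp
  then have 2: "continuous_on ?B ?h"
    by (rule continuous_on_eq) (auto simp: hat_def pf)
  have "?A \<union> ?B = UNIV" by auto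
  with continuous_on_closed_Un[OF cA cB 1 2] show "continuous_on UNIV ?h"
    by simp
qed

lemma continuous_tv' [continuous_intros]: "continuous_on S g \<Longrightarrow> continuous_on S (\<lambda>x. tv p (g x))"
  by (rule continuous_on_compose2[OF continuous_tv]) auto

lemma tv_before_start:
  assumes "ereal t \<le> start p" "ereal s \<le> start p"
  shows "tv p t = tv p s"
  using assms by transfer (auto simp: hat_def split: prod.splits)

lemma touches_iff: "touches p (x, s) \<longleftrightarrow> start p \<le> ereal s \<and> tv p s = tanh x"
proof (transfer fixing: x s)
  fix p :: raw_path
  have "tanh x = tanh_ereal (ereal x)" by simp
  then show "raw_touches p (x, s) \<longleftrightarrow> snd p \<le> ereal s \<and> tanh_ereal (hat p (ereal s)) = tanh x"
    by (auto simp: raw_touches_def hat_def simp del: tanh_ereal_simps split: prod.splits)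
qed

lemma starts_at_iff: "starts_at p (x, s) \<longleftrightarrow> start p = ereal s \<and> tv p s = tanh x"
proof (transfer fixing: x s)
  fix p :: raw_path
  have "tanh x = tanh_ereal (ereal x)" by simp
  then show "raw_starts_at p (x, s) \<longleftrightarrow> snd p = ereal s \<and> tanh_ereal (hat p (ereal s)) = tanh x"
    by (auto simp: raw_starts_at_def hat_def simp del: tanh_ereal_simps split: prod.splits)
qed

lemma
  assumes g: "continuous_on {t..} g"
  shows start_mk_path: "start (mk_path g t) = ereal t"
    and tv_mk_path: "tv (mk_path g t) s = tanh (g (max t s))"
proof -
  have e: "path_equiv (\<lambda>s. ereal (g (real_of_ereal s)), ereal t) (\<lambda>s. ereal (g (real_of_ereal s)), ereal t)"
    using raw_paths_ereal[OF g] by (simp add: path_equiv_def)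
  show "start (mk_path g t) = ereal t"
    unfolding mk_path_def by (subst start.abs_eq) (auto simp: e eq_onp_def)
  show "tv (mk_path g t) s = tanh (g (max t s))"
    unfolding mk_path_def by (subst tv.abs_eq) (auto simp: e eq_onp_def hat_def max_def)
qed

lemma abs_tanh_less_1: "\<bar>tanh (x::real)\<bar> < 1"
  using tanh_real_bounds[of x] by auto

lemma tanh_surj: 
  assumes "\<bar>y\<bar> < 1" shows "\<exists>x::real. y = tanh x"
proof
  have "0 < (1 - y) / (1 + y)" using assms by (auto simp: abs_less_iff)
  moreover have "-2 * (- ln ((1 - y) / (1 + y)) / 2) = ln ((1 - y) / (1 + y))" by simp
  ultimately have "exp (-2 * (- ln ((1 - y) / (1 + y)) / 2)) = (1 - y) / (1 + y)" by (metis exp_ln)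
  then show "y = tanh (- ln ((1 - y) / (1 + y)) / 2)"
    unfolding tanh_real_altdef using assms by (simp add: field_simps abs_less_iff)
qed


section \<open>Separability of the path space and measurability of paths\<close>

lemma tanh_ereal_le_iff: "tanh_ereal x \<le> tanh_ereal y \<longleftrightarrow> x \<le> y"
proof -
  have "tanh r < 1" "-1 < tanh r" for r :: real
    using tanh_real_bounds[of r] by auto
  then show ?thesis
    by (cases x; cases y) (auto simp: not_le intro: less_imp_le)
qed

lemma Psi_le_iff: "Psi s \<le> Psi t \<longleftrightarrow> s \<le> t"
  by (simp add: Psi_def tanh_ereal_le_iff)

text \<open>Outside a compact time interval the factor \<open>1 / (1 + \<bar>t\<bar>)\<close> makes all paths close to each other, and on
  it a path is determined up to a small error by its rounded values on a grid that is fine enough for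
  this path. As the number of grid points is part of the code, there are only countably many codes.\<close>

lemma path_grid_code:
  assumes e: "0 < (e::real)"
  shows "\<exists>code :: path \<Rightarrow> nat \<times> int \<times> int list. \<forall>p q. code p = code q \<longrightarrow> dist p q \<le> 3 * e"
proof -
  obtain m :: nat where m: "1 / e < real m" using reals_Archimedean2 by blast
  have "\<exists>N>0. \<forall>s t. s \<in> {- real m..real m} \<longrightarrow> t \<in> {- real m..real m} \<longrightarrow> \<bar>s - t\<bar> < 1 / real N \<longrightarrow> \<bar>tv p s - tv p t\<bar> < e" for p
  proof -
    have "uniformly_continuous_on {- real m..real m} (tv p)"
      by (intro compact_uniformly_continuous continuous_intros) auto
    then obtain d where d: "d > 0" "\<forall>s\<in>{- real m..real m}. \<forall>t\<in>{- real m..real m}. dist t s < d \<longrightarrow> dist (tv p t) (tv p s) < e"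
      using e unfolding uniformly_continuous_on_def by blast
    obtain N where N: "0 < N" "1 / real N < d" using d(1) real_arch_inverse[of d] by (auto simp: divide_inverse)
    then show ?thesis using d(2) by (intro exI[of _ N]) (force simp: dist_real_def)
  qed
  then obtain N where N: "\<And>p. 0 < N p" "\<And>p s t. s \<in> {- real m..real m} \<Longrightarrow> t \<in> {- real m..real m} \<Longrightarrow> \<bar>s - t\<bar> < 1 / real (N p) \<Longrightarrow> \<bar>tv p s - tv p t\<bar> < e"
    by metis
  define code where "code p = (N p, \<lfloor>Psi (start p) / e\<rfloor>, map (\<lambda>i. \<lfloor>tv p (- real m + real i / real (N p)) / e\<rfloor>) [0..<2 * m * N p + 1])" for p
  have close: "\<bar>x - y\<bar> \<le> e" if "\<lfloor>x / e\<rfloor> = \<lfloor>y / e\<rfloor>" for x y :: real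
  proof -
    have "\<bar>x / e - y / e\<bar> < 1" using that by linarith
    then have "\<bar>x - y\<bar> / e < 1" using e by (simp add: diff_divide_distrib[symmetric] abs_divide)
    then show ?thesis using e by (simp add: divide_less_eq)
  qed
  have "dist p q \<le> 3 * e" if "code p = code q" for p q
  proof (rule dist_path_leI)
    have eq: "N p = N q" "\<lfloor>Psi (start p) / e\<rfloor> = \<lfloor>Psi (start q) / e\<rfloor>"
      and L: "map (\<lambda>i. \<lfloor>tv p (- real m + real i / real (N p)) / e\<rfloor>) [0..<2 * m * N p + 1] = map (\<lambda>i. \<lfloor>tv q (- real m + real i / real (N p)) / e\<rfloor>) [0..<2 * m * N p + 1]"
      using that by (auto simp: code_def simp del: upt_Suc map_eq_conv)
    show "\<bar>Psi (start p) - Psi (start q)\<bar> \<le> 3 * e" using close[OF eq(2)] e by linarith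
    fix t
    show "\<bar>tv p t - tv q t\<bar> \<le> 3 * e * (1 + \<bar>t\<bar>)"
    proof (cases "\<bar>t\<bar> \<le> real m")
      case True
      define n where "n = real (N p)"
      have n: "n > 0" using N by (simp add: n_def)
      define i where "i = nat \<lfloor>(t + real m) * n\<rfloor>"
      have "0 \<le> (t + real m) * n" using True n by (auto simp: abs_le_iff)
      then have i: "real i \<le> (t + real m) * n" "(t + real m) * n < real i + 1"
        by (auto simp: i_def)
      define g where "g = - real m + real i / n"
      have g: "g \<le> t" "t < g + 1 / n"
        using i n by (auto simp: g_def field_simps)
      have "real i \<le> 2 * real m * n" using i(1) True n mult_right_mono[of "t + real m" "2 * real m" n] by linarith
      then have "i < 2 * m * N p + 1" unfolding n_def by (metis less_Suc_eq_le Suc_eq_plus1 of_nat_le_iff of_nat_mult of_nat_numeral)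
      then have "\<lfloor>tv p g / e\<rfloor> = \<lfloor>tv q g / e\<rfloor>"
        using bspec[OF L[unfolded map_eq_conv], of i] unfolding g_def n_def set_upt by simp
      then have 1: "\<bar>tv p g - tv q g\<bar> \<le> e" by (rule close)
      have gm: "g \<in> {- real m..real m}" "t \<in> {- real m..real m}" using True g n by (auto simp: g_def)
      have "\<bar>tv p g - tv p t\<bar> < e" "\<bar>tv q g - tv q t\<bar> < e"
        using N(2)[OF gm, of p] N(2)[OF gm, of q] g eq by (auto simp: n_def)
      with 1 have "\<bar>tv p t - tv q t\<bar> \<le> 3 * e" by linarith
      also have "\<dots> \<le> 3 * e * (1 + \<bar>t\<bar>)" using e by simp
      finally show ?thesis .
    next
      case False
      have "1 / e < \<bar>t\<bar>" using False m by linarith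
      then have "1 \<le> e * (1 + \<bar>t\<bar>)" using e by (simp add: field_simps)
      then show ?thesis using abs_tv_le[of p t] abs_tv_le[of q t] by linarith
    qed
  qed
  then show ?thesis by blast
qed

lemma countable_dense_paths: "\<exists>C :: path set. countable C \<and> (\<forall>p e. 0 < e \<longrightarrow> (\<exists>q\<in>C. dist p q < e))"
proof -
  have "\<exists>code :: path \<Rightarrow> nat \<times> int \<times> int list. \<forall>p q. code p = code q \<longrightarrow> dist p q \<le> 3 * (1 / (4 * real (Suc n)))" for n
    by (rule path_grid_code) simp
  then obtain code :: "nat \<Rightarrow> path \<Rightarrow> nat \<times> int \<times> int list"
    where code: "\<And>n p q. code n p = code n q \<Longrightarrow> dist p q \<le> 3 * (1 / (4 * real (Suc n)))" by metis
  define C where "C = (\<Union>n. (\<lambda>c. SOME p. code n p = c) ` range (code n))"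
  have "\<exists>q\<in>C. dist p q < e" if e: "0 < e" for p e
  proof -
    obtain n where n: "1 / real (Suc n) < e" using e reals_Archimedean[of e] by (auto simp: divide_inverse)
    define q where "q = (SOME q. code n q = code n p)"
    have "code n q = code n p" unfolding q_def by (rule someI) simp
    then have "dist p q \<le> 3 * (1 / (4 * real (Suc n)))" by (metis code)
    also have "\<dots> < 1 / real (Suc n)" by (simp add: field_simps)
    finally have "dist p q < e" using n by linarith
    moreover have "q \<in> C" unfolding C_def q_def by blast
    ultimately show ?thesis by blast
  qed
  moreover have "countable C" unfolding C_def by auto
  ultimately show ?thesis by blast
qed

instance path :: second_countable_topology
proof
  obtain C :: "path set" where C: "countable C" "\<And>p e. 0 < e \<Longrightarrow> \<exists>q\<in>C. dist p q < e"
    using countable_dense_paths by blast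
  define B where "B = (\<lambda>(q, n). ball q (1 / real (Suc n))) ` (C \<times> (UNIV :: nat set))"
  have "topological_basis B"
  proof (rule topological_basisI)
    fix b assume "b \<in> B" then show "open b" by (auto simp: B_def)
  next
    fix U :: "path set" and p assume "open U" "p \<in> U"
    then obtain e where e: "e > 0" "ball p e \<subseteq> U" by (rule openE)
    obtain n where n: "1 / real (Suc n) < e / 2" using e(1) nat_approx_posE[of "e/2"] by auto
    obtain q where q: "q \<in> C" "dist p q < 1 / real (Suc n)" using C(2)[of "1 / real (Suc n)" p] by auto
    have "ball q (1 / real (Suc n)) \<subseteq> ball p e"
    proof
      fix x assume "x \<in> ball q (1 / real (Suc n))"
      then show "x \<in> ball p e" using q n dist_triangle[of p x q] by auto
    qed
    with q e show "\<exists>b\<in>B. p \<in> b \<and> b \<subseteq> U" unfolding B_def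
      by (intro bexI[of _ "ball q (1 / real (Suc n))"]) (auto simp: dist_commute image_iff intro!: bexI[of _ "(q, n)"])
  qed
  moreover have "countable B" using C(1) by (auto simp: B_def)
  ultimately show "\<exists>B :: path set set. countable B \<and> open = generate_topology B"
    using topological_basis_imp_subbasis by blast
qed

lemma continuous_tv_path: "continuous_on UNIV (\<lambda>p. tv p t)"
proof (rule lipschitz_on_continuous_on)
  show "(1 + \<bar>t\<bar>)-lipschitz_on UNIV (\<lambda>p. tv p t)"
    by (rule lipschitz_onI) (use tv_dist in \<open>auto simp: dist_real_def\<close>)
qed

lemma continuous_start_path: "continuous_on UNIV (\<lambda>p. Psi (start p))"
proof (rule lipschitz_on_continuous_on)
  show "1-lipschitz_on UNIV (\<lambda>p. Psi (start p))"
    by (rule lipschitz_onI) (use start_dist in \<open>auto simp: dist_real_def\<close>)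
qed

lemma measurable_tv [measurable]: "(\<lambda>p. tv p t) \<in> borel_measurable borel"
  by (intro borel_measurable_continuous_onI continuous_tv_path)

lemma closed_start_le: "closed {p. start p \<le> s}"
proof -
  have "closed {p. Psi (start p) \<le> Psi s}"
    by (intro closed_Collect_le continuous_start_path continuous_intros)
  then show ?thesis by (simp add: Psi_le_iff)
qed

lemma closed_start_eq: "closed {p. start p = s}"
proof -
  have "closed {p. Psi (start p) = Psi s}"
    by (intro closed_Collect_eq continuous_start_path continuous_intros)
  then show ?thesis by (simp add: Psi_inj)
qed

lemma closed_tv: "closed S \<Longrightarrow> closed {p. tv p t \<in> S}"
  using closed_vimage[OF _ continuous_tv_path, of S t] by (simp add: vimage_def)

lemma closed_starts_at: "closed {p. starts_at p z}"
proof (cases z)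
  case (Pair x t)
  have "{p. starts_at p z} = {p. start p = ereal t} \<inter> {p. tv p t \<in> {tanh x}}"
    by (auto simp: Pair starts_at_iff)
  then show ?thesis using closed_Int[OF closed_start_eq closed_tv[of "{tanh x}"]] by simp
qed

lemma le_on_Rats_imp_le:
  fixes f g :: "real \<Rightarrow> real"
  assumes "continuous_on UNIV f" "continuous_on UNIV g" "\<And>t. t \<in> \<rat> \<Longrightarrow> f t \<le> g t"
  shows "f t \<le> g t"
proof -
  have "closed {t. f t \<le> g t}" by (intro closed_Collect_le assms)
  then have "UNIV \<subseteq> {t. f t \<le> g t}"
    using closure_minimal[of \<rat> "{t. f t \<le> g t}"] assms(3) by (auto simp: Rats_closure_real)
  then show ?thesis by blast
qed

lemma eq_on_rationals_after:
  fixes f g :: "real \<Rightarrow> real"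
  assumes f: "continuous_on UNIV f" and g: "continuous_on UNIV g"
    and eq: "\<And>r. r \<in> \<rat> \<Longrightarrow> v < r \<Longrightarrow> f r = g r" and "f v = g v" "v \<le> u"
  shows "f u = g u"
proof (cases "u = v")
  case False
  have "closed {t. f t = g t}" by (intro closed_Collect_eq f g)
  moreover have "u \<in> closure {t. f t = g t}"
    unfolding closure_approachable
  proof safe
    fix e :: real assume "0 < e"
    then obtain r where "r \<in> \<rat>" "u < r" "r < u + e" using Rats_dense_in_real[of u "u + e"] by auto
    then show "\<exists>y\<in>{t. f t = g t}. dist y u < e"
      using eq[of r] \<open>v \<le> u\<close> by (intro bexI[of _ r]) (auto simp: dist_real_def)
  qed
  ultimately show ?thesis by (simp add: closure_closed)
qed (use assms in simp)

lemma dist_path_le_iff: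
  "dist p q \<le> c \<longleftrightarrow> \<bar>Psi (start p) - Psi (start q)\<bar> \<le> c \<and> (\<forall>t\<in>\<rat>. \<bar>tv p t - tv q t\<bar> \<le> c * (1 + \<bar>t\<bar>))"
proof
  assume *: "dist p q \<le> c"
  have "\<bar>tv p t - tv q t\<bar> \<le> c * (1 + \<bar>t\<bar>)" for t
    using tv_dist[of p t q] mult_right_mono[OF *, of "1 + \<bar>t\<bar>"] by (simp add: mult.commute)
  then show "\<bar>Psi (start p) - Psi (start q)\<bar> \<le> c \<and> (\<forall>t\<in>\<rat>. \<bar>tv p t - tv q t\<bar> \<le> c * (1 + \<bar>t\<bar>))"
    using start_dist[of p q] * by auto
next
  assume *: "\<bar>Psi (start p) - Psi (start q)\<bar> \<le> c \<and> (\<forall>t\<in>\<rat>. \<bar>tv p t - tv q t\<bar> \<le> c * (1 + \<bar>t\<bar>))"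
  show "dist p q \<le> c"
  proof (rule dist_path_leI)
    fix t
    show "\<bar>tv p t - tv q t\<bar> \<le> c * (1 + \<bar>t\<bar>)"
      by (rule le_on_Rats_imp_le[where f = "\<lambda>t. \<bar>tv p t - tv q t\<bar>" and g = "\<lambda>t. c * (1 + \<bar>t\<bar>)"])
        (use * in \<open>auto intro!: continuous_intros\<close>)
  qed (use * in auto)
qed

lemma measurable_into_separable_metric:
  fixes f :: "'a \<Rightarrow> 'b::{metric_space, second_countable_topology}"
  assumes "\<And>q. (\<lambda>x. dist (f x) q) \<in> borel_measurable M"
  shows "f \<in> borel_measurable M"
proof (rule borel_measurableI)
  fix S :: "'b set" assume S: "open S"
  show "f -` S \<inter> space M \<in> sets M"
  proof -
  define \<F> where "\<F> = {ball q e | q e. ball q e \<subseteq> S}"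
  have SU: "S = \<Union>\<F>"
  proof
    show "S \<subseteq> \<Union>\<F>"
    proof
      fix x assume "x \<in> S"
      then obtain e where "e > 0" "ball x e \<subseteq> S" using S openE by metis
      then show "x \<in> \<Union>\<F>" unfolding \<F>_def by (intro UnionI[of "ball x e"]) auto
    qed
  qed (auto simp: \<F>_def)
  obtain \<F>' where F': "\<F>' \<subseteq> \<F>" "countable \<F>'" "\<Union>\<F>' = \<Union>\<F>"
    using Lindelof[of \<F>] unfolding \<F>_def by force
  have "f -` S \<inter> space M = (\<Union>B\<in>\<F>'. f -` B \<inter> space M)"
    unfolding SU F'(3)[symmetric] by auto
  also have "\<dots> \<in> sets M"
  proof (rule sets.countable_UN''[OF F'(2)])
    fix B assume "B \<in> \<F>'"
    then obtain q e where B: "B = ball q e" using F'(1) by (auto simp: \<F>_def)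
    have "f -` B \<inter> space M = {x \<in> space M. dist (f x) q < e}" by (auto simp: B dist_commute)
    also have "\<dots> \<in> sets M" using assms by measurable
    finally show "f -` B \<inter> space M \<in> sets M" .
  qed
  finally show "f -` S \<inter> space M \<in> sets M" .
  qed
qed

text \<open>A path-valued map with a deterministic starting time is Borel as soon as its values at each
  time are, because the distance of two paths is determined by their values at rational times.\<close>

lemma measurable_path_valued:
  assumes st: "\<And>x. x \<in> space M \<Longrightarrow> start (f x) = ereal t"
    and tv: "\<And>s. t \<le> s \<Longrightarrow> (\<lambda>x. tv (f x) s) \<in> borel_measurable M"
  shows "f \<in> borel_measurable M"
proof (rule measurable_into_separable_metric, rule borel_measurable_iff_le[THEN iffD2], safe)
  fix q :: path and c :: real
  have tv': "(\<lambda>x. tv (f x) s) \<in> borel_measurable M" for s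
  proof (cases "t \<le> s")
    case False
    have "tv (f x) s = tv (f x) t" if "x \<in> space M" for x
      using False by (intro tv_before_start) (auto simp: st that)
    then show ?thesis using tv[of t] by (simp cong: measurable_cong)
  qed (rule tv)
  have "{x \<in> space M. dist (f x) q \<le> c} = {x \<in> space M. \<bar>Psi (ereal t) - Psi (start q)\<bar> \<le> c \<and>
      (\<forall>s\<in>\<rat>. \<bar>tv (f x) s - tv q s\<bar> \<le> c * (1 + \<bar>s\<bar>))}"
    by (auto simp: dist_path_le_iff st)
  also have "\<dots> \<in> sets M"
  proof (intro sets.sets_Collect_conj sets.sets_Collect_countable_All' sets.sets_Collect_const countable_rat)
    fix s :: real
    note tv'[of s, measurable]
    show "{x \<in> space M. \<bar>tv (f x) s - tv q s\<bar> \<le> c * (1 + \<bar>s\<bar>)} \<in> sets M" by measurable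
  qed
  finally show "{x \<in> space M. dist (f x) q \<le> c} \<in> sets M" .
qed


section \<open>Borel functions of a compact set of paths\<close>

lemma compact_paths_of: "compact (paths_of K)" and paths_of_nonempty: "paths_of K \<noteq> {}"
  using paths_of[of K] by auto

lemma paths_of_Abs: "compact A \<Longrightarrow> A \<noteq> {} \<Longrightarrow> paths_of (Abs_path_set A) = A"
  by (simp add: Abs_path_set_inverse)

lemma infdist_less_dist_exists:
  assumes "infdist x A < e" "A \<noteq> {}" shows "\<exists>y\<in>A. dist x y < e"
  using assms by (simp add: infdist_notempty cINF_less_iff)

text \<open>The distance of a compact set from a disjoint closed set is positive, and a set within that
  Hausdorff distance does not reach the closed set either.\<close>

lemma closed_hit:
  assumes F: "closed F"
  shows "closed {K. paths_of K \<inter> F \<noteq> {}}"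
  unfolding closed_def open_dist
proof (intro ballI)
  fix K assume "K \<in> - {K. paths_of K \<inter> F \<noteq> {}}"
  then have disj: "paths_of K \<inter> F = {}" by simp
  show "\<exists>e>0. \<forall>L. dist L K < e \<longrightarrow> L \<in> - {K. paths_of K \<inter> F \<noteq> {}}"
  proof (cases "F = {}")
    case False
    obtain p where p: "p \<in> paths_of K" "\<And>q. q \<in> paths_of K \<Longrightarrow> infdist p F \<le> infdist q F"
      using continuous_attains_inf[OF compact_paths_of[of K] paths_of_nonempty continuous_on_infdist[OF continuous_on_id, of _ F]]
      by auto
    have pos: "0 < infdist p F"
      using p(1) disj F False in_closed_iff_infdist_zero[of F p] infdist_nonneg[of p F] by auto
    show ?thesis
    proof (intro exI[of _ "infdist p F"] conjI allI impI pos)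
      fix L assume L: "dist L K < infdist p F"
      have "q \<notin> F" if "q \<in> paths_of L" for q
      proof
        assume q: "q \<in> F"
        have "infdist q (paths_of K) \<le> hausdorff_dist (paths_of L) (paths_of K)"
          by (rule infdist_le_hausdorff_dist[OF compact_paths_of that])
        with L have "infdist q (paths_of K) < infdist p F" by (simp add: dist_path_set.rep_eq)
        then obtain r where r: "r \<in> paths_of K" "dist q r < infdist p F"
          using infdist_less_dist_exists paths_of_nonempty by blast
        have "infdist r F \<le> dist r q" by (rule infdist_le[OF q])
        with r p(2)[OF r(1)] show False by (simp add: dist_commute)
      qed
      then show "L \<in> - {K. paths_of K \<inter> F \<noteq> {}}" by auto
    qed
  qed (auto intro: exI[of _ 1])
qed

lemma sets_hit: "closed F \<Longrightarrow> {K. paths_of K \<inter> F \<noteq> {}} \<in> sets borel"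
  by (intro borel_closed closed_hit)

definition uniq_from :: "path_set \<Rightarrow> real \<times> real \<Rightarrow> bool" where
  "uniq_from K z \<longleftrightarrow> (\<exists>!p. p \<in> paths_of K \<and> starts_at p z)"

lemma path_from_uniq:
  assumes "uniq_from K z"
  shows "path_from K z \<in> paths_of K" "starts_at (path_from K z) z"
    and "p \<in> paths_of K \<Longrightarrow> starts_at p z \<Longrightarrow> p = path_from K z"
proof -
  have ex: "\<exists>!p. p \<in> paths_of K \<and> starts_at p z" using assms by (simp add: uniq_from_def)
  then have eq: "path_from K z = (THE p. p \<in> paths_of K \<and> starts_at p z)" by (simp add: path_from_def)
  show "path_from K z \<in> paths_of K" "starts_at (path_from K z) z"
    using theI'[OF ex] by (simp_all add: eq)
  then show "p \<in> paths_of K \<Longrightarrow> starts_at p z \<Longrightarrow> p = path_from K z" using ex by blast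
qed

text \<open>Two different paths of a compact set that start from the same point are separated by the closures
  of two sets of a countable basis, which makes non-uniqueness a countable union of hitting conditions.\<close>

lemma sets_uniq_from: "{K. uniq_from K z} \<in> sets borel"
proof -
  define S where "S = {p. starts_at p z}"
  have S: "closed S" unfolding S_def by (rule closed_starts_at)
  obtain B :: "path set set" where B: "countable B" "topological_basis B"
    using ex_countable_basis by blast
  define D where "D = {(U, V). U \<in> B \<and> V \<in> B \<and> closure U \<inter> closure V = {}}"
  have cD: "countable D" by (rule countable_subset[of _ "B \<times> B"]) (use B in \<open>auto simp: D_def\<close>)
  have sep: "\<exists>UV\<in>D. p \<in> closure (fst UV) \<and> q \<in> closure (snd UV)" if "p \<noteq> q" for p q :: path
  proof -
    define e where "e = dist p q / 3"
    have e: "e > 0" using that by (simp add: e_def)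
    obtain U where U: "U \<in> B" "p \<in> U" "U \<subseteq> ball p e"
      using topological_basisE[OF B(2) open_ball, of p p e] e by auto
    obtain V where V: "V \<in> B" "q \<in> V" "V \<subseteq> ball q e"
      using topological_basisE[OF B(2) open_ball, of q q e] e by auto
    have "closure U \<subseteq> cball p e" "closure V \<subseteq> cball q e"
      using U(3) V(3) by (meson closure_minimal closed_cball ball_subset_cball subset_trans)+
    moreover have "cball p e \<inter> cball q e = {}"
    proof (rule equals0I)
      fix x assume "x \<in> cball p e \<inter> cball q e"
      then have "dist p q \<le> e + e" using dist_triangle2[of p q x] by auto
      then show False using e by (simp add: e_def)
    qed
    ultimately have "closure U \<inter> closure V = {}" by blast
    moreover have "p \<in> closure U" "q \<in> closure V" using U V closure_subset by blast+
    ultimately show ?thesis unfolding D_def using U V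
      by (intro bexI[of _ "(U, V)"]) auto
  qed
  have "{K. uniq_from K z} = {K. paths_of K \<inter> S \<noteq> {}} -
      (\<Union>UV\<in>D. {K. paths_of K \<inter> (S \<inter> closure (fst UV)) \<noteq> {}} \<inter> {K. paths_of K \<inter> (S \<inter> closure (snd UV)) \<noteq> {}})"
    (is "?l = ?r - ?u")
  proof (intro set_eqI iffI)
    fix K assume "K \<in> ?l"
    then have u: "\<exists>!p. p \<in> paths_of K \<and> starts_at p z" by (simp add: uniq_from_def)
    then have "K \<in> ?r" by (auto simp: S_def)
    moreover have "K \<notin> ?u"
      using u by (fastforce simp: S_def D_def)
    ultimately show "K \<in> ?r - ?u" by blast
  next
    fix K assume K: "K \<in> ?r - ?u"
    then obtain p where p: "p \<in> paths_of K" "starts_at p z" by (auto simp: S_def)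
    have "q = p" if "q \<in> paths_of K" "starts_at q z" for q
    proof (rule ccontr)
      assume "q \<noteq> p"
      from sep[OF this] obtain UV where "UV \<in> D" "q \<in> closure (fst UV)" "p \<in> closure (snd UV)" by blast
      then have "K \<in> ?u" using p that by (auto simp: S_def)
      with K show False by blast
    qed
    with p show "K \<in> ?l" by (auto simp: uniq_from_def)
  qed
  also have "\<dots> \<in> sets borel"
    by (intro sets.Diff sets.countable_UN'' cD sets.Int sets_hit closed_Int S) auto
  finally show ?thesis .
qed

lemma measurable_path_from [measurable]: "(\<lambda>K. path_from K z) \<in> borel_measurable borel"
proof (rule borel_measurableI)
  fix S :: "path set" assume "open S"
  define F where "F = - S"
  have F: "closed F" using \<open>open S\<close> by (simp add: F_def closed_Compl)
  have *: "(\<lambda>K. path_from K z) -` F =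
      {K. uniq_from K z} \<inter> {K. paths_of K \<inter> (F \<inter> {p. starts_at p z}) \<noteq> {}}
      \<union> (if undefined \<in> F then - {K. uniq_from K z} else {})" (is "_ = ?r")
  proof (intro set_eqI iffI)
    fix K assume K: "K \<in> (\<lambda>K. path_from K z) -` F"
    show "K \<in> ?r"
    proof (cases "uniq_from K z")
      case True
      then show ?thesis using K path_from_uniq(1,2)[OF True] by auto
    next
      case False
      then have "path_from K z = undefined" by (simp add: path_from_def uniq_from_def)
      then show ?thesis using K False by auto
    qed
  next
    fix K assume K: "K \<in> ?r"
    show "K \<in> (\<lambda>K. path_from K z) -` F"
    proof (cases "uniq_from K z")
      case True
      then obtain p where "p \<in> paths_of K" "p \<in> F" "starts_at p z" using K by (auto split: if_splits)
      then have "p = path_from K z" using path_from_uniq(3)[OF True] by blast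
      then show ?thesis using \<open>p \<in> F\<close> by simp
    next
      case False
      then have "path_from K z = undefined" by (simp add: path_from_def uniq_from_def)
      then show ?thesis using K False by (auto split: if_splits)
    qed
  qed
  have "?r \<in> sets borel"
    using sets_uniq_from[of z] sets_hit[of "F \<inter> {p. starts_at p z}"] F closed_starts_at[of z]
    by (auto intro!: sets.Un sets.Int)
  then have "(\<lambda>K. path_from K z) -` F \<in> sets borel" unfolding * .
  moreover have "(\<lambda>K. path_from K z) -` S = - ((\<lambda>K. path_from K z) -` F)" by (auto simp: F_def)
  ultimately show "(\<lambda>K. path_from K z) -` S \<inter> space borel \<in> sets borel" by simp
qed

text \<open>Having at least \<open>k\<close> elements amounts to hitting \<open>k\<close> disjoint intervals with rational end points. The
  intervals are closed so that \<open>closed_hit\<close> applies.\<close>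

lemma enat_card_ge_iff_intervals:
  fixes A :: "real set"
  shows "enat k \<le> (if finite A then enat (card A) else \<infinity>) \<longleftrightarrow>
    (\<exists>L :: (rat \<times> rat) list. length L = k \<and>
      (\<forall>i<k. A \<inter> {of_rat (fst (L!i))..of_rat (snd (L!i))} \<noteq> {}) \<and>
      (\<forall>i<k. \<forall>j<k. i \<noteq> j \<longrightarrow> {of_rat (fst (L!i))..of_rat (snd (L!i))} \<inter> {of_rat (fst (L!j))..of_rat (snd (L!j)) :: real} = {}))"
    (is "?l \<longleftrightarrow> (\<exists>L. ?P L)")
proof
  assume ?l
  then obtain B where B: "B \<subseteq> A" "finite B" "card B = k"
    by (metis enat_ord_simps(1) infinite_arbitrarily_large obtain_subset_with_card_n)
  define xs where "xs = sorted_list_of_set B"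
  have xs: "length xs = k" "distinct xs" "set xs = B"
    using B by (simp_all add: xs_def)
  \<comment> \<open>a lower bound for the distances between the elements of \<open>B\<close>; the \<open>1\<close> keeps the set nonempty\<close>
  define r where "r = Min (insert 1 ((\<lambda>(x, y). \<bar>x - y\<bar>) ` {(x, y) \<in> B \<times> B. x \<noteq> y}))"
  have fin: "finite (insert 1 ((\<lambda>(x, y). \<bar>x - y\<bar>) ` {(x, y) \<in> B \<times> B. x \<noteq> y}))"
    using B(2) by (auto intro!: finite_imageI intro: finite_subset[of _ "B \<times> B"])
  have r: "0 < r" unfolding r_def using fin by (subst Min_gr_iff) auto
  have rle: "r \<le> \<bar>x - y\<bar>" if "x \<in> B" "y \<in> B" "x \<noteq> y" for x y
    unfolding r_def by (rule Min_le[OF fin]) (use that in \<open>force simp: image_iff\<close>)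
  have "\<exists>cd :: rat \<times> rat. x - r/3 < of_rat (fst cd) \<and> of_rat (fst cd) < x \<and> x < of_rat (snd cd) \<and> of_rat (snd cd) < x + r/3" for x
    using of_rat_dense[of "x - r/3" x] of_rat_dense[of x "x + r/3"] r by auto
  then obtain cd :: "real \<Rightarrow> rat \<times> rat"
    where cd: "\<And>x. x - r/3 < of_rat (fst (cd x)) \<and> of_rat (fst (cd x)) < x \<and> x < of_rat (snd (cd x)) \<and> of_rat (snd (cd x)) < x + r/3"
    by metis
  have "?P (map cd xs)"
  proof (intro conjI allI impI)
    show "length (map cd xs) = k" using xs by simp
  next
    fix i assume "i < k"
    then have "xs ! i \<in> A \<inter> {of_rat (fst (map cd xs ! i))..of_rat (snd (map cd xs ! i))}"
      using xs B cd[of "xs ! i"] nth_mem[of i xs] by auto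
    then show "A \<inter> {of_rat (fst (map cd xs ! i))..of_rat (snd (map cd xs ! i))} \<noteq> {}" by blast
  next
    fix i j assume ij: "i < k" "j < k" "i \<noteq> j"
    then have "xs ! i \<noteq> xs ! j" using xs nth_eq_iff_index_eq by blast
    then have "r \<le> \<bar>xs ! i - xs ! j\<bar>" using ij xs by (intro rle) auto
    then show "{of_rat (fst (map cd xs ! i))..of_rat (snd (map cd xs ! i))} \<inter> {of_rat (fst (map cd xs ! j))..of_rat (snd (map cd xs ! j)) :: real} = {}"
      using ij xs cd[of "xs ! i"] cd[of "xs ! j"] by auto
  qed
  then show "\<exists>L. ?P L" by blast
next
  assume "\<exists>L. ?P L"
  then obtain L where L: "?P L" by blast
  then have "\<forall>i<k. \<exists>x. x \<in> A \<inter> {of_rat (fst (L!i))..of_rat (snd (L!i))}" by blast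
  then obtain f where f: "\<And>i. i < k \<Longrightarrow> f i \<in> A \<inter> {of_rat (fst (L!i))..of_rat (snd (L!i))}" by metis
  have inj: "inj_on f {..<k}"
  proof (rule inj_onI, rule ccontr)
    fix i j assume ij: "i \<in> {..<k}" "j \<in> {..<k}" "f i = f j" "i \<noteq> j"
    then have "f i \<in> {of_rat (fst (L!i))..of_rat (snd (L!i))} \<inter> {of_rat (fst (L!j))..of_rat (snd (L!j))}"
      using f[of i] f[of j] by auto
    then show False using L ij by blast
  qed
  have sub: "f ` {..<k} \<subseteq> A" using f by blast
  show ?l
  proof (cases "finite A")
    case True
    then show ?thesis using card_mono[OF True sub] card_image[OF inj] by simp
  qed simp
qed

text \<open>The first coordinates of the touched points at time \<open>u\<close>, expressed in terms of \<open>tv\<close>.\<close>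

definition touched_reals :: "path_set \<Rightarrow> real \<Rightarrow> real \<Rightarrow> real \<Rightarrow> real \<Rightarrow> real set" where
  "touched_reals K s u a b = {x. \<exists>p\<in>paths_of K. start p \<le> ereal s \<and> tanh a \<le> tv p s \<and> tv p s \<le> tanh b \<and> tv p u = tanh x}"

lemma touched_points_eq:
  assumes "0 < t"
  shows "touched_points K t0 t a b = touched_reals K t0 (t0 + t) a b \<times> {t0 + t}"
proof -
  have le: "start p \<le> ereal (t0 + t)" if "start p \<le> ereal t0" for p
    using that assms by (metis ereal_less_eq(3) less_add_same_cancel1 less_eq_real_def order_trans)
  have "(\<exists>y\<in>{a..b} \<times> {t0}. touches p y) \<longleftrightarrow> start p \<le> ereal t0 \<and> tanh a \<le> tv p t0 \<and> tv p t0 \<le> tanh b" for p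
  proof
    assume "\<exists>y\<in>{a..b} \<times> {t0}. touches p y"
    then show "start p \<le> ereal t0 \<and> tanh a \<le> tv p t0 \<and> tv p t0 \<le> tanh b"
      by (auto simp: touches_iff)
  next
    assume *: "start p \<le> ereal t0 \<and> tanh a \<le> tv p t0 \<and> tv p t0 \<le> tanh b"
    then obtain x where x: "tv p t0 = tanh x"
      using tanh_surj[of "tv p t0"] tanh_real_bounds[of a] tanh_real_bounds[of b] by fastforce
    then show "\<exists>y\<in>{a..b} \<times> {t0}. touches p y"
      using * by (intro bexI[of _ "(x, t0)"]) (auto simp: touches_iff)
  qed
  note iff = this
  show ?thesis unfolding touched_points_def touched_reals_def iff
    using le by (auto simp: touches_iff) blast
qed

lemma eta_eq:
  assumes "0 < t"
  shows "eta K t0 t a b = (let A = touched_reals K t0 (t0 + t) a b in if finite A then enat (card A) else \<infinity>)"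
  unfolding eta_def touched_points_eq[OF assms]
  by (simp add: Let_def finite_cartesian_product_iff card_cartesian_product)

lemma measurable_eta:
  assumes "0 < t"
  shows "(\<lambda>K. eta K t0 t a b) \<in> measurable borel (count_space UNIV)"
proof -
  let ?A = "\<lambda>K. touched_reals K t0 (t0 + t) a b"
  define F where "F c d = {p. start p \<le> ereal t0} \<inter> {p. tv p t0 \<in> {tanh a..tanh b}} \<inter> {p. tv p (t0 + t) \<in> {tanh c..tanh d}}" for c d
  have hit: "?A K \<inter> {c..d} \<noteq> {} \<longleftrightarrow> paths_of K \<inter> F c d \<noteq> {}" for K c d
  proof
    assume "paths_of K \<inter> F c d \<noteq> {}"
    then obtain p where p: "p \<in> paths_of K" "p \<in> F c d" by blast
    then obtain x where "tv p (t0 + t) = tanh x"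
      using tanh_surj[of "tv p (t0 + t)"] tanh_real_bounds[of c] tanh_real_bounds[of d] by (fastforce simp: F_def)
    then show "?A K \<inter> {c..d} \<noteq> {}" using p by (auto simp: F_def touched_reals_def)
  qed (force simp: F_def touched_reals_def)
  have F: "closed (F c d)" for c d unfolding F_def
    by (intro closed_Int closed_start_le closed_tv closed_atLeastAtMost)
  have ge: "{K. enat k \<le> eta K t0 t a b} \<in> sets borel" for k
  proof -
    have "{K. enat k \<le> eta K t0 t a b} = (\<Union>L\<in>{L :: (rat \<times> rat) list. length L = k \<and>
        (\<forall>i<k. \<forall>j<k. i \<noteq> j \<longrightarrow> {of_rat (fst (L!i))..of_rat (snd (L!i))} \<inter> {of_rat (fst (L!j))..of_rat (snd (L!j)) :: real} = {})}.
        {K \<in> space borel. \<forall>i\<in>{..<k}. paths_of K \<inter> F (of_rat (fst (L!i))) (of_rat (snd (L!i))) \<noteq> {}})"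
      unfolding eta_eq[OF assms] Let_def enat_card_ge_iff_intervals hit by auto
    also have "\<dots> \<in> sets borel"
    proof (intro sets.countable_UN'' sets.sets_Collect_countable_All')
      fix L :: "(rat \<times> rat) list" and i
      show "{K \<in> space borel. paths_of K \<inter> F (of_rat (fst (L!i))) (of_rat (snd (L!i))) \<noteq> {}} \<in> sets borel"
        using sets_hit[OF F] by simp
    qed auto
    finally show ?thesis .
  qed
  show ?thesis
  proof (subst measurable_count_space_eq2_countable, safe)
    fix y :: enat
    have "{K. eta K t0 t a b = y} \<in> sets borel"
    proof (cases y)
      case (enat k)
      have "{K. eta K t0 t a b = y} = {K. enat k \<le> eta K t0 t a b} - {K. enat (Suc k) \<le> eta K t0 t a b}"
        by (auto simp: enat Suc_ile_eq not_less)
      then show ?thesis using ge by auto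
    next
      case infinity
      have "{K. eta K t0 t a b = y} = (\<Inter>k. {K. enat k \<le> eta K t0 t a b})"
      proof (intro set_eqI iffI)
        fix K assume K: "K \<in> (\<Inter>k. {K. enat k \<le> eta K t0 t a b})"
        have "eta K t0 t a b = \<infinity>"
        proof (cases "eta K t0 t a b")
          case (enat n)
          have "enat (Suc n) \<le> eta K t0 t a b" using K by blast
          then show ?thesis by (simp add: enat)
        qed
        then show "K \<in> {K. eta K t0 t a b = y}" by (simp add: infinity)
      qed (simp add: infinity)
      then show ?thesis using ge by auto
    qed
    then show "(\<lambda>K. eta K t0 t a b) -` {y} \<inter> space borel \<in> sets borel" by (simp add: vimage_def)
  qed auto
qed

lemma measurable_eta_hat:
  assumes "0 < t"
  shows "(\<lambda>K. eta_hat K t0 t a b) \<in> borel_measurable borel"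
  unfolding eta_hat_def
  by (rule measurable_compose[OF measurable_eta[OF assms], of "\<lambda>n. ereal_of_enat n - 1"]) simp

text \<open>The set formed by finitely many paths depends continuously on these paths.\<close>

definition finite_path_set :: "nat \<Rightarrow> (nat \<Rightarrow> path) \<Rightarrow> path_set" where
  "finite_path_set n p = Abs_path_set (p ` {..n})"

lemma paths_of_finite_path_set: "paths_of (finite_path_set n p) = p ` {..n}"
  unfolding finite_path_set_def by (rule paths_of_Abs) (auto intro: finite_imp_compact)

lemma dist_finite_path_set_le:
  assumes "\<And>i. i \<le> n \<Longrightarrow> dist (p i) (q i) \<le> e"
  shows "dist (finite_path_set n p) (finite_path_set n q) \<le> e"
  unfolding dist_path_set.rep_eq paths_of_finite_path_set
proof (rule hausdorff_dist_le)
  show "infdist x (q ` {..n}) \<le> e" if "x \<in> p ` {..n}" for x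
    using that assms by (auto intro!: infdist_le2)
  show "infdist x (p ` {..n}) \<le> e" if "x \<in> q ` {..n}" for x
    using that assms by (auto intro!: infdist_le2 simp: dist_commute)
qed auto

lemma measurable_finite_path_set:
  "finite_path_set n \<in> measurable (PiM UNIV (\<lambda>_. borel)) borel"
proof -
  have "finite_path_set n \<in> borel_measurable borel"
  proof (rule borel_measurableI)
    fix U :: "path_set set" assume U: "open U"
    have "open (finite_path_set n -` U)"
    proof (subst open_subopen, safe)
      fix p assume "finite_path_set n p \<in> U"
      then obtain e where e: "e > 0" "ball (finite_path_set n p) e \<subseteq> U" using U by (metis openE)
      define V where "V = Pi\<^sub>E UNIV (\<lambda>i. if i \<le> n then ball (p i) (e / 2) else UNIV)"
      have "open V" unfolding V_def
        by (intro open_PiE) (auto intro: finite_subset[of _ "{..n}"] split: if_splits)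
      moreover have "p \<in> V" using e by (auto simp: V_def)
      moreover have "V \<subseteq> finite_path_set n -` U"
      proof safe
        fix q assume q: "q \<in> V"
        have "dist (finite_path_set n p) (finite_path_set n q) \<le> e / 2"
        proof (rule dist_finite_path_set_le)
          fix i assume "i \<le> n"
          then show "dist (p i) (q i) \<le> e / 2" using q by (auto simp: V_def PiE_iff dest!: spec[of _ i])
        qed
        then show "q \<in> finite_path_set n -` U" using e by auto
      qed
      ultimately show "\<exists>T. open T \<and> p \<in> T \<and> T \<subseteq> finite_path_set n -` U" by blast
    qed
    then show "finite_path_set n -` U \<inter> space borel \<in> sets borel" by auto
  qed
  then show ?thesis using measurable_cong_sets[OF sets_PiM_equal_borel refl] by blast
qed


section \<open>Coalescence as a measurable operation\<close>

text \<open>By compactness a continuous function has a zero iff it takes arbitrarily small values, and these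
  are already taken at rational points or end points of the interval.\<close>

lemma sets_Collect_zero_on_interval:
  fixes f :: "'a \<Rightarrow> real \<Rightarrow> real"
  assumes meas: "\<And>u. u \<in> {a..b} \<Longrightarrow> (\<lambda>x. f x u) \<in> borel_measurable M"
    and cont: "\<And>x. x \<in> space M \<Longrightarrow> continuous_on {a..b} (f x)"
  shows "{x \<in> space M. \<exists>u\<in>{a..b}. f x u = 0} \<in> sets M"
proof (cases "a \<le> b")
  case ab: True
  define Q where "Q = (\<rat> \<inter> {a..b}) \<union> {a, b}"
  have Q: "countable Q" "Q \<subseteq> {a..b}" using ab countable_rat by (auto simp: Q_def)
  have "{x \<in> space M. \<exists>u\<in>{a..b}. f x u = 0} =
      {x \<in> space M. \<forall>n::nat. \<exists>u\<in>Q. \<bar>f x u\<bar> < 1 / real (Suc n)}"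
  proof (intro Collect_cong conj_cong refl iffI allI)
    fix x n assume x: "x \<in> space M" and "\<exists>u\<in>{a..b}. f x u = 0"
    then obtain u where u: "u \<in> {a..b}" "f x u = 0" by blast
    show "\<exists>u\<in>Q. \<bar>f x u\<bar> < 1 / real (Suc n)"
    proof (cases "u \<in> Q")
      case True
      then show ?thesis using u by (intro bexI[of _ u]) auto
    next
      case False
      then have ab: "a < u" "u < b" using u by (auto simp: Q_def less_le)
      obtain d where d: "d > 0" "\<And>v. v \<in> {a..b} \<Longrightarrow> dist v u < d \<Longrightarrow> dist (f x v) (f x u) < 1 / real (Suc n)"
        using cont[OF x] u(1) unfolding continuous_on_iff by (metis of_nat_0_less_iff zero_less_Suc zero_less_divide_1_iff)
      obtain q where q: "q \<in> \<rat>" "max a (u - d) < q" "q < min b (u + d)"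
      proof -
        have "max a (u - d) < min b (u + d)" using ab d(1) by linarith
        from Rats_dense_in_real[OF this] that show ?thesis by blast
      qed
      then have "q \<in> Q" "q \<in> {a..b}" "dist q u < d" by (auto simp: Q_def dist_real_def)
      then show ?thesis using d(2)[of q] u by (intro bexI[of _ q]) (auto simp: dist_real_def)
    qed
  next
    fix x assume x: "x \<in> space M" and *: "\<forall>n::nat. \<exists>u\<in>Q. \<bar>f x u\<bar> < 1 / real (Suc n)"
    have "continuous_on {a..b} (\<lambda>u. \<bar>f x u\<bar>)" by (intro continuous_intros cont x)
    then obtain v where v: "v \<in> {a..b}" "\<And>u. u \<in> {a..b} \<Longrightarrow> \<bar>f x v\<bar> \<le> \<bar>f x u\<bar>"
      using continuous_attains_inf[of "{a..b}" "\<lambda>u. \<bar>f x u\<bar>"] ab by auto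
    have "f x v = 0"
    proof (rule ccontr)
      assume "f x v \<noteq> 0"
      then obtain n where "1 / real (Suc n) < \<bar>f x v\<bar>" using nat_approx_posE[of "\<bar>f x v\<bar>"] by auto
      moreover obtain u where "u \<in> Q" "\<bar>f x u\<bar> < 1 / real (Suc n)" using * by blast
      ultimately show False using v(2)[of u] Q by fastforce
    qed
    then show "\<exists>u\<in>{a..b}. f x u = 0" using v by blast
  qed
  also have "\<dots> \<in> sets M"
  proof (intro sets.sets_Collect_countable_All sets.sets_Collect_countable_Ex' Q(1))
    fix n :: nat and u assume "u \<in> Q"
    then have [measurable]: "(\<lambda>x. f x u) \<in> borel_measurable M" using meas Q by blast
    show "{x \<in> space M. \<bar>f x u\<bar> < 1 / real (Suc n)} \<in> sets M" by measurable
  qed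
  finally show ?thesis .
qed simp

text \<open>The paths \<open>C 0, \<dots>, C (k - 1)\<close> and \<open>w\<close> start at times \<open>t 0, \<dots>, t k\<close>. The time at which \<open>w\<close> is
  absorbed and the index of the path that absorbs it are expressed by the predicate \<open>hits\<close>, which
  refers to compact time intervals only and is therefore measurable in the paths.\<close>

definition hits :: "(nat \<Rightarrow> real) \<Rightarrow> (nat \<Rightarrow> real \<Rightarrow> real) \<Rightarrow> nat \<Rightarrow> (real \<Rightarrow> real) \<Rightarrow> nat \<Rightarrow> real \<Rightarrow> bool" where
  "hits t C k w j r \<longleftrightarrow> (\<exists>u\<in>{max (t k) (t j)..r}. C j u - w u = 0)"

definition absorber :: "(nat \<Rightarrow> real) \<Rightarrow> (nat \<Rightarrow> real \<Rightarrow> real) \<Rightarrow> nat \<Rightarrow> (real \<Rightarrow> real) \<Rightarrow> nat" where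
  "absorber t C k w = (LEAST j. j < k \<and> (\<forall>r\<in>\<rat>. (\<exists>i<k. hits t C k w i r) \<longrightarrow> hits t C k w j r))"

context
  fixes t :: "nat \<Rightarrow> real" and C :: "nat \<Rightarrow> real \<Rightarrow> real" and k :: nat and w :: "real \<Rightarrow> real"
  assumes cC: "\<And>j. j < k \<Longrightarrow> continuous_on {t j..} (C j)" and cw: "continuous_on {t k..} w"
begin

lemma closed_meeting: "j < k \<Longrightarrow> closed {u. t k \<le> u \<and> t j \<le> u \<and> C j u = w u}"
proof -
  assume j: "j < k"
  have "continuous_on {max (t k) (t j)..} (\<lambda>u. C j u - w u)"
    by (intro continuous_intros continuous_on_subset[OF cC[OF j]] continuous_on_subset[OF cw]) auto
  then have "closed {u \<in> {max (t k) (t j)..}. C j u - w u = 0}"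
    by (intro continuous_closed_preimage_constant) auto
  also have "{u \<in> {max (t k) (t j)..}. C j u - w u = 0} = {u. t k \<le> u \<and> t j \<le> u \<and> C j u = w u}" by auto
  finally show ?thesis .
qed

lemma closed_meeting_times: "closed (meeting_times t C k w)"
proof -
  have "meeting_times t C k w = (\<Union>j<k. {u. t k \<le> u \<and> t j \<le> u \<and> C j u = w u})"
    by (auto simp: meeting_times_def)
  then show ?thesis using closed_meeting by auto
qed

lemma bdd_below_meeting_times: "bdd_below (meeting_times t C k w)"
  by (rule bdd_belowI[of _ "t k"]) (auto simp: meeting_times_def)

lemma Inf_meeting_times:
  assumes "meeting_times t C k w \<noteq> {}"
  shows "Inf (meeting_times t C k w) \<in> meeting_times t C k w"
  using closed_contains_Inf[OF assms bdd_below_meeting_times closed_meeting_times] .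

lemma meeting_before_iff:
  "meeting_times t C k w \<noteq> {} \<and> Inf (meeting_times t C k w) \<le> s \<longleftrightarrow> (\<exists>j<k. hits t C k w j s)"
proof
  assume *: "meeting_times t C k w \<noteq> {} \<and> Inf (meeting_times t C k w) \<le> s"
  then show "\<exists>j<k. hits t C k w j s" using Inf_meeting_times
    by (fastforce simp: hits_def meeting_times_def)
next
  assume "\<exists>j<k. hits t C k w j s"
  then obtain u where "u \<in> meeting_times t C k w" "u \<le> s"
    unfolding hits_def meeting_times_def by auto blast
  then show "meeting_times t C k w \<noteq> {} \<and> Inf (meeting_times t C k w) \<le> s"
    using cInf_lower[OF _ bdd_below_meeting_times] by fastforce
qed

text \<open>The path \<open>j\<close> is met at the first meeting time iff no meeting with any path can be completed by a rational
  time without a meeting with \<open>j\<close>: otherwise a rational time separates the two first meeting times.\<close>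

lemma meets_first_iff:
  assumes T: "meeting_times t C k w \<noteq> {}" and j: "j < k"
  defines "\<tau> \<equiv> Inf (meeting_times t C k w)"
  shows "t j \<le> \<tau> \<and> C j \<tau> = w \<tau> \<longleftrightarrow> (\<forall>r\<in>\<rat>. (\<exists>i<k. hits t C k w i r) \<longrightarrow> hits t C k w j r)"
proof
  assume *: "t j \<le> \<tau> \<and> C j \<tau> = w \<tau>"
  have "t k \<le> \<tau>" using Inf_meeting_times[OF T] by (simp add: meeting_times_def \<tau>_def)
  with * show "\<forall>r\<in>\<rat>. (\<exists>i<k. hits t C k w i r) \<longrightarrow> hits t C k w j r"
    unfolding meeting_before_iff[symmetric] by (auto simp: hits_def \<tau>_def)
next
  assume *: "\<forall>r\<in>\<rat>. (\<exists>i<k. hits t C k w i r) \<longrightarrow> hits t C k w j r"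
  let ?T = "{u. t k \<le> u \<and> t j \<le> u \<and> C j u = w u}"
  have "\<tau> \<in> closure ?T"
    unfolding closure_approachable
  proof safe
    fix e :: real assume "0 < e"
    then obtain r where r: "r \<in> \<rat>" "\<tau> < r" "r < \<tau> + e" using Rats_dense_in_real[of \<tau> "\<tau> + e"] by auto
    then have "hits t C k w j r" using * meeting_before_iff[of r] T by (auto simp: \<tau>_def)
    then obtain u where u: "u \<in> ?T" "u \<le> r" by (auto simp: hits_def)
    then have "u \<in> meeting_times t C k w" using j by (auto simp: meeting_times_def)
    then have "\<tau> \<le> u" unfolding \<tau>_def by (rule cInf_lower[OF _ bdd_below_meeting_times])
    with u r show "\<exists>y\<in>?T. dist y \<tau> < e" by (intro bexI[of _ u]) (auto simp: dist_real_def)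
  qed
  then show "t j \<le> \<tau> \<and> C j \<tau> = w \<tau>" using closed_meeting[OF j] by (simp add: closure_closed)
qed

lemma absorber_eq:
  assumes "meeting_times t C k w \<noteq> {}"
  shows "absorber t C k w = (LEAST j. j < k \<and> t j \<le> Inf (meeting_times t C k w) \<and>
    C j (Inf (meeting_times t C k w)) = w (Inf (meeting_times t C k w)))"
  unfolding absorber_def using meets_first_iff[OF assms] by (intro arg_cong[where f = Least] ext) auto

lemma merge_eq: "merge t C k w s = (if \<exists>j<k. hits t C k w j s then C (absorber t C k w) s else w s)"
proof (cases "meeting_times t C k w \<noteq> {} \<and> Inf (meeting_times t C k w) \<le> s")
  case True
  then have "meeting_times t C k w \<noteq> {}" by blast
  then show ?thesis using True
    by (simp only: meeting_before_iff[symmetric] merge_def Let_def absorber_eq if_True)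
next
  case False
  then show ?thesis by (simp only: meeting_before_iff[symmetric] merge_def Let_def if_False)
qed

lemma absorber_props:
  assumes "meeting_times t C k w \<noteq> {}"
  defines "\<tau> \<equiv> Inf (meeting_times t C k w)"
  shows "absorber t C k w < k" "t (absorber t C k w) \<le> \<tau>" "C (absorber t C k w) \<tau> = w \<tau>" "t k \<le> \<tau>"
proof -
  let ?P = "\<lambda>j. j < k \<and> t j \<le> \<tau> \<and> C j \<tau> = w \<tau>"
  have "\<exists>j. ?P j" "t k \<le> \<tau>" using Inf_meeting_times[OF assms(1)] by (auto simp: meeting_times_def \<tau>_def)
  then show "absorber t C k w < k" "t (absorber t C k w) \<le> \<tau>" "C (absorber t C k w) \<tau> = w \<tau>" "t k \<le> \<tau>"
    using LeastI_ex[of ?P] absorber_eq[OF assms(1)] by (simp_all add: \<tau>_def)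
qed

text \<open>At the meeting time the two pieces have the same value.\<close>

lemma continuous_merge: "continuous_on {t k..} (merge t C k w)"
proof (cases "meeting_times t C k w = {}")
  case True
  then have "merge t C k w = w" by (auto simp: merge_def)
  then show ?thesis using cw by simp
next
  case False
  define \<tau> where "\<tau> = Inf (meeting_times t C k w)"
  note a = absorber_props[OF False, folded \<tau>_def]
  let ?J = "absorber t C k w"
  have "continuous_on {t k..\<tau>} (merge t C k w)"
  proof (rule continuous_on_eq)
    show "continuous_on {t k..\<tau>} w" by (rule continuous_on_subset[OF cw]) auto
    fix s assume "s \<in> {t k..\<tau>}"
    then show "w s = merge t C k w s"
      using a absorber_eq[OF False] by (auto simp: merge_def Let_def \<tau>_def[symmetric])
  qed
  moreover have "continuous_on {\<tau>..} (merge t C k w)"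
  proof (rule continuous_on_eq)
    show "continuous_on {\<tau>..} (C ?J)" by (rule continuous_on_subset[OF cC]) (use a in auto)
    fix s assume "s \<in> {\<tau>..}"
    then show "C ?J s = merge t C k w s"
      using False absorber_eq[OF False] by (auto simp: merge_def Let_def \<tau>_def[symmetric])
  qed
  ultimately have "continuous_on ({t k..\<tau>} \<union> {\<tau>..}) (merge t C k w)"
    by (intro continuous_on_closed_Un) auto
  moreover have "{t k..\<tau>} \<union> {\<tau>..} = {t k..}" using a by auto
  ultimately show ?thesis by simp
qed

end

lemma merge_0: "merge t C 0 w = w"
  by (rule ext) (simp add: merge_def meeting_times_def)

lemma merge_two:
  assumes c0: "continuous_on {t 0..} (C 0)" and c1: "continuous_on {t 1..} w" and le: "t 0 \<le> t (1::nat)"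
  shows "merge t C 1 w u = (if \<exists>v\<in>{t 1..u}. C 0 v = w v then C 0 u else w u)"
proof -
  have h: "(\<exists>j<1. hits t C 1 w j u) \<longleftrightarrow> (\<exists>v\<in>{t 1..u}. C 0 v = w v)"
    using le by (auto simp: hits_def max_def)
  have "absorber t C 1 w = 0" if "\<exists>j<1. hits t C 1 w j u"
    using absorber_props(1)[of 1 t C w] meeting_before_iff[of 1 t C w u] c0 c1 that by auto
  then show ?thesis unfolding h[symmetric] using merge_eq[of 1 t C w u] c0 c1 by auto
qed

lemma measurable_merge:
  assumes cC: "\<And>x j. x \<in> space M \<Longrightarrow> j < k \<Longrightarrow> continuous_on {t j..} (C x j)"
    and cw: "\<And>x. x \<in> space M \<Longrightarrow> continuous_on {t k..} (w x)"
    and mC: "\<And>j s. j < k \<Longrightarrow> t j \<le> s \<Longrightarrow> (\<lambda>x. C x j s) \<in> borel_measurable M"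
    and mw: "\<And>s. t k \<le> s \<Longrightarrow> (\<lambda>x. w x s) \<in> borel_measurable M"
    and s: "t k \<le> s"
  shows "(\<lambda>x. merge t (C x) k (w x) s) \<in> borel_measurable M"
proof -
  have hit: "{x \<in> space M. hits t (C x) k (w x) j r} \<in> sets M" if "j < k" for j r
    unfolding hits_def
    using that by (intro sets_Collect_zero_on_interval borel_measurable_diff mC mw continuous_on_diff)
      (auto intro: continuous_on_subset[OF cC] continuous_on_subset[OF cw])
  have Hit: "{x \<in> space M. \<exists>j\<in>{..<k}. hits t (C x) k (w x) j r} \<in> sets M" for r
    by (intro sets.sets_Collect_finite_Ex hit) auto
  have Hit': "{x \<in> space M. \<exists>j<k. hits t (C x) k (w x) j r} \<in> sets M" for r
    using Hit[of r] by (simp only: Bex_def lessThan_iff)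
  have "{x \<in> space M. j < k \<and> (\<forall>r\<in>\<rat>. (\<exists>i<k. hits t (C x) k (w x) i r) \<longrightarrow> hits t (C x) k (w x) j r)} \<in> sets M" for j
  proof (cases "j < k")
    case True
    have "{x \<in> space M. \<forall>r\<in>\<rat>. (\<exists>i<k. hits t (C x) k (w x) i r) \<longrightarrow> hits t (C x) k (w x) j r} \<in> sets M"
      by (intro sets.sets_Collect_countable_All' sets.sets_Collect_imp Hit' hit True countable_rat)
    then show ?thesis using True by (simp only: simp_thms)
  next
    case False
    then show ?thesis by (simp only: simp_thms sets.empty_sets Collect_empty_eq[THEN iffD2])
  qed
  note sel = this
  have abs: "(\<lambda>x. absorber t (C x) k (w x)) \<in> measurable M (count_space UNIV)"
    unfolding absorber_def by (rule measurable_Least) (simp only: pred_def sel)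
  \<comment> \<open>outside the relevant indices the value is set to \<open>0\<close>, to have measurability for all \<open>j\<close>\<close>
  define C' where "C' x j = (if j < k \<and> t j \<le> s then C x j s else 0)" for x j
  have "(\<lambda>x. C' x j) \<in> borel_measurable M" for j
    unfolding C'_def by (cases "j < k \<and> t j \<le> s") (auto simp: mC)
  then have 1: "(\<lambda>x. C' x (absorber t (C x) k (w x))) \<in> borel_measurable M"
    by (rule measurable_compose_countable[OF _ abs])
  have "(\<lambda>x. if \<exists>j<k. hits t (C x) k (w x) j s then C' x (absorber t (C x) k (w x)) else w x s) \<in> borel_measurable M"
    by (rule measurable_If[OF 1 mw[OF s] Hit'])
  moreover have "merge t (C x) k (w x) s =
      (if \<exists>j<k. hits t (C x) k (w x) j s then C' x (absorber t (C x) k (w x)) else w x s)" if x: "x \<in> space M" for x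
  proof -
    have "absorber t (C x) k (w x) < k \<and> t (absorber t (C x) k (w x)) \<le> s" if h: "\<exists>j<k. hits t (C x) k (w x) j s"
    proof -
      have "meeting_times t (C x) k (w x) \<noteq> {} \<and> Inf (meeting_times t (C x) k (w x)) \<le> s"
        using meeting_before_iff[of k t "C x" "w x" s] cC[OF x] cw[OF x] h by blast
      then show ?thesis
        using absorber_props[of k t "C x" "w x"] cC[OF x] cw[OF x] by fastforce
    qed
    then show ?thesis
      using merge_eq[of k t "C x" "w x" s] cC[OF x] cw[OF x] by (auto simp: C'_def)
  qed
  ultimately show ?thesis by (simp cong: measurable_cong)
qed

text \<open>The paths are processed in the order of their indices, so that continuity and measurability of the
  earlier ones are available when the next one is merged into them.\<close>

lemma coalesce_regular:
  assumes cW: "\<And>x j. x \<in> space M \<Longrightarrow> j < n \<Longrightarrow> continuous_on {t j..} (W x j)"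
    and mW: "\<And>j s. j < n \<Longrightarrow> t j \<le> s \<Longrightarrow> (\<lambda>x. W x j s) \<in> borel_measurable M"
    and "k \<le> n" "j < k"
  shows "(\<forall>x\<in>space M. continuous_on {t j..} (coalesce t (W x) k j)) \<and>
    (\<forall>s\<ge>t j. (\<lambda>x. coalesce t (W x) k j s) \<in> borel_measurable M)"
  using assms(3,4)
proof (induction k arbitrary: j)
  case (Suc k)
  show ?case
  proof (cases "j = k")
    case False
    then show ?thesis using Suc by auto
  next
    case True
    have "k < n" using Suc.prems by simp
    then show ?thesis unfolding True using Suc.IH Suc.prems(1)
      by (auto intro!: continuous_merge measurable_merge cW mW)
  qed
qed simp

lemma measurable_coalescing_paths:
  assumes c: "\<And>\<omega> j. \<omega> \<in> space M \<Longrightarrow> j < n \<Longrightarrow> continuous_on {0..} (\<lambda>s. B j s \<omega>)"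
    and m: "\<And>j s. j < n \<Longrightarrow> 0 \<le> s \<Longrightarrow> B j s \<in> borel_measurable M"
  shows "coalescing_paths n z B \<in> measurable M (Pi\<^sub>M {..<n} (\<lambda>_. borel))"
  unfolding coalescing_paths_def
proof (rule measurable_restrict)
  fix j assume "j \<in> {..<n}"
  then have j: "j < n" by simp
  define t where "t i = snd (z i)" for i
  define W where "W \<omega> i s = fst (z i) + B i (s - snd (z i)) \<omega>" for \<omega> i s
  have cW: "continuous_on {t i..} (W \<omega> i)" if "\<omega> \<in> space M" "i < n" for \<omega> i
    unfolding W_def t_def
    by (intro continuous_intros continuous_on_compose2[OF c[OF that]]) auto
  have mW: "(\<lambda>\<omega>. W \<omega> i s) \<in> borel_measurable M" if "i < n" "t i \<le> s" for i s
    unfolding W_def using that by (intro borel_measurable_add borel_measurable_const m) (auto simp: t_def)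
  have reg: "\<And>\<omega>. \<omega> \<in> space M \<Longrightarrow> continuous_on {t j..} (coalesce t (W \<omega>) n j)"
    "\<And>s. t j \<le> s \<Longrightarrow> (\<lambda>\<omega>. coalesce t (W \<omega>) n j s) \<in> borel_measurable M"
    using coalesce_regular[of M n t W n j] cW mW j by auto
  have "(\<lambda>\<omega>. mk_path (coalesce t (W \<omega>) n j) (t j)) \<in> borel_measurable M"
  proof (rule measurable_path_valued)
    show "start (mk_path (coalesce t (W \<omega>) n j) (t j)) = ereal (t j)" if "\<omega> \<in> space M" for \<omega>
      by (rule start_mk_path[OF reg(1)[OF that]])
    fix s assume s: "t j \<le> s"
    have "(\<lambda>\<omega>. tanh (coalesce t (W \<omega>) n j s)) \<in> borel_measurable M"
      by (rule measurable_compose[OF reg(2)[OF s]])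
        (intro borel_measurable_continuous_onI continuous_intros, auto)
    then show "(\<lambda>\<omega>. tv (mk_path (coalesce t (W \<omega>) n j) (t j)) s) \<in> borel_measurable M"
      by (rule measurable_cong[THEN iffD1, rotated]) (simp add: tv_mk_path[OF reg(1)] s)
  qed
  then show "(\<lambda>\<omega>. mk_path (coalesce (\<lambda>i. snd (z i)) (\<lambda>i s. fst (z i) + B i (s - snd (z i)) \<omega>) n j) (snd (z j))) \<in> borel_measurable M"
    unfolding t_def W_def .
qed


section \<open>The law of coalescing Brownian motions is unique\<close>

lemma standard_BM_D:
  assumes "standard_BM N B"
  shows "0 \<le> s \<Longrightarrow> B s \<in> borel_measurable N"
    and "\<omega> \<in> space N \<Longrightarrow> B 0 \<omega> = 0"
    and "\<omega> \<in> space N \<Longrightarrow> continuous_on {0..} (\<lambda>s. B s \<omega>)"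
    and "0 \<le> s \<Longrightarrow> s < t \<Longrightarrow> distributed N lborel (\<lambda>\<omega>. B t \<omega> - B s \<omega>) (normal_density 0 (sqrt (t - s)))"
    and "0 \<le> r 0 \<Longrightarrow> (\<And>i. i < k \<Longrightarrow> r i < r (Suc i)) \<Longrightarrow>
        prob_space.indep_vars N (\<lambda>_. borel) (\<lambda>i \<omega>. B (r (Suc i)) \<omega> - B (r i) \<omega>) {..<k}"
  using assms unfolding standard_BM_def by blast+

lemma grid_nonneg:
  fixes r :: "nat \<Rightarrow> real"
  assumes "0 \<le> r 0" "\<And>i. i < k \<Longrightarrow> r i < r (Suc i)" "i \<le> k"
  shows "0 \<le> r i"
  using assms(3)
proof (induction i)
  case (Suc i)
  then show ?case using assms(2)[of i] by auto
qed (use assms in auto)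

text \<open>The joint law of the increments is a product of normal laws which depends on the grid only.\<close>

lemma distr_increments:
  assumes N: "prob_space N" and B: "standard_BM N B"
    and r: "0 \<le> r 0" "\<And>i. i < k \<Longrightarrow> r i < r (Suc i)" and k: "0 < k"
  shows "distr N (Pi\<^sub>M {..<k} (\<lambda>_. borel)) (\<lambda>\<omega>. \<lambda>i\<in>{..<k}. B (r (Suc i)) \<omega> - B (r i) \<omega>) =
    Pi\<^sub>M {..<k} (\<lambda>i. distr (density lborel (normal_density 0 (sqrt (r (Suc i) - r i)))) borel (\<lambda>x. x))"
proof -
  interpret prob_space N by fact
  note D = standard_BM_D[OF B]
  have ge0: "0 \<le> r i" if "i \<le> k" for i using grid_nonneg[OF r that] .
  have rv: "random_variable borel (\<lambda>\<omega>. B (r (Suc i)) \<omega> - B (r i) \<omega>)" if "i \<in> {..<k}" for i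
    using that by (intro borel_measurable_diff D(1) ge0) auto
  have "distr N (Pi\<^sub>M {..<k} (\<lambda>_. borel)) (\<lambda>\<omega>. \<lambda>i\<in>{..<k}. B (r (Suc i)) \<omega> - B (r i) \<omega>) =
      Pi\<^sub>M {..<k} (\<lambda>i. distr N borel (\<lambda>\<omega>. B (r (Suc i)) \<omega> - B (r i) \<omega>))"
    using D(5)[of r k] r k rv by (subst indep_vars_iff_distr_eq_PiM'[symmetric]) auto
  also have "\<dots> = Pi\<^sub>M {..<k} (\<lambda>i. distr (density lborel (normal_density 0 (sqrt (r (Suc i) - r i)))) borel (\<lambda>x. x))"
  proof (rule PiM_cong[OF refl])
    fix i assume i: "i \<in> {..<k}"
    have "distr N lborel (\<lambda>\<omega>. B (r (Suc i)) \<omega> - B (r i) \<omega>) = density lborel (normal_density 0 (sqrt (r (Suc i) - r i)))"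
      using D(4)[of "r i" "r (Suc i)"] ge0[of i] r(2)[of i] i by (auto simp: distributed_def)
    then have "distr (density lborel (normal_density 0 (sqrt (r (Suc i) - r i)))) borel (\<lambda>x. x) =
        distr (distr N lborel (\<lambda>\<omega>. B (r (Suc i)) \<omega> - B (r i) \<omega>)) borel (\<lambda>x. x)" by simp
    also have "\<dots> = distr N borel (\<lambda>\<omega>. B (r (Suc i)) \<omega> - B (r i) \<omega>)"
      using rv[OF i] by (subst distr_distr) (auto simp: comp_def)
    finally show "distr N borel (\<lambda>\<omega>. B (r (Suc i)) \<omega> - B (r i) \<omega>) =
        distr (density lborel (normal_density 0 (sqrt (r (Suc i) - r i)))) borel (\<lambda>x. x)" ..
  qed
  finally show ?thesis .
qed

text \<open>The grid consists of the elements of \<open>J\<close> in increasing order.\<close>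

lemma finite_times_grid:
  fixes J :: "real set"
  assumes "finite J" "J \<subseteq> {0..}" "0 \<in> J"
  obtains r :: "nat \<Rightarrow> real" and k idx where "r 0 = 0" "\<And>i. i < k \<Longrightarrow> r i < r (Suc i)" "card J = Suc k"
    "\<And>s. s \<in> J \<Longrightarrow> idx s \<le> k \<and> r (idx s) = s" "r k = Max J"
proof -
  define L where "L = sorted_list_of_set J"
  have L: "set L = J" "sorted L" "distinct L" "length L = card J" using assms(1) by (auto simp: L_def)
  obtain k where k: "card J = Suc k" using assms by (metis card_Suc_Diff1)
  have "\<exists>i. i \<le> k \<and> L ! i = s" if "s \<in> J" for s
    using that L k by (metis in_set_conv_nth less_Suc_eq_le)
  then obtain idx where idx: "\<And>s. s \<in> J \<Longrightarrow> idx s \<le> k \<and> L ! idx s = s" by metis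
  have mono: "L ! i \<le> L ! j" if "i \<le> j" "j \<le> k" for i j
    using L(2) that L(4) k by (intro sorted_nth_mono) auto
  have "L ! 0 = 0"
  proof -
    have "L ! 0 \<le> L ! idx 0" using idx[OF assms(3)] by (intro mono) auto
    moreover have "L ! 0 \<in> J" using L k by (metis nth_mem zero_less_Suc)
    ultimately show ?thesis using idx[OF assms(3)] assms(2) by auto
  qed
  moreover have "L ! i < L ! Suc i" if "i < k" for i
    using L k that by (intro sorted_wrt_nth_less[of "(<)"]) (auto simp: strict_sorted_iff)
  moreover have "L ! k = Max J"
  proof (rule Max_eqI[symmetric])
    show "L ! k \<in> J" using L k by (metis nth_mem lessI)
    show "y \<le> L ! k" if "y \<in> J" for y using idx[OF that] mono[of "idx y" k] by auto
  qed (use assms in auto)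
  ultimately show thesis using that[of "(!) L" k idx] idx k by auto
qed

lemma BM_sum_increments:
  fixes r :: "nat \<Rightarrow> real"
  assumes B: "standard_BM N B" and r: "r 0 = 0" and \<omega>: "\<omega> \<in> space N" and "i \<le> k"
  shows "B (r i) \<omega> = (\<Sum>l<i. (\<lambda>i\<in>{..<k}. B (r (Suc i)) \<omega> - B (r i) \<omega>) l)"
proof -
  have "(\<Sum>l<i. (\<lambda>i\<in>{..<k}. B (r (Suc i)) \<omega> - B (r i) \<omega>) l) = (\<Sum>l<i. B (r (Suc l)) \<omega> - B (r l) \<omega>)"
    using \<open>i \<le> k\<close> by (intro sum.cong) auto
  also have "\<dots> = B (r i) \<omega> - B (r 0) \<omega>" by (rule sum_lessThan_telescope)
  finally show ?thesis using standard_BM_D(2)[OF B \<omega>] r by simp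
qed

lemma measurable_BM_path: 
  assumes B: "standard_BM N B"
  shows "(\<lambda>\<omega>. \<lambda>s\<in>{0..}. B s \<omega>) \<in> measurable N (Pi\<^sub>M {0..} (\<lambda>_. borel))"
  by (rule measurable_restrict) (use standard_BM_D(1)[OF B] in auto)

text \<open>The positions at finitely many times are sums of increments over a grid. The times \<open>0\<close> and \<open>1\<close> are
  added to the grid so that it starts where the motion is known and has at least one increment.\<close>

lemma BM_law_unique:
  assumes N: "prob_space N" and B: "standard_BM N B" and N': "prob_space N'" and B': "standard_BM N' B'"
  shows "distr N (Pi\<^sub>M {0..} (\<lambda>_. borel)) (\<lambda>\<omega>. \<lambda>s\<in>{0..}. B s \<omega>) =
    distr N' (Pi\<^sub>M {0..} (\<lambda>_. borel)) (\<lambda>\<omega>. \<lambda>s\<in>{0..}. B' s \<omega>)"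
proof (rule measure_eqI_PiM_infinite)
  show "finite_measure (distr N (Pi\<^sub>M {0..} (\<lambda>_. borel)) (\<lambda>\<omega>. \<lambda>s\<in>{0..}. B s \<omega>))"
    using prob_space.prob_space_distr[OF N measurable_BM_path[OF B]] by (rule prob_space.axioms)
  fix A :: "real \<Rightarrow> real set" and J :: "real set"
  assume J: "finite J" "J \<subseteq> {0..}" and A: "\<And>i. i \<in> J \<Longrightarrow> A i \<in> sets borel"
  have J1: "finite (insert 0 (insert 1 J))" "insert 0 (insert 1 J) \<subseteq> {0..}" "0 \<in> insert 0 (insert 1 J)"
    using J by auto
  obtain r k idx where r: "r 0 = (0::real)" "\<And>i. i < k \<Longrightarrow> r i < r (Suc i)"
    and card: "card (insert 0 (insert (1::real) J)) = Suc k"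
    and idx: "\<And>s. s \<in> insert 0 (insert 1 J) \<Longrightarrow> idx s \<le> k \<and> r (idx s) = s"
    using finite_times_grid[OF J1] by metis
  have k: "0 < k"
  proof (rule ccontr)
    assume "\<not> 0 < k"
    then have "idx 1 = idx 0" using idx[of 0] idx[of 1] by simp
    then show False using idx[of 0] idx[of 1] by simp
  qed
  let ?P = "Pi\<^sub>M {..<k} (\<lambda>_. borel :: real measure)"
  define E where "E = {y \<in> space ?P. \<forall>s\<in>J. (\<Sum>l<idx s. y l) \<in> A s}"
  have E: "E \<in> sets ?P" unfolding E_def
  proof (rule sets.sets_Collect_countable_All')
    fix s assume s: "s \<in> J"
    have "(\<lambda>y. \<Sum>l<idx s. y l) \<in> borel_measurable ?P"
    proof (intro borel_measurable_sum)
      fix l assume "l \<in> {..<idx s}"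
      then have "l \<in> {..<k}" using idx[of s] s by auto
      then show "(\<lambda>y. y l) \<in> borel_measurable ?P" by (rule measurable_component_singleton)
    qed
    from measurable_sets[OF this A[OF s]] show "{y \<in> space ?P. (\<Sum>l<idx s. y l) \<in> A s} \<in> sets ?P"
      by (simp add: vimage_def Int_def conj_commute)
  qed (use J in \<open>auto intro: countable_finite\<close>)
  have key: "emeasure (distr M (Pi\<^sub>M {0..} (\<lambda>_. borel)) (\<lambda>\<omega>. \<lambda>s\<in>{0..}. W s \<omega>))
      (prod_emb {0..} (\<lambda>_. borel) J (Pi\<^sub>E J A)) = emeasure (distr M ?P (\<lambda>\<omega>. \<lambda>i\<in>{..<k}. W (r (Suc i)) \<omega> - W (r i) \<omega>)) E"
    if M: "prob_space M" and W: "standard_BM M W" for M :: "'z measure" and W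
  proof -
    have 1: "prod_emb {0..} (\<lambda>_. borel) J (Pi\<^sub>E J A) \<in> sets (Pi\<^sub>M {0..} (\<lambda>_. borel))"
      using J A by (intro sets_PiM_I) auto
    have mW: "(\<lambda>\<omega>. \<lambda>i\<in>{..<k}. W (r (Suc i)) \<omega> - W (r i) \<omega>) \<in> measurable M ?P"
      using grid_nonneg[of r k] r by (intro measurable_restrict borel_measurable_diff standard_BM_D(1)[OF W]) auto
    have "(\<lambda>\<omega>. \<lambda>s\<in>{0..}. W s \<omega>) -` prod_emb {0..} (\<lambda>_. borel) J (Pi\<^sub>E J A) \<inter> space M =
        {\<omega> \<in> space M. \<forall>s\<in>J. W s \<omega> \<in> A s}"
      using J(2) by (auto simp: prod_emb_def PiE_iff) (metis (no_types, opaque_lifting) atLeast_iff in_mono)+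
    also have "\<dots> = (\<lambda>\<omega>. \<lambda>i\<in>{..<k}. W (r (Suc i)) \<omega> - W (r i) \<omega>) -` E \<inter> space M"
    proof (intro set_eqI iffI)
      fix \<omega>
      have "(\<Sum>l<idx s. (\<lambda>i\<in>{..<k}. W (r (Suc i)) \<omega> - W (r i) \<omega>) l) = W s \<omega>" if "\<omega> \<in> space M" "s \<in> J" for s
        using BM_sum_increments[OF W, of r \<omega> "idx s" k] r(1) that(1) idx[of s] that(2) by simp
      then show "\<omega> \<in> {\<omega> \<in> space M. \<forall>s\<in>J. W s \<omega> \<in> A s} \<Longrightarrow> \<omega> \<in> (\<lambda>\<omega>. \<lambda>i\<in>{..<k}. W (r (Suc i)) \<omega> - W (r i) \<omega>) -` E \<inter> space M"
        "\<omega> \<in> (\<lambda>\<omega>. \<lambda>i\<in>{..<k}. W (r (Suc i)) \<omega> - W (r i) \<omega>) -` E \<inter> space M \<Longrightarrow> \<omega> \<in> {\<omega> \<in> space M. \<forall>s\<in>J. W s \<omega> \<in> A s}"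
        using measurable_space[OF mW, of \<omega>] by (auto simp: E_def)
    qed
    finally show ?thesis using 1 E mW measurable_BM_path[OF W] by (simp add: emeasure_distr)
  qed
  show "emeasure (distr N (Pi\<^sub>M {0..} (\<lambda>_. borel)) (\<lambda>\<omega>. \<lambda>s\<in>{0..}. B s \<omega>)) (prod_emb {0..} (\<lambda>_. borel) J (Pi\<^sub>E J A)) =
      emeasure (distr N' (Pi\<^sub>M {0..} (\<lambda>_. borel)) (\<lambda>\<omega>. \<lambda>s\<in>{0..}. B' s \<omega>)) (prod_emb {0..} (\<lambda>_. borel) J (Pi\<^sub>E J A))"
    unfolding key[OF N B] using key[OF N' B'] distr_increments[OF N B, of r k] distr_increments[OF N' B', of r k] r k by simp
qed simp_all

lemma independent_BMs_law_unique:
  assumes B: "independent_BMs n N B" and B': "independent_BMs n N' B'" and n: "0 < n"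
  shows "distr N (Pi\<^sub>M {..<n} (\<lambda>_. Pi\<^sub>M {0..} (\<lambda>_. borel))) (\<lambda>\<omega>. \<lambda>j\<in>{..<n}. \<lambda>s\<in>{0..}. B j s \<omega>) =
    distr N' (Pi\<^sub>M {..<n} (\<lambda>_. Pi\<^sub>M {0..} (\<lambda>_. borel))) (\<lambda>\<omega>. \<lambda>j\<in>{..<n}. \<lambda>s\<in>{0..}. B' j s \<omega>)"
proof -
  have *: "distr M (Pi\<^sub>M {..<n} (\<lambda>_. Pi\<^sub>M {0..} (\<lambda>_. borel))) (\<lambda>\<omega>. \<lambda>j\<in>{..<n}. \<lambda>s\<in>{0..}. W j s \<omega>) =
      Pi\<^sub>M {..<n} (\<lambda>j. distr M (Pi\<^sub>M {0..} (\<lambda>_. borel)) (\<lambda>\<omega>. \<lambda>s\<in>{0..}. W j s \<omega>))"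
    if "independent_BMs n M W" for M :: "'z measure" and W
  proof -
    interpret prob_space M using that by (simp add: independent_BMs_def)
    show ?thesis using that n measurable_BM_path
      by (subst indep_vars_iff_distr_eq_PiM'[symmetric]) (auto simp: independent_BMs_def)
  qed
  show ?thesis unfolding *[OF B] *[OF B']
    using B B' by (intro PiM_cong refl BM_law_unique) (auto simp: independent_BMs_def)
qed

text \<open>All functionals of the Brownian motions are transported to one space of continuous functions,
  on which the coalescing paths are a fixed measurable function.\<close>

lemma coalescing_BM_law_unique:
  assumes \<mu>: "coalescing_BM_law n z \<mu>" and \<nu>: "coalescing_BM_law n z \<nu>" and n: "0 < n"
  shows "\<mu> = \<nu>"
proof -
  obtain N N' :: "(nat \<Rightarrow> real \<Rightarrow> real) measure" and B B' where
    B: "independent_BMs n N B" and mu: "\<mu> = distr N (Pi\<^sub>M {..<n} (\<lambda>_. borel)) (coalescing_paths n z B)" and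
    B': "independent_BMs n N' B'" and nu: "\<nu> = distr N' (Pi\<^sub>M {..<n} (\<lambda>_. borel)) (coalescing_paths n z B')"
    using \<mu> \<nu> unfolding coalescing_BM_law_def by blast
  define S where "S = {c :: nat \<Rightarrow> real \<Rightarrow> real. \<forall>i<n. continuous_on {0..} (c i)}"
  define \<iota> where "\<iota> c = (\<lambda>j\<in>{..<n}. \<lambda>s\<in>{0..}. c j s)" for c :: "nat \<Rightarrow> real \<Rightarrow> real"
  let ?\<Omega> = "Pi\<^sub>M {..<n} (\<lambda>_. Pi\<^sub>M {0..} (\<lambda>_. borel)) :: (nat \<Rightarrow> real \<Rightarrow> real) measure"
  define M0 where "M0 = vimage_algebra S \<iota> ?\<Omega>"
  have \<iota>: "\<iota> \<in> S \<rightarrow> space ?\<Omega>" by (auto simp: \<iota>_def space_PiM)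
  have m\<iota>: "\<iota> \<in> measurable M0 ?\<Omega>" unfolding M0_def by (rule measurable_vimage_algebra1[OF \<iota>])
  define G where "G = coalescing_paths n z (\<lambda>j s c. c j s :: real)"
  have G: "G \<in> measurable M0 (Pi\<^sub>M {..<n} (\<lambda>_. borel))"
    unfolding G_def
  proof (rule measurable_coalescing_paths)
    show "continuous_on {0..} (\<lambda>s. c j s)" if "c \<in> space M0" "j < n" for c j
      using that by (auto simp: M0_def S_def)
    fix j and s :: real assume js: "j < n" "0 \<le> s"
    have "(\<lambda>f. f j s) \<in> borel_measurable ?\<Omega>"
      by (rule measurable_compose[of "\<lambda>f. f j" ?\<Omega> "Pi\<^sub>M {0..} (\<lambda>_. borel)" "\<lambda>g. g s"])
        (use js in \<open>auto intro: measurable_component_singleton\<close>)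
    from measurable_compose[OF m\<iota> this] show "(\<lambda>c. c j s) \<in> borel_measurable M0"
      using js by (simp add: \<iota>_def)
  qed
  have main: "distr M (Pi\<^sub>M {..<n} (\<lambda>_. borel)) (coalescing_paths n z W) = distr (distr M M0 (\<lambda>\<omega> j s. W j s \<omega>)) (Pi\<^sub>M {..<n} (\<lambda>_. borel)) G \<and>
      (\<forall>A\<in>sets ?\<Omega>. emeasure (distr M M0 (\<lambda>\<omega> j s. W j s \<omega>)) (\<iota> -` A \<inter> S) =
        emeasure (distr M ?\<Omega> (\<lambda>\<omega>. \<lambda>j\<in>{..<n}. \<lambda>s\<in>{0..}. W j s \<omega>)) A)"
    if W: "independent_BMs n M W" for M :: "(nat \<Rightarrow> real \<Rightarrow> real) measure" and W
  proof -
    have bm: "standard_BM M (W j)" if "j < n" for j using W that by (simp add: independent_BMs_def)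
    have mW: "(\<lambda>\<omega>. \<lambda>j\<in>{..<n}. \<lambda>s\<in>{0..}. W j s \<omega>) \<in> measurable M ?\<Omega>"
      by (rule measurable_restrict) (use measurable_BM_path[OF bm] in auto)
    have inS: "(\<lambda>\<omega> j s. W j s \<omega>) \<in> space M \<rightarrow> S" using standard_BM_D(3)[OF bm] by (auto simp: S_def)
    have m: "(\<lambda>\<omega> j s. W j s \<omega>) \<in> measurable M M0"
      unfolding M0_def by (rule measurable_vimage_algebra2[OF inS]) (use mW in \<open>simp add: \<iota>_def\<close>)
    have "distr (distr M M0 (\<lambda>\<omega> j s. W j s \<omega>)) (Pi\<^sub>M {..<n} (\<lambda>_. borel)) G =
        distr M (Pi\<^sub>M {..<n} (\<lambda>_. borel)) (G \<circ> (\<lambda>\<omega> j s. W j s \<omega>))"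
      by (rule distr_distr[OF G m])
    also have "G \<circ> (\<lambda>\<omega> j s. W j s \<omega>) = coalescing_paths n z W"
      by (simp add: G_def coalescing_paths_def fun_eq_iff)
    finally have 1: "distr M (Pi\<^sub>M {..<n} (\<lambda>_. borel)) (coalescing_paths n z W) = distr (distr M M0 (\<lambda>\<omega> j s. W j s \<omega>)) (Pi\<^sub>M {..<n} (\<lambda>_. borel)) G" ..
    have "emeasure (distr M M0 (\<lambda>\<omega> j s. W j s \<omega>)) (\<iota> -` A \<inter> S) =
        emeasure (distr M ?\<Omega> (\<lambda>\<omega>. \<lambda>j\<in>{..<n}. \<lambda>s\<in>{0..}. W j s \<omega>)) A" if A: "A \<in> sets ?\<Omega>" for A
    proof -
      have "\<iota> -` A \<inter> S \<in> sets M0" unfolding M0_def by (rule in_vimage_algebra[OF A])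
      then have "emeasure (distr M M0 (\<lambda>\<omega> j s. W j s \<omega>)) (\<iota> -` A \<inter> S) =
          emeasure M ((\<lambda>\<omega> j s. W j s \<omega>) -` (\<iota> -` A \<inter> S) \<inter> space M)" by (rule emeasure_distr[OF m])
      also have "(\<lambda>\<omega> j s. W j s \<omega>) -` (\<iota> -` A \<inter> S) \<inter> space M = (\<lambda>\<omega>. \<lambda>j\<in>{..<n}. \<lambda>s\<in>{0..}. W j s \<omega>) -` A \<inter> space M"
        using inS by (auto simp: \<iota>_def)
      also have "emeasure M \<dots> = emeasure (distr M ?\<Omega> (\<lambda>\<omega>. \<lambda>j\<in>{..<n}. \<lambda>s\<in>{0..}. W j s \<omega>)) A"
        by (rule emeasure_distr[OF mW A, symmetric])
      finally show ?thesis .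
    qed
    with 1 show ?thesis by blast
  qed
  have "distr N M0 (\<lambda>\<omega> j s. B j s \<omega>) = distr N' M0 (\<lambda>\<omega> j s. B' j s \<omega>)"
  proof (rule measure_eqI)
    fix X assume "X \<in> sets (distr N M0 (\<lambda>\<omega> j s. B j s \<omega>))"
    then obtain A where A: "A \<in> sets ?\<Omega>" "X = \<iota> -` A \<inter> S"
      by (auto simp: M0_def sets_vimage_algebra2[OF \<iota>])
    show "emeasure (distr N M0 (\<lambda>\<omega> j s. B j s \<omega>)) X = emeasure (distr N' M0 (\<lambda>\<omega> j s. B' j s \<omega>)) X"
      unfolding A(2) using main[OF B] main[OF B'] A(1) independent_BMs_law_unique[OF B B' n] by simp
  qed simp
  then show ?thesis unfolding mu nu using main[OF B] main[OF B'] by simp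
qed


section \<open>Two Brownian motions that start close to each other meet soon\<close>

text \<open>Independence of two random variables whose types differ.\<close>

definition indep_pair :: "'a measure \<Rightarrow> 'b measure \<Rightarrow> ('a \<Rightarrow> 'b) \<Rightarrow> 'c measure \<Rightarrow> ('a \<Rightarrow> 'c) \<Rightarrow> bool" where
  "indep_pair M MA A MB B \<longleftrightarrow> A \<in> measurable M MA \<and> B \<in> measurable M MB \<and>
    (\<forall>a\<in>sets MA. \<forall>b\<in>sets MB. measure M (A -` a \<inter> B -` b \<inter> space M) =
      measure M (A -` a \<inter> space M) * measure M (B -` b \<inter> space M))"

lemma indep_pair_D:
  assumes "indep_pair M MA A MB B"
  shows "A \<in> measurable M MA" "B \<in> measurable M MB"
    "a \<in> sets MA \<Longrightarrow> b \<in> sets MB \<Longrightarrow> measure M (A -` a \<inter> B -` b \<inter> space M) =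
      measure M (A -` a \<inter> space M) * measure M (B -` b \<inter> space M)"
  using assms by (auto simp: indep_pair_def)

lemma indep_pair_compose:
  assumes ind: "indep_pair M MA A MB B" and f: "f \<in> measurable MA NA" and g: "g \<in> measurable MB NB"
    and A': "\<And>\<omega>. \<omega> \<in> space M \<Longrightarrow> A' \<omega> = f (A \<omega>)" and B': "\<And>\<omega>. \<omega> \<in> space M \<Longrightarrow> B' \<omega> = g (B \<omega>)"
  shows "indep_pair M NA A' NB B'"
  unfolding indep_pair_def
proof (intro conjI ballI)
  note D = indep_pair_D[OF ind]
  show "A' \<in> measurable M NA" using measurable_compose[OF D(1) f] A' by (simp cong: measurable_cong)
  show "B' \<in> measurable M NB" using measurable_compose[OF D(2) g] B' by (simp cong: measurable_cong)
  fix a b assume a: "a \<in> sets NA" and b: "b \<in> sets NB"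
  have 1: "A' -` a \<inter> space M = A -` (f -` a \<inter> space MA) \<inter> space M"
    using A' measurable_space[OF D(1)] by auto
  have 2: "B' -` b \<inter> space M = B -` (g -` b \<inter> space MB) \<inter> space M"
    using B' measurable_space[OF D(2)] by auto
  have "A' -` a \<inter> B' -` b \<inter> space M = A -` (f -` a \<inter> space MA) \<inter> B -` (g -` b \<inter> space MB) \<inter> space M"
    using 1 2 by blast
  then show "measure M (A' -` a \<inter> B' -` b \<inter> space M) = measure M (A' -` a \<inter> space M) * measure M (B' -` b \<inter> space M)"
    unfolding 1 2 using D(3)[OF measurable_sets[OF f a] measurable_sets[OF g b]] by simp
qed

definition rectangles :: "'a measure \<Rightarrow> ('a \<Rightarrow> 'x) \<Rightarrow> ('a \<Rightarrow> 'y) \<Rightarrow> 'x measure \<Rightarrow> 'y measure \<Rightarrow> 'a set set" where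
  "rectangles M X Y MX MY = {X -` x \<inter> Y -` y \<inter> space M | x y. x \<in> sets MX \<and> y \<in> sets MY}"

lemma Int_stable_rectangles: "Int_stable (rectangles M X Y MX MY)"
proof (rule Int_stableI)
  fix a b assume "a \<in> rectangles M X Y MX MY" "b \<in> rectangles M X Y MX MY"
  then obtain x y x' y' where "a = X -` x \<inter> Y -` y \<inter> space M" "b = X -` x' \<inter> Y -` y' \<inter> space M"
    and "x \<in> sets MX" "y \<in> sets MY" "x' \<in> sets MX" "y' \<in> sets MY" by (auto simp: rectangles_def)
  then show "a \<inter> b \<in> rectangles M X Y MX MY" unfolding rectangles_def
    by (intro CollectI exI[of _ "x \<inter> x'"] exI[of _ "y \<inter> y'"]) auto
qed

lemma sigma_rectangles:
  assumes X: "X \<in> measurable M MX" and Y: "Y \<in> measurable M MY" and S: "S \<in> sets (MX \<Otimes>\<^sub>M MY)"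
  shows "(\<lambda>\<omega>. (X \<omega>, Y \<omega>)) -` S \<inter> space M \<in> sigma_sets (space M) (rectangles M X Y MX MY)"
proof -
  let ?S = "sigma (space M) (rectangles M X Y MX MY)"
  have sub: "rectangles M X Y MX MY \<subseteq> Pow (space M)" by (auto simp: rectangles_def)
  have "X \<in> measurable ?S MX"
  proof (rule measurableI)
    fix x assume x: "x \<in> sets MX"
    have "X -` x \<inter> space M = X -` x \<inter> Y -` space MY \<inter> space M" using measurable_space[OF Y] by auto
    then have "X -` x \<inter> space M \<in> rectangles M X Y MX MY" unfolding rectangles_def using x by auto
    then show "X -` x \<inter> space ?S \<in> sets ?S" using sub by (auto simp: space_measure_of)
  qed (use sub measurable_space[OF X] in \<open>auto simp: space_measure_of\<close>)
  moreover have "Y \<in> measurable ?S MY"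
  proof (rule measurableI)
    fix y assume y: "y \<in> sets MY"
    have "Y -` y \<inter> space M = X -` space MX \<inter> Y -` y \<inter> space M" using measurable_space[OF X] by auto
    then have "Y -` y \<inter> space M \<in> rectangles M X Y MX MY" unfolding rectangles_def using y by auto
    then show "Y -` y \<inter> space ?S \<in> sets ?S" using sub by (auto simp: space_measure_of)
  qed (use sub measurable_space[OF Y] in \<open>auto simp: space_measure_of\<close>)
  ultimately have "(\<lambda>\<omega>. (X \<omega>, Y \<omega>)) \<in> measurable ?S (MX \<Otimes>\<^sub>M MY)" by (rule measurable_Pair)
  from measurable_sets[OF this S] show ?thesis using sub by (simp add: space_measure_of sets_measure_of)
qed

context prob_space
begin

lemma indep_pairI_indep_var:
  assumes "indep_var MA A MB B"
  shows "indep_pair M MA A MB B"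
  unfolding indep_pair_def
proof (intro conjI ballI)
  fix a b assume ab: "a \<in> sets MA" "b \<in> sets MB"
  have "A -` a \<inter> B -` b \<inter> space M = (\<lambda>x. (A x, B x)) -` (a \<times> b) \<inter> space M" by auto
  then show "prob (A -` a \<inter> B -` b \<inter> space M) = prob (A -` a \<inter> space M) * prob (B -` b \<inter> space M)"
    using indep_varD[OF assms ab] by simp
qed (use indep_var_rv1[OF assms] indep_var_rv2[OF assms] in auto)

text \<open>If \<open>A\<close>, \<open>B\<close> are independent, \<open>C\<close>, \<open>D\<close> are independent, and the two pairs are independent of each other,
  then all four are independent. For two Brownian motions this turns independence of the past and
  future of each of them into independence of the common past and the common future.\<close>

lemma indep_pair_swap:
  assumes AB: "indep_pair M MA A MB B" and CD: "indep_pair M MC C MD D"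
    and ind: "indep_pair M (MA \<Otimes>\<^sub>M MB) (\<lambda>\<omega>. (A \<omega>, B \<omega>)) (MC \<Otimes>\<^sub>M MD) (\<lambda>\<omega>. (C \<omega>, D \<omega>))"
  shows "indep_pair M (MA \<Otimes>\<^sub>M MC) (\<lambda>\<omega>. (A \<omega>, C \<omega>)) (MB \<Otimes>\<^sub>M MD) (\<lambda>\<omega>. (B \<omega>, D \<omega>))"
proof -
  note rvs [measurable] = indep_pair_D(1,2)[OF AB] indep_pair_D(1,2)[OF CD]
  have "indep_set (rectangles M A C MA MC) (rectangles M B D MB MD)"
  proof (rule indep_setI)
    show "rectangles M A C MA MC \<subseteq> events" "rectangles M B D MB MD \<subseteq> events"
      by (auto simp: rectangles_def)
    fix x y assume "x \<in> rectangles M A C MA MC" "y \<in> rectangles M B D MB MD"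
    then obtain a b c d where x: "x = A -` a \<inter> C -` c \<inter> space M" and y: "y = B -` b \<inter> D -` d \<inter> space M"
      and s: "a \<in> sets MA" "b \<in> sets MB" "c \<in> sets MC" "d \<in> sets MD" by (auto simp: rectangles_def)
    have *: "prob (A -` a \<inter> B -` b \<inter> C -` c \<inter> D -` d \<inter> space M) =
        prob (A -` a \<inter> space M) * prob (B -` b \<inter> space M) * (prob (C -` c \<inter> space M) * prob (D -` d \<inter> space M))"
      if s: "a \<in> sets MA" "b \<in> sets MB" "c \<in> sets MC" "d \<in> sets MD" for a b c d
    proof -
      have "prob (A -` a \<inter> B -` b \<inter> C -` c \<inter> D -` d \<inter> space M) =
          prob ((\<lambda>x. (A x, B x)) -` (a \<times> b) \<inter> (\<lambda>x. (C x, D x)) -` (c \<times> d) \<inter> space M)"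
        by (rule arg_cong[where f = prob]) auto
      also have "\<dots> = prob ((\<lambda>x. (A x, B x)) -` (a \<times> b) \<inter> space M) * prob ((\<lambda>x. (C x, D x)) -` (c \<times> d) \<inter> space M)"
        using s by (intro indep_pair_D(3)[OF ind]) auto
      also have "(\<lambda>x. (A x, B x)) -` (a \<times> b) \<inter> space M = A -` a \<inter> B -` b \<inter> space M" by auto
      also have "(\<lambda>x. (C x, D x)) -` (c \<times> d) \<inter> space M = C -` c \<inter> D -` d \<inter> space M" by auto
      finally show ?thesis using indep_pair_D(3)[OF AB s(1,2)] indep_pair_D(3)[OF CD s(3,4)] by simp
    qed
    have X: "x = A -` a \<inter> B -` space MB \<inter> C -` c \<inter> D -` space MD \<inter> space M"
      using measurable_space[OF rvs(2)] measurable_space[OF rvs(4)] by (auto simp: x)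
    have Y: "y = A -` space MA \<inter> B -` b \<inter> C -` space MC \<inter> D -` d \<inter> space M"
      using measurable_space[OF rvs(1)] measurable_space[OF rvs(3)] by (auto simp: y)
    have XY: "x \<inter> y = A -` a \<inter> B -` b \<inter> C -` c \<inter> D -` d \<inter> space M" by (auto simp: x y)
    have one: "prob (Z -` space MZ \<inter> space M) = 1" if "random_variable MZ Z" for Z :: "'a \<Rightarrow> 'z" and MZ
    proof -
      have "Z -` space MZ \<inter> space M = space M" using measurable_space[OF that] by auto
      then show ?thesis by (simp add: prob_space)
    qed
    have 1: "prob x = prob (A -` a \<inter> space M) * prob (C -` c \<inter> space M)"
      unfolding X using *[OF s(1) sets.top s(3) sets.top] by (simp add: one rvs)
    have 2: "prob y = prob (B -` b \<inter> space M) * prob (D -` d \<inter> space M)"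
      unfolding Y using *[OF sets.top s(2) sets.top s(4)] by (simp add: one rvs)
    show "prob (x \<inter> y) = prob x * prob y"
      unfolding XY 1 2 *[OF s] by simp
  qed
  from indep_set_sigma_sets[OF this Int_stable_rectangles Int_stable_rectangles]
  have sig: "indep_set (sigma_sets (space M) (rectangles M A C MA MC)) (sigma_sets (space M) (rectangles M B D MB MD))" .
  show ?thesis
    unfolding indep_pair_def
  proof (intro conjI ballI)
    fix S T assume S: "S \<in> sets (MA \<Otimes>\<^sub>M MC)" and T: "T \<in> sets (MB \<Otimes>\<^sub>M MD)"
    have "(\<lambda>\<omega>. (A \<omega>, C \<omega>)) -` S \<inter> (\<lambda>\<omega>. (B \<omega>, D \<omega>)) -` T \<inter> space M =
        ((\<lambda>\<omega>. (A \<omega>, C \<omega>)) -` S \<inter> space M) \<inter> ((\<lambda>\<omega>. (B \<omega>, D \<omega>)) -` T \<inter> space M)" by auto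
    then show "prob ((\<lambda>\<omega>. (A \<omega>, C \<omega>)) -` S \<inter> (\<lambda>\<omega>. (B \<omega>, D \<omega>)) -` T \<inter> space M) =
        prob ((\<lambda>\<omega>. (A \<omega>, C \<omega>)) -` S \<inter> space M) * prob ((\<lambda>\<omega>. (B \<omega>, D \<omega>)) -` T \<inter> space M)"
      using indep_setD[OF sig sigma_rectangles[OF rvs(1,3) S] sigma_rectangles[OF rvs(2,4) T]] by simp
  qed measurable
qed

lemma indep_var_of_indep_vars:
  assumes "indep_vars M' X I" "i \<in> I" "j \<in> I" "i \<noteq> j"
  shows "indep_var (M' i) (X i) (M' j) (X j)"
proof -
  have "indep_var (M' i) ((\<lambda>f. f i) \<circ> (\<lambda>\<omega>. restrict (\<lambda>i. X i \<omega>) {i})) (M' j) ((\<lambda>f. f j) \<circ> (\<lambda>\<omega>. restrict (\<lambda>i. X i \<omega>) {j}))"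
    using assms by (intro indep_var_compose[OF indep_var_restrict[OF assms(1)]]) auto
  then show ?thesis by (simp add: comp_def)
qed

lemma normal_symmetric:
  assumes X: "distributed M lborel X (normal_density 0 \<sigma>)" and "0 < \<sigma>"
  shows "prob {\<omega> \<in> space M. X \<omega> < - x} = prob {\<omega> \<in> space M. x < X \<omega>}"
proof -
  have "distributed M lborel (\<lambda>\<omega>. 0 + (-1) * X \<omega>) (normal_density (0 + (-1) * 0) (\<bar>-1\<bar> * \<sigma>))"
    by (rule normal_density_affine[OF X]) (use assms in auto)
  then have Y: "distributed M lborel (\<lambda>\<omega>. - X \<omega>) (normal_density 0 \<sigma>)" by simp
  have "distr M lborel X = distr M lborel (\<lambda>\<omega>. - X \<omega>)"
    using X Y by (simp add: distributed_def)
  moreover have "prob {\<omega> \<in> space M. x < X \<omega>} = measure (distr M lborel X) {x<..}"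
    using distributed_measurable[OF X] by (subst measure_distr) (auto simp: vimage_def Int_def conj_commute)
  moreover have "prob {\<omega> \<in> space M. X \<omega> < - x} = measure (distr M lborel (\<lambda>\<omega>. - X \<omega>)) {x<..}"
    using distributed_measurable[OF Y] by (subst measure_distr) (auto simp: vimage_def Int_def conj_commute less_minus_iff)
  ultimately show ?thesis by simp
qed

lemma normal_negative_half:
  assumes X: "distributed M lborel X (normal_density 0 \<sigma>)" and "0 < \<sigma>"
  shows "prob {\<omega> \<in> space M. X \<omega> < 0} \<le> 1 / 2"
proof -
  have [measurable]: "random_variable borel X" using distributed_measurable[OF X] by simp
  have "prob {\<omega> \<in> space M. X \<omega> < 0} + prob {\<omega> \<in> space M. 0 < X \<omega>} = prob ({\<omega> \<in> space M. X \<omega> < 0} \<union> {\<omega> \<in> space M. 0 < X \<omega>})"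
    by (rule finite_measure_Union[symmetric]) auto
  also have "\<dots> \<le> 1" by (rule prob_le_1)
  finally show ?thesis using normal_symmetric[OF assms, of 0] by simp
qed

text \<open>The normal density is bounded by \<open>1 / sqrt (2 \<pi> \<sigma>\<^sup>2)\<close>, and the two tails have equal probability.\<close>

lemma normal_small_ball:
  assumes X: "distributed M lborel X (normal_density 0 \<sigma>)" and \<sigma>: "0 < \<sigma>" and x: "0 \<le> x"
  shows "1 - 2 * prob {\<omega> \<in> space M. X \<omega> < - x} \<le> 2 * x / sqrt (2 * pi * \<sigma>\<^sup>2)"
proof -
  have [measurable]: "random_variable borel X" using distributed_measurable[OF X] by simp
  have "1 = prob ({\<omega> \<in> space M. X \<omega> < - x} \<union> {\<omega> \<in> space M. x < X \<omega>} \<union> {\<omega> \<in> space M. X \<omega> \<in> {- x..x}})"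
    by (subst prob_space[symmetric]) (rule arg_cong[where f = prob], auto)
  also have "\<dots> = prob ({\<omega> \<in> space M. X \<omega> < - x} \<union> {\<omega> \<in> space M. x < X \<omega>}) + prob {\<omega> \<in> space M. X \<omega> \<in> {- x..x}}"
    by (rule finite_measure_Union) auto
  also have "prob ({\<omega> \<in> space M. X \<omega> < - x} \<union> {\<omega> \<in> space M. x < X \<omega>}) = prob {\<omega> \<in> space M. X \<omega> < - x} + prob {\<omega> \<in> space M. x < X \<omega>}"
    using x by (intro finite_measure_Union) auto
  finally have 1: "1 - 2 * prob {\<omega> \<in> space M. X \<omega> < - x} = prob {\<omega> \<in> space M. X \<omega> \<in> {- x..x}}"
    using normal_symmetric[OF X \<sigma>, of x] by simp
  have "emeasure M {\<omega> \<in> space M. X \<omega> \<in> {- x..x}} = emeasure M (X -` {- x..x} \<inter> space M)"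
    by (rule arg_cong[where f = "emeasure M"]) auto
  also have "\<dots> = (\<integral>\<^sup>+y. ennreal (normal_density 0 \<sigma> y) * indicator {- x..x} y \<partial>lborel)"
    by (rule distributed_emeasure[OF X]) simp
  also have "\<dots> \<le> (\<integral>\<^sup>+y. ennreal (1 / sqrt (2 * pi * \<sigma>\<^sup>2)) * indicator {- x..x} y \<partial>lborel)"
    by (intro nn_integral_mono mult_right_mono ennreal_leI) (auto simp: normal_density_def intro!: divide_right_mono)
  also have "\<dots> = ennreal (1 / sqrt (2 * pi * \<sigma>\<^sup>2)) * ennreal (2 * x)"
    using x by (subst nn_integral_cmult_indicator) auto
  also have "\<dots> = ennreal (2 * x / sqrt (2 * pi * \<sigma>\<^sup>2))"
    using x by (subst ennreal_mult[symmetric]) auto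
  finally have "prob {\<omega> \<in> space M. X \<omega> \<in> {- x..x}} \<le> 2 * x / sqrt (2 * pi * \<sigma>\<^sup>2)"
    using x by (simp add: emeasure_eq_measure)
  with 1 show ?thesis by simp
qed

text \<open>On a grid through all points of \<open>J\<close> with \<open>a\<close> and \<open>c\<close> as last points, the positions at the times in \<open>J\<close> are
  functions of all increments but the last one.\<close>

lemma BM_past_indep:
  assumes B: "standard_BM M B" and a: "0 \<le> a" "a < c" and J: "finite J" "J \<subseteq> {0..a}"
  shows "indep_pair M (Pi\<^sub>M J (\<lambda>_. borel)) (\<lambda>\<omega>. \<lambda>u\<in>J. B u \<omega>) borel (\<lambda>\<omega>. B c \<omega> - B a \<omega>)"
proof -
  let ?J = "insert 0 (insert a J)"
  have J': "finite ?J" "?J \<subseteq> {0..}" "0 \<in> ?J" using J a by auto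
  obtain r0 k idx where r0: "r0 0 = (0::real)" "\<And>i. i < k \<Longrightarrow> r0 i < r0 (Suc i)"
    and idx: "\<And>s. s \<in> ?J \<Longrightarrow> idx s \<le> k \<and> r0 (idx s) = s" and rk: "r0 k = Max ?J"
    using finite_times_grid[OF J'] by metis
  have rk': "r0 k = a" unfolding rk using J a by (intro Max_eqI) auto
  \<comment> \<open>the grid through \<open>J\<close>, which ends in \<open>a\<close>, followed by \<open>c\<close>\<close>
  define r where "r i = (if i \<le> k then r0 i else c)" for i
  have r: "r 0 = 0" "\<And>i. i < Suc k \<Longrightarrow> r i < r (Suc i)"
    using r0 a rk' by (auto simp: r_def less_Suc_eq)
  define X where "X i \<omega> = B (r (Suc i)) \<omega> - B (r i) \<omega>" for i \<omega>
  have "indep_vars (\<lambda>_. borel) X {..<Suc k}"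
    unfolding X_def using r standard_BM_D(5)[OF B, of r "Suc k"] by simp
  then have "indep_var (Pi\<^sub>M {..<k} (\<lambda>_. borel)) (\<lambda>\<omega>. restrict (\<lambda>i. X i \<omega>) {..<k}) (Pi\<^sub>M {k} (\<lambda>_. borel)) (\<lambda>\<omega>. restrict (\<lambda>i. X i \<omega>) {k})"
    by (rule indep_var_restrict) auto
  from indep_pairI_indep_var[OF this] show ?thesis
  proof (rule indep_pair_compose)
    show "(\<lambda>y. \<lambda>u\<in>J. \<Sum>l<idx u. y l) \<in> measurable (Pi\<^sub>M {..<k} (\<lambda>_. borel)) (Pi\<^sub>M J (\<lambda>_. borel :: real measure))"
    proof (intro measurable_restrict borel_measurable_sum measurable_component_singleton)
      fix u l assume "u \<in> J" "l \<in> {..<idx u}"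
      then show "l \<in> {..<k}" using idx[of u] by auto
    qed
    show "(\<lambda>y. y k) \<in> measurable (Pi\<^sub>M {k} (\<lambda>_. borel)) (borel :: real measure)"
      by (rule measurable_component_singleton) simp
    fix \<omega> assume \<omega>: "\<omega> \<in> space M"
    have "(\<Sum>l<idx u. (\<lambda>i\<in>{..<k}. X i \<omega>) l) = B u \<omega>" if "u \<in> J" for u
    proof -
      have i: "idx u \<le> k" "r (idx u) = u" using idx[of u] that by (auto simp: r_def)
      have "(\<Sum>l<idx u. (\<lambda>i\<in>{..<k}. X i \<omega>) l) = (\<Sum>l<idx u. B (r (Suc l)) \<omega> - B (r l) \<omega>)"
        using i by (intro sum.cong) (auto simp: X_def)
      also have "\<dots> = B (r (idx u)) \<omega> - B (r 0) \<omega>" by (rule sum_lessThan_telescope)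
      finally show ?thesis using standard_BM_D(2)[OF B \<omega>] r i by simp
    qed
    then show "(\<lambda>u\<in>J. B u \<omega>) = (\<lambda>u\<in>J. \<Sum>l<idx u. (\<lambda>i\<in>{..<k}. X i \<omega>) l)"
      by (auto simp: fun_eq_iff)
    show "B c \<omega> - B a \<omega> = (\<lambda>i\<in>{k}. X i \<omega>) k"
      by (simp add: X_def r_def rk')
  qed
qed

end


text \<open>The properties of the difference of two independent Brownian motions on the time interval
  \<open>{s..u}\<close> on which the reflection argument relies.\<close>

definition reflectable :: "'a measure \<Rightarrow> (real \<Rightarrow> 'a \<Rightarrow> real) \<Rightarrow> real \<Rightarrow> real \<Rightarrow> bool" where
  "reflectable M D s u \<longleftrightarrow> prob_space M \<and> s < u \<and>
    (\<forall>\<omega>\<in>space M. continuous_on {s..u} (\<lambda>v. D v \<omega>)) \<and> (\<forall>v\<in>{s..u}. D v \<in> borel_measurable M) \<and>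
    (\<forall>v. s \<le> v \<and> v < u \<longrightarrow>
      distributed M lborel (\<lambda>\<omega>. D u \<omega> - D v \<omega>) (normal_density 0 (sqrt (2 * (u - v))))) \<and>
    (\<forall>v J. s \<le> v \<and> v < u \<and> finite J \<and> J \<subseteq> {s..v} \<longrightarrow>
      indep_pair M (Pi\<^sub>M J (\<lambda>_. borel)) (\<lambda>\<omega>. \<lambda>w\<in>J. D w \<omega>) borel (\<lambda>\<omega>. D u \<omega> - D v \<omega>))"

lemma reflectable_D:
  assumes "reflectable M D s u"
  shows "prob_space M" "s < u" "\<omega> \<in> space M \<Longrightarrow> continuous_on {s..u} (\<lambda>v. D v \<omega>)"
    "v \<in> {s..u} \<Longrightarrow> D v \<in> borel_measurable M"
    "s \<le> v \<Longrightarrow> v < u \<Longrightarrow> distributed M lborel (\<lambda>\<omega>. D u \<omega> - D v \<omega>) (normal_density 0 (sqrt (2 * (u - v))))"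
    "s \<le> v \<Longrightarrow> v < u \<Longrightarrow> finite J \<Longrightarrow> J \<subseteq> {s..v} \<Longrightarrow>
      indep_pair M (Pi\<^sub>M J (\<lambda>_. borel)) (\<lambda>\<omega>. \<lambda>w\<in>J. D w \<omega>) borel (\<lambda>\<omega>. D u \<omega> - D v \<omega>)"
  using assms unfolding reflectable_def by blast+

lemma reflectable_minus:
  assumes R: "reflectable M D s u"
  shows "reflectable M (\<lambda>v \<omega>. - D v \<omega>) s u"
  unfolding reflectable_def
proof (intro conjI ballI allI impI)
  note D = reflectable_D[OF R]
  interpret prob_space M by (rule D(1))
  show "prob_space M" "s < u" by (fact D)+
  show "continuous_on {s..u} (\<lambda>v. - D v \<omega>)" if "\<omega> \<in> space M" for \<omega>
    by (intro continuous_intros D that)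
  show "(\<lambda>\<omega>. - D v \<omega>) \<in> borel_measurable M" if "v \<in> {s..u}" for v
    by (intro borel_measurable_uminus D that)
  show "distributed M lborel (\<lambda>\<omega>. - D u \<omega> - - D v \<omega>) (normal_density 0 (sqrt (2 * (u - v))))"
    if "s \<le> v \<and> v < u" for v
  proof -
    have "distributed M lborel (\<lambda>\<omega>. 0 + (-1) * (D u \<omega> - D v \<omega>)) (normal_density (0 + (-1) * 0) (\<bar>-1\<bar> * sqrt (2 * (u - v))))"
      using that by (intro normal_density_affine D(5)) auto
    then show ?thesis by (simp add: algebra_simps)
  qed
  show "indep_pair M (Pi\<^sub>M J (\<lambda>_. borel)) (\<lambda>\<omega>. \<lambda>w\<in>J. - D w \<omega>) borel (\<lambda>\<omega>. - D u \<omega> - - D v \<omega>)"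
    if "s \<le> v \<and> v < u \<and> finite J \<and> J \<subseteq> {s..v}" for v J
  proof (rule indep_pair_compose[OF D(6)[of v J]])
    show "(\<lambda>y. \<lambda>w\<in>J. - y w) \<in> measurable (Pi\<^sub>M J (\<lambda>_. borel)) (Pi\<^sub>M J (\<lambda>_. borel :: real measure))"
      by (intro measurable_restrict borel_measurable_uminus measurable_component_singleton)
    show "uminus \<in> borel_measurable (borel :: real measure)" by simp
  qed (use that in \<open>auto simp: fun_eq_iff\<close>)
qed

lemma reflectable_BM_difference:
  assumes B: "independent_BMs 2 M B" and s: "s0 \<le> s" "s < u"
  shows "reflectable M (\<lambda>v \<omega>. (x0 + B 0 (v - s0) \<omega>) - (d + B 1 (v - s) \<omega>)) s u"
  unfolding reflectable_def
proof (intro conjI ballI allI impI)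
  show "prob_space M" using B by (simp add: independent_BMs_def)
  then interpret prob_space M .
  have BM: "standard_BM M (B 0)" "standard_BM M (B 1)" using B by (auto simp: independent_BMs_def)
  have iv: "indep_var (Pi\<^sub>M {0..} (\<lambda>_. borel)) (\<lambda>\<omega>. \<lambda>s\<in>{0..}. B 0 s \<omega>) (Pi\<^sub>M {0..} (\<lambda>_. borel)) (\<lambda>\<omega>. \<lambda>s\<in>{0..}. B 1 s \<omega>)"
    using B indep_var_of_indep_vars[of "\<lambda>_. Pi\<^sub>M {0..} (\<lambda>_. borel)" "\<lambda>j \<omega>. \<lambda>s\<in>{0..}. B j s \<omega>" "{..<2}" 0 1]
    by (simp add: independent_BMs_def)
  show "s < u" by fact
  show "continuous_on {s..u} (\<lambda>v. x0 + B 0 (v - s0) \<omega> - (d + B 1 (v - s) \<omega>))" if "\<omega> \<in> space M" for \<omega>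
    using s by (intro continuous_intros continuous_on_compose2[OF standard_BM_D(3)[OF BM(1) that]]
      continuous_on_compose2[OF standard_BM_D(3)[OF BM(2) that]]) auto
  show "(\<lambda>\<omega>. x0 + B 0 (v - s0) \<omega> - (d + B 1 (v - s) \<omega>)) \<in> borel_measurable M" if "v \<in> {s..u}" for v
    using s that by (intro borel_measurable_diff borel_measurable_add borel_measurable_const
      standard_BM_D(1)[OF BM(1)] standard_BM_D(1)[OF BM(2)]) auto
  fix v
  show "distributed M lborel (\<lambda>\<omega>. x0 + B 0 (u - s0) \<omega> - (d + B 1 (u - s) \<omega>) - (x0 + B 0 (v - s0) \<omega> - (d + B 1 (v - s) \<omega>)))
     (normal_density 0 (sqrt (2 * (u - v))))" if v: "s \<le> v \<and> v < u"
  proof -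
    have "indep_var borel ((\<lambda>x. x (u - s0) - x (v - s0)) \<circ> (\<lambda>\<omega>. \<lambda>s\<in>{0..}. B 0 s \<omega>))
        borel ((\<lambda>x. x (u - s) - x (v - s)) \<circ> (\<lambda>\<omega>. \<lambda>s\<in>{0..}. B 1 s \<omega>))"
      using v s by (intro indep_var_compose[OF iv] borel_measurable_diff measurable_component_singleton) auto
    then have "indep_var borel (\<lambda>\<omega>. B 0 (u - s0) \<omega> - B 0 (v - s0) \<omega>) borel (\<lambda>\<omega>. B 1 (u - s) \<omega> - B 1 (v - s) \<omega>)"
      using v s by (simp add: comp_def)
    then have "distributed M lborel (\<lambda>\<omega>. (B 0 (u - s0) \<omega> - B 0 (v - s0) \<omega>) - (B 1 (u - s) \<omega> - B 1 (v - s) \<omega>))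
        (normal_density (0 - 0) (sqrt ((sqrt (u - v))\<^sup>2 + (sqrt (u - v))\<^sup>2)))"
      using v s standard_BM_D(4)[OF BM(1), of "v - s0" "u - s0"] standard_BM_D(4)[OF BM(2), of "v - s" "u - s"]
      by (intro diff_indep_normal) auto
    moreover have "(sqrt (u - v))\<^sup>2 + (sqrt (u - v))\<^sup>2 = 2 * (u - v)" using v by simp
    ultimately show ?thesis by (simp add: algebra_simps)
  qed
  fix J
  show "indep_pair M (Pi\<^sub>M J (\<lambda>_. borel)) (\<lambda>\<omega>. \<lambda>w\<in>J. x0 + B 0 (w - s0) \<omega> - (d + B 1 (w - s) \<omega>)) borel
     (\<lambda>\<omega>. x0 + B 0 (u - s0) \<omega> - (d + B 1 (u - s) \<omega>) - (x0 + B 0 (v - s0) \<omega> - (d + B 1 (v - s) \<omega>)))"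
    if v: "s \<le> v \<and> v < u \<and> finite J \<and> J \<subseteq> {s..v}"
  proof -
    define J0 where "J0 = (\<lambda>w. w - s0) ` J"
    define J1 where "J1 = (\<lambda>w. w - s) ` J"
    have J0: "finite J0" "J0 \<subseteq> {0..v - s0}" and J1: "finite J1" "J1 \<subseteq> {0..v - s}"
      using v s by (auto simp: J0_def J1_def)
    have 1: "indep_pair M (Pi\<^sub>M J0 (\<lambda>_. borel)) (\<lambda>\<omega>. \<lambda>w\<in>J0. B 0 w \<omega>) borel (\<lambda>\<omega>. B 0 (u - s0) \<omega> - B 0 (v - s0) \<omega>)"
      using v s J0 by (intro BM_past_indep[OF BM(1)]) auto
    have 2: "indep_pair M (Pi\<^sub>M J1 (\<lambda>_. borel)) (\<lambda>\<omega>. \<lambda>w\<in>J1. B 1 w \<omega>) borel (\<lambda>\<omega>. B 1 (u - s) \<omega> - B 1 (v - s) \<omega>)"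
      using v s J1 by (intro BM_past_indep[OF BM(2)]) auto
    have f: "(\<lambda>x. (\<lambda>w\<in>J. x w, x b - x a)) \<in> measurable (Pi\<^sub>M {0..} (\<lambda>_. borel)) (Pi\<^sub>M J (\<lambda>_. borel) \<Otimes>\<^sub>M (borel :: real measure))"
      if "J \<subseteq> {0..}" "0 \<le> a" "0 \<le> b" for J and a b :: real
      using that by (intro measurable_Pair measurable_restrict borel_measurable_diff measurable_component_singleton) auto
    have 3: "indep_pair M (Pi\<^sub>M J0 (\<lambda>_. borel) \<Otimes>\<^sub>M borel) (\<lambda>\<omega>. (\<lambda>w\<in>J0. B 0 w \<omega>, B 0 (u - s0) \<omega> - B 0 (v - s0) \<omega>))
        (Pi\<^sub>M J1 (\<lambda>_. borel) \<Otimes>\<^sub>M borel) (\<lambda>\<omega>. (\<lambda>w\<in>J1. B 1 w \<omega>, B 1 (u - s) \<omega> - B 1 (v - s) \<omega>))"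
      by (rule indep_pair_compose[OF indep_pairI_indep_var[OF iv] f[of J0 "v - s0" "u - s0"] f[of J1 "v - s" "u - s"]])
        (use v s J0 J1 in \<open>auto simp: fun_eq_iff restrict_def\<close>)
    show ?thesis
    proof (rule indep_pair_compose[OF indep_pair_swap[OF 1 2 3],
          of "\<lambda>(a, c). \<lambda>w\<in>J. x0 + a (w - s0) - (d + c (w - s))" "Pi\<^sub>M J (\<lambda>_. borel)" "\<lambda>(b, c). b - c" borel])
      show "(\<lambda>(a, c). \<lambda>w\<in>J. x0 + a (w - s0) - (d + c (w - s))) \<in> measurable (Pi\<^sub>M J0 (\<lambda>_. borel) \<Otimes>\<^sub>M Pi\<^sub>M J1 (\<lambda>_. borel)) (Pi\<^sub>M J (\<lambda>_. borel))"
        unfolding split_beta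
        by (intro measurable_restrict borel_measurable_diff borel_measurable_add borel_measurable_const
            measurable_compose[OF measurable_fst measurable_component_singleton]
            measurable_compose[OF measurable_snd measurable_component_singleton])
          (auto simp: J0_def J1_def)
      show "(\<lambda>(b, c). b - c) \<in> borel_measurable (borel \<Otimes>\<^sub>M (borel :: real measure))" by measurable
    qed (auto simp: fun_eq_iff J0_def J1_def)
  qed
qed

text \<open>The reflection principle on a grid. If the process starts in \<open>(0, \<delta>]\<close> and no step of the grid goes down
  by more than \<open>e\<close>, then a final value below \<open>-e\<close> forces the process to move down after the first grid
  point with a nonpositive value, which given that point happens with probability at most one half.
  So the probability of reaching nonpositive values is at least twice that of a final value below \<open>-e\<close>,
  apart from the event \<open>bad\<close>. The remaining probability is that of a normal variable in
  \<open>[-(e + \<delta>), e + \<delta>]\<close>.\<close>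

lemma (in prob_space) reflection_step:
  assumes R: "reflectable M D s u" and n: "0 < n" and e: "0 \<le> e" and \<delta>: "0 \<le> \<delta>"
    and G: "G \<in> events" "\<And>\<omega>. \<omega> \<in> G \<Longrightarrow> 0 < D s \<omega> \<and> D s \<omega> \<le> \<delta>" "\<And>\<omega> v. \<omega> \<in> G \<Longrightarrow> v \<in> {s..u} \<Longrightarrow> 0 < D v \<omega>"
  defines "A \<equiv> {\<omega> \<in> space M. 0 < D s \<omega> \<and> D s \<omega> \<le> \<delta>}"
    and "bad \<equiv> {\<omega> \<in> space M. \<exists>k\<in>{..<n}. D (s + real (Suc k) * (u - s) / real n) \<omega> - D (s + real k * (u - s) / real n) \<omega> < - e}"
  shows "bad \<in> events" "prob G \<le> prob A * ((e + \<delta>) / sqrt (pi * (u - s))) + 2 * prob bad"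
proof -
  note RD = reflectable_D[OF R]
  define v where "v k = s + real k * (u - s) / real n" for k
  have v0: "v 0 = s" and vn: "v n = u" using n by (simp_all add: v_def)
  have vmono: "v i \<le> v j" if "i \<le> j" for i j
    using that RD(2) unfolding v_def by (intro add_left_mono divide_right_mono mult_right_mono) auto
  have vless: "v i < u" if "i < n" for i
  proof -
    have "real i * (u - s) < real n * (u - s)" using that RD(2) by (intro mult_strict_right_mono) auto
    then show ?thesis using n RD(2) by (simp add: v_def field_simps)
  qed
  have vI: "v i \<in> {s..u}" if "i \<le> n" for i using vmono[of 0 i] vmono[of i n] that v0 vn by auto
  have mD: "D (v i) \<in> borel_measurable M" if "i \<le> n" for i using RD(4)[OF vI[OF that]] .
  have bad: "bad = {\<omega> \<in> space M. \<exists>k\<in>{..<n}. D (v (Suc k)) \<omega> - D (v k) \<omega> < - e}"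
    by (simp add: bad_def v_def)
  show badE: "bad \<in> events"
    unfolding bad
  proof (rule sets.sets_Collect_finite_Ex)
    fix k assume "k \<in> {..<n}"
    then have [measurable]: "D (v k) \<in> borel_measurable M" "D (v (Suc k)) \<in> borel_measurable M" using mD by auto
    show "{\<omega> \<in> space M. D (v (Suc k)) \<omega> - D (v k) \<omega> < - e} \<in> events" by measurable
  qed simp
  have [measurable]: "D s \<in> borel_measurable M" "D u \<in> borel_measurable M" using mD[of 0] mD[of n] v0 vn by auto
  have A: "A \<in> events" unfolding A_def by measurable
  \<comment> \<open>\<open>k\<close> is the first grid point with a nonpositive value\<close>
  define E where "E k = {\<omega> \<in> space M. (0 < D s \<omega> \<and> D s \<omega> \<le> \<delta>) \<and> (\<forall>i\<in>{..<k}. 0 < D (v i) \<omega>) \<and> D (v k) \<omega> \<le> 0}" for k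
  have E: "E k \<in> events" if "k \<le> n" for k
  proof -
    have [measurable]: "D (v k) \<in> borel_measurable M" using mD that by auto
    have "{\<omega> \<in> space M. \<forall>i\<in>{..<k}. 0 < D (v i) \<omega>} \<in> events"
    proof (rule sets.sets_Collect_countable_All')
      fix i assume "i \<in> {..<k}"
      then have [measurable]: "D (v i) \<in> borel_measurable M" using mD that by auto
      show "{\<omega> \<in> space M. 0 < D (v i) \<omega>} \<in> events" by measurable
    qed simp
    moreover have "{\<omega> \<in> space M. 0 < D s \<omega>} \<in> events" "{\<omega> \<in> space M. D s \<omega> \<le> \<delta>} \<in> events" "{\<omega> \<in> space M. D (v k) \<omega> \<le> 0} \<in> events"
      by measurable
    ultimately show ?thesis unfolding E_def by (intro sets.sets_Collect_conj)
  qed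
  define F where "F k = {\<omega> \<in> E k. D u \<omega> - D (v k) \<omega> < 0}" for k
  have F: "F k \<in> events" if "k \<le> n" for k
  proof -
    have [measurable]: "D (v k) \<in> borel_measurable M" "E k \<in> events" using mD E that by auto
    have "F k = E k \<inter> {\<omega> \<in> space M. D u \<omega> - D (v k) \<omega> < 0}" by (auto simp: F_def E_def)
    then show ?thesis by simp
  qed
  \<comment> \<open>the future increment is symmetric and independent of the event \<open>E k\<close>; at the last grid point there is none\<close>
  have half: "prob (F k) \<le> prob (E k) / 2" if k: "k \<le> n" for k
  proof (cases "k = n")
    case True
    then have "F k = {}" by (auto simp: F_def vn)
    then show ?thesis by simp
  next
    case False
    with k have k: "k < n" by simp
    define J where "J = v ` {..k}"
    have J: "finite J" "J \<subseteq> {s..v k}" using vmono[of 0] vmono[of _ k] v0 by (auto simp: J_def)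
    have ind: "indep_pair M (Pi\<^sub>M J (\<lambda>_. borel)) (\<lambda>\<omega>. \<lambda>w\<in>J. D w \<omega>) borel (\<lambda>\<omega>. D u \<omega> - D (v k) \<omega>)"
      using vI[of k] k vless[OF k] J by (intro RD(6)) auto
    let ?P = "Pi\<^sub>M J (\<lambda>_. borel) :: (real \<Rightarrow> real) measure"
    define T where "T = {y \<in> space ?P. (0 < y (v 0) \<and> y (v 0) \<le> \<delta>) \<and> (\<forall>i\<in>{..<k}. 0 < y (v i)) \<and> y (v k) \<le> 0}"
    have c: "(\<lambda>y. y (v i)) \<in> borel_measurable ?P" if "i \<le> k" for i
      by (rule measurable_component_singleton) (use that in \<open>auto simp: J_def\<close>)
    have T: "T \<in> sets ?P"
    proof -
      have [measurable]: "(\<lambda>y. y (v 0)) \<in> borel_measurable ?P" "(\<lambda>y. y (v k)) \<in> borel_measurable ?P" using c by auto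
      have "{y \<in> space ?P. \<forall>i\<in>{..<k}. 0 < y (v i)} \<in> sets ?P"
      proof (rule sets.sets_Collect_countable_All')
        fix i assume "i \<in> {..<k}"
        then have [measurable]: "(\<lambda>y. y (v i)) \<in> borel_measurable ?P" using c by auto
        show "{y \<in> space ?P. 0 < y (v i)} \<in> sets ?P" by measurable
      qed simp
      moreover have "{y \<in> space ?P. 0 < y (v 0)} \<in> sets ?P" "{y \<in> space ?P. y (v 0) \<le> \<delta>} \<in> sets ?P" "{y \<in> space ?P. y (v k) \<le> 0} \<in> sets ?P"
        by measurable
      ultimately show ?thesis unfolding T_def by (intro sets.sets_Collect_conj)
    qed
    have Ek: "E k = (\<lambda>\<omega>. \<lambda>w\<in>J. D w \<omega>) -` T \<inter> space M"
      unfolding E_def T_def using v0 by (auto simp: J_def space_PiM)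
    have "F k = (\<lambda>\<omega>. \<lambda>w\<in>J. D w \<omega>) -` T \<inter> (\<lambda>\<omega>. D u \<omega> - D (v k) \<omega>) -` {..<0} \<inter> space M"
      unfolding F_def Ek by auto
    then have "prob (F k) = prob (E k) * prob ((\<lambda>\<omega>. D u \<omega> - D (v k) \<omega>) -` {..<0} \<inter> space M)"
      using indep_pair_D(3)[OF ind T, of "{..<0}"] by (simp add: Ek)
    also have "(\<lambda>\<omega>. D u \<omega> - D (v k) \<omega>) -` {..<0} \<inter> space M = {\<omega> \<in> space M. D u \<omega> - D (v k) \<omega> < 0}" by auto
    also have "prob \<dots> \<le> 1 / 2"
      using vI[of k] k vless[OF k] by (intro normal_negative_half[OF RD(5)]) auto
    finally show ?thesis by (simp add: mult_left_mono)
  qed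
  let ?X = "\<lambda>\<omega>. D u \<omega> - D s \<omega>"
  have X: "distributed M lborel ?X (normal_density 0 (sqrt (2 * (u - s))))" using RD(2) by (intro RD(5)) auto
  define q where "q = prob {\<omega> \<in> space M. ?X \<omega> < - (e + \<delta>)}"
  have "prob A * q = prob (A \<inter> {\<omega> \<in> space M. ?X \<omega> < - (e + \<delta>)})"
  proof -
    have ind: "indep_pair M (Pi\<^sub>M {s} (\<lambda>_. borel)) (\<lambda>\<omega>. \<lambda>w\<in>{s}. D w \<omega>) borel ?X"
      using RD(2) by (intro RD(6)) auto
    let ?P = "Pi\<^sub>M {s} (\<lambda>_. borel) :: (real \<Rightarrow> real) measure"
    have [measurable]: "(\<lambda>y. y s) \<in> borel_measurable ?P" by (rule measurable_component_singleton) simp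
    define T where "T = {y \<in> space ?P. 0 < y s \<and> y s \<le> \<delta>}"
    have T: "T \<in> sets ?P" unfolding T_def by measurable
    have 1: "A = (\<lambda>\<omega>. \<lambda>w\<in>{s}. D w \<omega>) -` T \<inter> space M" by (auto simp: A_def T_def space_PiM)
    have 2: "{\<omega> \<in> space M. ?X \<omega> < - (e + \<delta>)} = ?X -` {..<- (e + \<delta>)} \<inter> space M" by auto
    have "A \<inter> {\<omega> \<in> space M. ?X \<omega> < - (e + \<delta>)} = (\<lambda>\<omega>. \<lambda>w\<in>{s}. D w \<omega>) -` T \<inter> ?X -` {..<- (e + \<delta>)} \<inter> space M"
      using 1 2 by blast
    then show ?thesis unfolding q_def 2 using indep_pair_D(3)[OF ind T, of "{..<- (e + \<delta>)}"] 1 by simp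
  qed
  also have "\<dots> \<le> prob ((\<Union>k\<in>{..n}. F k) \<union> bad)"
  proof (rule finite_measure_mono)
    show "A \<inter> {\<omega> \<in> space M. ?X \<omega> < - (e + \<delta>)} \<subseteq> (\<Union>k\<in>{..n}. F k) \<union> bad"
    proof
      fix \<omega> assume \<omega>: "\<omega> \<in> A \<inter> {\<omega> \<in> space M. ?X \<omega> < - (e + \<delta>)}"
      then have Du: "D u \<omega> < - e" and Ds: "0 < D s \<omega>" "D s \<omega> \<le> \<delta>" and sp: "\<omega> \<in> space M" by (auto simp: A_def)
      define k where "k = (LEAST k. D (v k) \<omega> \<le> 0)"
      have kn: "D (v n) \<omega> \<le> 0" using Du e by (simp add: vn)
      have k: "D (v k) \<omega> \<le> 0" "k \<le> n" unfolding k_def by (rule LeastI[of _ n], fact kn) (rule Least_le, fact kn)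
      have lt: "0 < D (v i) \<omega>" if "i < k" for i using not_less_Least[OF that[unfolded k_def]] by simp
      have "k \<noteq> 0" using k Ds v0 by (intro notI) simp
      then obtain j where j: "k = Suc j" using not0_implies_Suc by blast
      show "\<omega> \<in> (\<Union>k\<in>{..n}. F k) \<union> bad"
      proof (cases "D (v (Suc j)) \<omega> - D (v j) \<omega> < - e")
        case True
        then have "\<omega> \<in> bad" unfolding bad using sp k j by auto
        then show ?thesis by blast
      next
        case False
        then have "D u \<omega> < D (v k) \<omega>" using lt[of j] Du by (simp add: j)
        then have "\<omega> \<in> F k" using k lt sp Ds by (auto simp: F_def E_def)
        then show ?thesis using k by blast
      qed
    qed
    show "(\<Union>k\<in>{..n}. F k) \<union> bad \<in> events" using F badE by auto
  qed
  also have "\<dots> \<le> prob (\<Union>k\<in>{..n}. F k) + prob bad"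
    using F badE by (intro measure_Un_le) auto
  also have "prob (\<Union>k\<in>{..n}. F k) \<le> (\<Sum>k\<in>{..n}. prob (F k))"
    using F by (intro measure_UNION_le) auto
  also have "\<dots> \<le> (\<Sum>k\<in>{..n}. prob (E k) / 2)"
    by (intro sum_mono half) auto
  also have "\<dots> = (\<Sum>k\<in>{..n}. prob (E k)) / 2" by (simp add: sum_divide_distrib)
  also have "(\<Sum>k\<in>{..n}. prob (E k)) = prob (\<Union>k\<in>{..n}. E k)"
  proof (rule finite_measure_finite_Union[symmetric])
    show "disjoint_family_on E {..n}"
      unfolding disjoint_family_on_def
    proof (intro ballI impI)
      fix i j :: nat assume "i \<noteq> j"
      then consider "i < j" | "j < i" by linarith
      then show "E i \<inter> E j = {}" by cases (force simp: E_def)+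
    qed
  qed (use E in auto)
  finally have 1: "prob A * q \<le> prob (\<Union>k\<in>{..n}. E k) / 2 + prob bad" by simp
  have "prob G + prob (\<Union>k\<in>{..n}. E k) = prob (G \<union> (\<Union>k\<in>{..n}. E k))"
  proof (rule finite_measure_Union[symmetric])
    show "G \<inter> (\<Union>k\<in>{..n}. E k) = {}" using G(3) vI by (fastforce simp: E_def)
  qed (use G E in auto)
  also have "\<dots> \<le> prob A"
    using G(2) sets.sets_into_space[OF G(1)] A by (intro finite_measure_mono) (auto simp: A_def E_def)
  finally have "prob G \<le> prob A * (1 - 2 * q) + 2 * prob bad" using 1 by (simp add: algebra_simps)
  moreover have "1 - 2 * q \<le> (e + \<delta>) / sqrt (pi * (u - s))"
  proof -
    have "1 - 2 * q \<le> 2 * (e + \<delta>) / sqrt (2 * pi * (sqrt (2 * (u - s)))\<^sup>2)"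
      unfolding q_def using RD(2) e \<delta> by (intro normal_small_ball[OF X]) auto
    also have "2 * pi * (sqrt (2 * (u - s)))\<^sup>2 = 2\<^sup>2 * (pi * (u - s))" using RD(2) by simp
    also have "sqrt \<dots> = 2 * sqrt (pi * (u - s))" by (subst real_sqrt_mult) simp
    finally show ?thesis by (simp only: mult_divide_mult_cancel_left[of 2] zero_neq_numeral not_False_eq_True)
  qed
  ultimately show "prob G \<le> prob A * ((e + \<delta>) / sqrt (pi * (u - s))) + 2 * prob bad"
    using mult_left_mono[of "1 - 2 * q" _ "prob A"] by (smt (verit) measure_nonneg)
qed

text \<open>By continuity of the sample paths, large steps disappear as the grid becomes finer. Afterwards the
  allowed step size \<open>e\<close> tends to \<open>0\<close>.\<close>

lemma (in prob_space) reflection_estimate: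
  assumes R: "reflectable M D s u" and \<delta>: "0 \<le> \<delta>"
    and G: "G \<in> events" "\<And>\<omega>. \<omega> \<in> G \<Longrightarrow> 0 < D s \<omega> \<and> D s \<omega> \<le> \<delta>" "\<And>\<omega> v. \<omega> \<in> G \<Longrightarrow> v \<in> {s..u} \<Longrightarrow> 0 < D v \<omega>"
  shows "prob G \<le> prob {\<omega> \<in> space M. 0 < D s \<omega> \<and> D s \<omega> \<le> \<delta>} * (\<delta> / sqrt (pi * (u - s)))"
proof -
  note RD = reflectable_D[OF R]
  define pA where "pA = prob {\<omega> \<in> space M. 0 < D s \<omega> \<and> D s \<omega> \<le> \<delta>}"
  define bad where "bad e n = {\<omega> \<in> space M. \<exists>k\<in>{..<n}. D (s + real (Suc k) * (u - s) / real n) \<omega> - D (s + real k * (u - s) / real n) \<omega> < - e}" for e n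
  have step: "prob G \<le> pA * ((e + \<delta>) / sqrt (pi * (u - s)))" if e: "0 < e" for e
  proof -
    have badE: "bad e (Suc n) \<in> events" for n
      unfolding bad_def using e by (intro reflection_step(1)[OF R _ _ \<delta> G]) auto
    have "(\<lambda>n. \<integral>\<omega>. indicator (bad e (Suc n)) \<omega> \<partial>M) \<longlonglongrightarrow> (\<integral>\<omega>. (0::real) \<partial>M)"
    proof (rule integral_dominated_convergence)
      show "AE \<omega> in M. (\<lambda>n. indicator (bad e (Suc n)) \<omega> :: real) \<longlonglongrightarrow> 0"
      proof (rule AE_I2)
        fix \<omega> assume \<omega>: "\<omega> \<in> space M"
        have "uniformly_continuous_on {s..u} (\<lambda>v. D v \<omega>)"
          by (intro compact_uniformly_continuous RD(3) \<omega>) auto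
        then obtain h where h: "h > 0" "\<And>v w. v \<in> {s..u} \<Longrightarrow> w \<in> {s..u} \<Longrightarrow> dist w v < h \<Longrightarrow> dist (D w \<omega>) (D v \<omega>) < e"
          using e unfolding uniformly_continuous_on_def by metis
        obtain n0 :: nat where n0: "(u - s) / h < real n0" using reals_Archimedean2 by blast
        have "indicator (bad e (Suc n)) \<omega> = (0::real)" if "n0 \<le> n" for n
        proof -
          let ?v = "\<lambda>k. s + real k * (u - s) / real (Suc n)"
          have "\<not> D (?v (Suc k)) \<omega> - D (?v k) \<omega> < - e" if k: "k < Suc n" for k
          proof -
            have us: "0 < u - s" using RD(2) by simp
            have vI: "?v k \<in> {s..u}" if "k \<le> Suc n" for k
            proof -
              have "real k * (u - s) \<le> real (Suc n) * (u - s)" using that us by (intro mult_right_mono) auto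
              then have "real k * (u - s) / real (Suc n) \<le> u - s" by (simp add: divide_le_eq mult.commute)
              then show ?thesis using us by simp
            qed
            have "?v (Suc k) - ?v k = (real (Suc k) * (u - s) - real k * (u - s)) / real (Suc n)"
              by (simp only: add_diff_cancel_left diff_divide_distrib)
            also have "real (Suc k) * (u - s) - real k * (u - s) = u - s"
              by (simp add: distrib_right)
            finally have "?v (Suc k) - ?v k = (u - s) / real (Suc n)" .
            moreover have "(u - s) / real (Suc n) < h"
            proof -
              have "(u - s) / h < real (Suc n)" using n0 \<open>n0 \<le> n\<close> by linarith
              then show ?thesis using h(1) by (simp add: field_simps)
            qed
            ultimately have "dist (?v (Suc k)) (?v k) < h" using us by (simp add: dist_real_def)
            then have "dist (D (?v (Suc k)) \<omega>) (D (?v k) \<omega>) < e" using k by (intro h(2) vI) auto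
            then show ?thesis by (simp add: dist_real_def)
          qed
          then show ?thesis by (auto simp: bad_def indicator_def)
        qed
        then show "(\<lambda>n. indicator (bad e (Suc n)) \<omega> :: real) \<longlonglongrightarrow> 0"
          by (intro tendsto_eventually) (auto simp: eventually_sequentially)
      qed
    qed (use badE in \<open>auto simp: indicator_def\<close>)
    then have "(\<lambda>n. prob (bad e (Suc n))) \<longlonglongrightarrow> 0"
      using badE by simp
    then have "(\<lambda>n. pA * ((e + \<delta>) / sqrt (pi * (u - s))) + 2 * prob (bad e (Suc n))) \<longlonglongrightarrow> pA * ((e + \<delta>) / sqrt (pi * (u - s))) + 2 * 0"
      by (intro tendsto_intros)
    moreover have "prob G \<le> pA * ((e + \<delta>) / sqrt (pi * (u - s))) + 2 * prob (bad e (Suc n))" for n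
      unfolding bad_def pA_def using e by (intro reflection_step(2)[OF R _ _ \<delta> G]) auto
    ultimately show ?thesis using LIMSEQ_le_const by fastforce
  qed
  have "((\<lambda>e. pA * ((e + \<delta>) / sqrt (pi * (u - s)))) \<longlongrightarrow> pA * ((0 + \<delta>) / sqrt (pi * (u - s)))) (at_right 0)"
    by (intro tendsto_intros) (use RD(2) in auto)
  moreover have "eventually (\<lambda>e. prob G \<le> pA * ((e + \<delta>) / sqrt (pi * (u - s)))) (at_right 0)"
    using eventually_at_right_less[of 0] by (rule eventually_mono) (use step in auto)
  ultimately have "prob G \<le> pA * ((0 + \<delta>) / sqrt (pi * (u - s)))"
    by (rule tendsto_lowerbound) simp
  then show ?thesis by (simp add: pA_def)
qed


section \<open>Sample path properties of a web of coalescing Brownian motions\<close>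

text \<open>At time \<open>s\<close> the path is within \<open>\<delta>\<close> of \<open>d\<close>, strictly above it for \<open>\<sigma> = 1\<close> and strictly below it for \<open>\<sigma> = -1\<close>.\<close>

definition near :: "real \<Rightarrow> real \<Rightarrow> real \<Rightarrow> real \<Rightarrow> path \<Rightarrow> bool" where
  "near \<sigma> \<delta> d s p \<longleftrightarrow> (\<exists>y. tv p s = tanh y \<and> 0 < \<sigma> * (y - d) \<and> \<sigma> * (y - d) \<le> \<delta>)"

lemma near_1: "near 1 \<delta> d s p \<longleftrightarrow> tanh d < tv p s \<and> tv p s \<le> tanh (d + \<delta>)"
proof
  assume *: "tanh d < tv p s \<and> tv p s \<le> tanh (d + \<delta>)"
  then have "\<bar>tv p s\<bar> < 1" using tanh_real_bounds[of d] tanh_real_bounds[of "d + \<delta>"] by auto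
  then obtain y where "tv p s = tanh y" using tanh_surj by blast
  then show "near 1 \<delta> d s p" using * by (intro near_def[THEN iffD2] exI[of _ y]) auto
qed (auto simp: near_def)

lemma near_m1: "near (-1) \<delta> d s p \<longleftrightarrow> tanh (d - \<delta>) \<le> tv p s \<and> tv p s < tanh d"
proof
  assume *: "tanh (d - \<delta>) \<le> tv p s \<and> tv p s < tanh d"
  then have "\<bar>tv p s\<bar> < 1" using tanh_real_bounds[of d] tanh_real_bounds[of "d - \<delta>"] by auto
  then obtain y where "tv p s = tanh y" using tanh_surj by blast
  then show "near (-1) \<delta> d s p" using * by (intro near_def[THEN iffD2] exI[of _ y]) auto
qed (auto simp: near_def)

lemma near_sets: 
  assumes "\<sigma> \<in> {1, -1}"
  shows "{p. near \<sigma> \<delta> d s p} \<in> sets borel"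
proof -
  have "{p \<in> space borel. tanh d < tv p s \<and> tv p s \<le> tanh (d + \<delta>)} \<in> sets borel"
    "{p \<in> space borel. tanh (d - \<delta>) \<le> tv p s \<and> tv p s < tanh d} \<in> sets borel" by measurable
  moreover have "{p. near 1 \<delta> d s p} = {p \<in> space borel. tanh d < tv p s \<and> tv p s \<le> tanh (d + \<delta>)}"
    "{p. near (-1) \<delta> d s p} = {p \<in> space borel. tanh (d - \<delta>) \<le> tv p s \<and> tv p s < tanh d}"
    by (auto simp: near_1 near_m1)
  ultimately have "{p. near 1 \<delta> d s p} \<in> sets borel" "{p. near (-1) \<delta> d s p} \<in> sets borel" by (simp_all only:)
  with assms show ?thesis by blast
qed

lemma card_image_le_jumps:
  "card (g ` {0..n::nat}) \<le> 1 + (\<Sum>i<n. if g i \<noteq> g (Suc i) then 1 else 0)"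
proof (induction n)
  case (Suc n)
  have "g ` {0..Suc n} = insert (g (Suc n)) (g ` {0..n})" by (auto simp: atLeast0_atMost_Suc)
  moreover have "g n \<in> g ` {0..n}" by simp
  ultimately show ?case using Suc by (cases "g n = g (Suc n)") (auto simp: insert_absorb card_insert_if intro: le_SucI)
qed simp

text \<open>The assumptions that \<open>\<W>'\<close> shares with the Brownian web.\<close>

locale web_paths = prob_space M for M :: "'a measure" +
  fixes X :: "'a \<Rightarrow> path_set"
  assumes X_measurable [measurable]: "X \<in> borel_measurable M"
    and unique: "unique_paths M X"
    and marginals: "coalescing_BM_marginals M X"
begin

definition W :: "real \<times> real \<Rightarrow> 'a \<Rightarrow> path" where "W z \<omega> = path_from (X \<omega>) z"

lemma W_measurable [measurable]: "W z \<in> borel_measurable M"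
  unfolding W_def by measurable

lemma AE_uniq_from: "AE \<omega> in M. uniq_from (X \<omega>) z"
  using unique unfolding unique_paths_def uniq_from_def by blast

lemma AE_start: "AE \<omega> in M. start (W z \<omega>) = ereal (snd z) \<and> tv (W z \<omega>) (snd z) = tanh (fst z)"
  using AE_uniq_from[of z]
proof eventually_elim
  case (elim \<omega>)
  then have "starts_at (W z \<omega>) (fst z, snd z)" using path_from_uniq(2) by (simp add: W_def)
  then show ?case by (simp only: starts_at_iff)
qed

lemma tv_W_measurable [measurable]: "(\<lambda>\<omega>. tv (W z \<omega>) u) \<in> borel_measurable M"
  by measurable

text \<open>Probabilities of events that concern finitely many paths from deterministic points can be computed
  for coalescing Brownian motions.\<close>

lemma transfer:
  obtains N :: "(nat \<Rightarrow> real \<Rightarrow> real) measure" and B where "independent_BMs n N B"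
    "\<And>S. S \<in> sets (Pi\<^sub>M {..<n} (\<lambda>_. borel)) \<Longrightarrow>
      prob {\<omega> \<in> space M. (\<lambda>j\<in>{..<n}. W (z j) \<omega>) \<in> S} = measure N {\<omega> \<in> space N. coalescing_paths n z B \<omega> \<in> S}"
proof -
  have "coalescing_BM_law n z (distr M (Pi\<^sub>M {..<n} (\<lambda>_. borel)) (\<lambda>\<omega>. \<lambda>j\<in>{..<n}. W (z j) \<omega>))"
    using marginals by (simp add: coalescing_BM_marginals_def W_def)
  then obtain N :: "(nat \<Rightarrow> real \<Rightarrow> real) measure" and B where B: "independent_BMs n N B"
    and eq: "distr M (Pi\<^sub>M {..<n} (\<lambda>_. borel)) (\<lambda>\<omega>. \<lambda>j\<in>{..<n}. W (z j) \<omega>) = distr N (Pi\<^sub>M {..<n} (\<lambda>_. borel)) (coalescing_paths n z B)"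
    unfolding coalescing_BM_law_def by blast
  have bm: "standard_BM N (B j)" if "j < n" for j using B that by (simp add: independent_BMs_def)
  have mN: "coalescing_paths n z B \<in> measurable N (Pi\<^sub>M {..<n} (\<lambda>_. borel))"
    using standard_BM_D(1,3)[OF bm] by (intro measurable_coalescing_paths) auto
  have mM: "(\<lambda>\<omega>. \<lambda>j\<in>{..<n}. W (z j) \<omega>) \<in> measurable M (Pi\<^sub>M {..<n} (\<lambda>_. borel))"
    by (intro measurable_restrict W_measurable)
  show thesis
  proof (rule that[OF B])
    fix S :: "(nat \<Rightarrow> path) set" assume S: "S \<in> sets (Pi\<^sub>M {..<n} (\<lambda>_. borel))"
    have "prob {\<omega> \<in> space M. (\<lambda>j\<in>{..<n}. W (z j) \<omega>) \<in> S} =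
        measure (distr M (Pi\<^sub>M {..<n} (\<lambda>_. borel)) (\<lambda>\<omega>. \<lambda>j\<in>{..<n}. W (z j) \<omega>)) S"
      by (subst measure_distr[OF mM S]) (simp add: vimage_def Int_def conj_commute)
    also have "\<dots> = measure N {\<omega> \<in> space N. coalescing_paths n z B \<omega> \<in> S}"
      unfolding eq by (subst measure_distr[OF mN S]) (simp add: vimage_def Int_def conj_commute)
    finally show "prob {\<omega> \<in> space M. (\<lambda>j\<in>{..<n}. W (z j) \<omega>) \<in> S} = measure N {\<omega> \<in> space N. coalescing_paths n z B \<omega> \<in> S}" .
  qed
qed

lemma transfer_one:
  obtains N :: "(nat \<Rightarrow> real \<Rightarrow> real) measure" and B where "prob_space N" "standard_BM N B"
    "\<And>P. {p \<in> space borel. P p} \<in> sets borel \<Longrightarrow>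
      prob {\<omega> \<in> space M. P (W (x, s) \<omega>)} = measure N {\<omega> \<in> space N. P (mk_path (\<lambda>v. x + B (v - s) \<omega>) s)}"
proof -
  obtain N :: "(nat \<Rightarrow> real \<Rightarrow> real) measure" and B where B: "independent_BMs 1 N B"
    and tr: "\<And>S. S \<in> sets (Pi\<^sub>M {..<1} (\<lambda>_. borel)) \<Longrightarrow>
      prob {\<omega> \<in> space M. (\<lambda>j\<in>{..<1}. W (x, s) \<omega>) \<in> S} = measure N {\<omega> \<in> space N. coalescing_paths 1 (\<lambda>_. (x, s)) B \<omega> \<in> S}"
    proof -
    show ?thesis by (rule transfer[of 1 "\<lambda>_. (x, s)"]) (rule that)
  qed
  show thesis
  proof (rule that)
    show "prob_space N" "standard_BM N (B 0)" using B by (auto simp: independent_BMs_def)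
    fix P :: "path \<Rightarrow> bool" assume P: "{p \<in> space borel. P p} \<in> sets borel"
    let ?Pi = "Pi\<^sub>M {..<1} (\<lambda>_. borel) :: (nat \<Rightarrow> path) measure"
    have "(\<lambda>q. q 0) \<in> measurable ?Pi borel" by (rule measurable_component_singleton) simp
    from measurable_sets_Collect[OF this P] have S: "{q \<in> space ?Pi. P (q 0)} \<in> sets ?Pi" .
    have "coalescing_paths 1 (\<lambda>_. (x, s)) B \<omega> 0 = mk_path (\<lambda>v. x + B 0 (v - s) \<omega>) s" for \<omega>
      by (simp add: coalescing_paths_def merge_0)
    moreover have "coalescing_paths 1 (\<lambda>_. (x, s)) B \<omega> \<in> space ?Pi" for \<omega>
      by (auto simp: coalescing_paths_def space_PiM)
    moreover have "(\<lambda>j\<in>{..<1}. W (x, s) \<omega>) \<in> space ?Pi" for \<omega> by (auto simp: space_PiM)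
    ultimately show "prob {\<omega> \<in> space M. P (W (x, s) \<omega>)} = measure N {\<omega> \<in> space N. P (mk_path (\<lambda>v. x + B 0 (v - s) \<omega>) s)}"
      using tr[OF S] by simp
  qed
qed

lemma transfer_two:
  assumes s01: "s0 \<le> s1"
  obtains N :: "(nat \<Rightarrow> real \<Rightarrow> real) measure" and B m where "independent_BMs 2 N B"
    "\<And>\<omega>. \<omega> \<in> space N \<Longrightarrow> continuous_on {s1..} (m \<omega>)"
    "\<And>\<omega> u. \<omega> \<in> space N \<Longrightarrow> m \<omega> u = (if \<exists>v\<in>{s1..u}. x0 + B 0 (v - s0) \<omega> = x1 + B 1 (v - s1) \<omega>
      then x0 + B 0 (u - s0) \<omega> else x1 + B 1 (u - s1) \<omega>)"
    "\<And>P. {p \<in> space (borel \<Otimes>\<^sub>M borel). P (fst p) (snd p)} \<in> sets (borel \<Otimes>\<^sub>M borel) \<Longrightarrow>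
      prob {\<omega> \<in> space M. P (W (x0, s0) \<omega>) (W (x1, s1) \<omega>)} =
      measure N {\<omega> \<in> space N. P (mk_path (\<lambda>v. x0 + B 0 (v - s0) \<omega>) s0) (mk_path (m \<omega>) s1)}"
proof -
  let ?z = "\<lambda>i::nat. if i = 0 then (x0, s0) else (x1, s1)"
  obtain N :: "(nat \<Rightarrow> real \<Rightarrow> real) measure" and B where B: "independent_BMs 2 N B"
    and tr: "\<And>S. S \<in> sets (Pi\<^sub>M {..<2} (\<lambda>_. borel)) \<Longrightarrow>
      prob {\<omega> \<in> space M. (\<lambda>j\<in>{..<2}. W (?z j) \<omega>) \<in> S} = measure N {\<omega> \<in> space N. coalescing_paths 2 ?z B \<omega> \<in> S}"
    proof -
    show ?thesis by (rule transfer[of 2 ?z]) (rule that)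
  qed
  define t where "t = (\<lambda>i::nat. snd (?z i))"
  define C where "C \<omega> i s = fst (?z i) + B i (s - snd (?z i)) \<omega>" for \<omega> i s
  have BM: "standard_BM N (B 0)" "standard_BM N (B 1)" using B by (auto simp: independent_BMs_def)
  have t01: "t 0 = s0" "t 1 = s1" by (auto simp: t_def)
  have C01: "C \<omega> 0 = (\<lambda>v. x0 + B 0 (v - s0) \<omega>)" "C \<omega> 1 = (\<lambda>v. x1 + B 1 (v - s1) \<omega>)" for \<omega> by (auto simp: C_def)
  have c: "continuous_on {t 0..} (C \<omega> 0)" "continuous_on {t 1..} (C \<omega> 1)" if "\<omega> \<in> space N" for \<omega>
    unfolding C01 t01
    by (intro continuous_intros continuous_on_compose2[OF standard_BM_D(3)[OF BM(1) that]]
      continuous_on_compose2[OF standard_BM_D(3)[OF BM(2) that]]; auto)+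
  have co1: "coalesce t V 1 = V" for V by (simp add: merge_0)
  show thesis
  proof (rule that[OF B, of "\<lambda>\<omega>. merge t (C \<omega>) 1 (C \<omega> 1)"])
    show "continuous_on {s1..} (merge t (C \<omega>) 1 (C \<omega> 1))" if "\<omega> \<in> space N" for \<omega>
      using continuous_merge[of 1 t "C \<omega>" "C \<omega> 1"] c[OF that] by (simp add: t01 del: One_nat_def)
    show "merge t (C \<omega>) 1 (C \<omega> 1) u = (if \<exists>v\<in>{s1..u}. x0 + B 0 (v - s0) \<omega> = x1 + B 1 (v - s1) \<omega>
      then x0 + B 0 (u - s0) \<omega> else x1 + B 1 (u - s1) \<omega>)" if "\<omega> \<in> space N" for \<omega> u
      using merge_two[of t "C \<omega>" "C \<omega> 1" u] c[OF that] s01 by (simp add: t01 C01 del: One_nat_def)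
    fix P :: "path \<Rightarrow> path \<Rightarrow> bool" assume P: "{p \<in> space (borel \<Otimes>\<^sub>M borel). P (fst p) (snd p)} \<in> sets (borel \<Otimes>\<^sub>M borel :: (path \<times> path) measure)"
    let ?Pi = "Pi\<^sub>M {..<2} (\<lambda>_. borel) :: (nat \<Rightarrow> path) measure"
    have "(\<lambda>q. (q 0, q 1)) \<in> measurable ?Pi (borel \<Otimes>\<^sub>M borel)"
      by (intro measurable_Pair measurable_component_singleton) auto
    from measurable_sets_Collect[OF this P] have S: "{q \<in> space ?Pi. P (q 0) (q 1)} \<in> sets ?Pi" by simp
    have "coalescing_paths 2 ?z B \<omega> = (\<lambda>j\<in>{..<2}. mk_path (coalesce t (C \<omega>) 2 j) (t j))" for \<omega>
      unfolding coalescing_paths_def t_def C_def ..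
    moreover have "coalesce t (C \<omega>) 2 = (C \<omega>)(1 := merge t (C \<omega>) 1 (C \<omega> 1))" for \<omega>
      using co1[of "C \<omega>"] by (simp add: numeral_2_eq_2)
    ultimately have cp: "coalescing_paths 2 ?z B \<omega> 0 = mk_path (C \<omega> 0) s0"
      "coalescing_paths 2 ?z B \<omega> 1 = mk_path (merge t (C \<omega>) 1 (C \<omega> 1)) s1" for \<omega>
      by (simp_all add: t01 del: One_nat_def)
    have "coalescing_paths 2 ?z B \<omega> \<in> space ?Pi" for \<omega>
      by (auto simp: coalescing_paths_def space_PiM)
    moreover have "(\<lambda>j\<in>{..<2}. W (?z j) \<omega>) \<in> space ?Pi" for \<omega> by (auto simp: space_PiM)
    ultimately show "prob {\<omega> \<in> space M. P (W (x0, s0) \<omega>) (W (x1, s1) \<omega>)} =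
      measure N {\<omega> \<in> space N. P (mk_path (\<lambda>v. x0 + B 0 (v - s0) \<omega>) s0) (mk_path (merge t (C \<omega>) 1 (C \<omega> 1)) s1)}"
      using tr[OF S] by (simp add: cp C01 del: One_nat_def)
  qed
qed

text \<open>Being infinite at some time of a compact interval is a measurable event for a path, and it does not
  occur for Brownian motions.\<close>

lemma AE_real: "AE \<omega> in M. \<forall>u. \<bar>tv (W z \<omega>) u\<bar> < 1"
proof (cases z)
  case (Pair x s)
  have "AE \<omega> in M. \<not> (\<exists>u\<in>{- real n..real n}. 1 - \<bar>tv (W z \<omega>) u\<bar> = 0)" for n
  proof -
    obtain N :: "(nat \<Rightarrow> real \<Rightarrow> real) measure" and B where N: "prob_space N" "standard_BM N B" and
      tr: "\<And>P. {p \<in> space borel. P p} \<in> sets borel \<Longrightarrow>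
        prob {\<omega> \<in> space M. P (W (x, s) \<omega>)} = measure N {\<omega> \<in> space N. P (mk_path (\<lambda>v. x + B (v - s) \<omega>) s)}"
      proof -
    show ?thesis by (rule transfer_one[of x s]) (rule that)
  qed
    define P where "P p \<longleftrightarrow> (\<exists>u\<in>{- real n..real n}. 1 - \<bar>tv p u\<bar> = 0)" for p
    have P: "{p \<in> space borel. P p} \<in> sets borel"
      unfolding P_def by (intro sets_Collect_zero_on_interval) (measurable, intro continuous_intros)
    have e: "{\<omega> \<in> space N. P (mk_path (\<lambda>v. x + B (v - s) \<omega>) s)} = {}"
    proof -
      have "\<not> P (mk_path (\<lambda>v. x + B (v - s) \<omega>) s)" if "\<omega> \<in> space N" for \<omega>
      proof -
        have c: "continuous_on {s..} (\<lambda>v. x + B (v - s) \<omega>)"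
          by (intro continuous_intros continuous_on_compose2[OF standard_BM_D(3)[OF N(2) that]]) auto
        have "1 - \<bar>tv (mk_path (\<lambda>v. x + B (v - s) \<omega>) s) u\<bar> \<noteq> 0" for u
          using abs_tanh_less_1[of "x + B (max s u - s) \<omega>"] by (simp add: tv_mk_path[OF c])
        then show ?thesis unfolding P_def by blast
      qed
      then show ?thesis by blast
    qed
    have "prob {\<omega> \<in> space M. P (W z \<omega>)} = 0"
      unfolding Pair tr[OF P] e by (rule measure_empty)
    moreover have "{\<omega> \<in> space M. P (W z \<omega>)} \<in> events" using measurable_sets_Collect[OF W_measurable P] .
    ultimately have "AE \<omega> in M. \<omega> \<notin> {\<omega> \<in> space M. P (W z \<omega>)}" using prob_eq_0 by blast
    then show ?thesis using AE_space by eventually_elim (auto simp: P_def)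
  qed
  then have "AE \<omega> in M. \<forall>n. \<not> (\<exists>u\<in>{- real n..real n}. 1 - \<bar>tv (W z \<omega>) u\<bar> = 0)"
    by (simp add: AE_all_countable)
  then show ?thesis
  proof eventually_elim
    case (elim \<omega>)
    show ?case
    proof
      fix u
      obtain n :: nat where "\<bar>u\<bar> \<le> real n" using real_arch_simple by blast
      then have "u \<in> {- real n..real n}" by auto
      then have "1 - \<bar>tv (W z \<omega>) u\<bar> \<noteq> 0" using elim by blast
      then show "\<bar>tv (W z \<omega>) u\<bar> < 1" using abs_tv_le[of "W z \<omega>" u] by linarith
    qed
  qed
qed

text \<open>Meeting before a rational time without being equal at that time is a measurable event for two paths,
  and it does not occur for coalescing Brownian motions. Continuity extends the conclusion to all times.\<close>

lemma AE_coalesce_ordered: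
  assumes s01: "s0 \<le> s1"
  shows "AE \<omega> in M. \<forall>v u. s1 \<le> v \<longrightarrow> v \<le> u \<longrightarrow> tv (W (x0, s0) \<omega>) v = tv (W (x1, s1) \<omega>) v \<longrightarrow>
    tv (W (x0, s0) \<omega>) u = tv (W (x1, s1) \<omega>) u"
proof -
  define P where "P r p q \<longleftrightarrow> (\<exists>v\<in>{s1..r}. tv p v - tv q v = 0) \<and> tv p r \<noteq> tv q r" for r p q
  have P: "{p \<in> space (borel \<Otimes>\<^sub>M borel). P r (fst p) (snd p)} \<in> sets (borel \<Otimes>\<^sub>M borel)" for r
    unfolding P_def
  proof (intro sets.sets_Collect_conj sets_Collect_zero_on_interval)
    show "{p \<in> space (borel \<Otimes>\<^sub>M borel). tv (fst p) r \<noteq> tv (snd p) r} \<in> sets (borel \<Otimes>\<^sub>M borel)" by measurable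
    show "(\<lambda>p. tv (fst p) v - tv (snd p) v) \<in> borel_measurable (borel \<Otimes>\<^sub>M borel)" for v by measurable
  qed (intro continuous_intros)
  have "AE \<omega> in M. \<not> P r (W (x0, s0) \<omega>) (W (x1, s1) \<omega>)" for r
  proof -
    obtain N :: "(nat \<Rightarrow> real \<Rightarrow> real) measure" and B m where B: "independent_BMs 2 N B"
      and mc: "\<And>\<omega>. \<omega> \<in> space N \<Longrightarrow> continuous_on {s1..} (m \<omega>)"
      and m: "\<And>\<omega> u. \<omega> \<in> space N \<Longrightarrow> m \<omega> u = (if \<exists>v\<in>{s1..u}. x0 + B 0 (v - s0) \<omega> = x1 + B 1 (v - s1) \<omega>
        then x0 + B 0 (u - s0) \<omega> else x1 + B 1 (u - s1) \<omega>)"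
      and tr: "\<And>P. {p \<in> space (borel \<Otimes>\<^sub>M borel). P (fst p) (snd p)} \<in> sets (borel \<Otimes>\<^sub>M borel) \<Longrightarrow>
        prob {\<omega> \<in> space M. P (W (x0, s0) \<omega>) (W (x1, s1) \<omega>)} =
        measure N {\<omega> \<in> space N. P (mk_path (\<lambda>v. x0 + B 0 (v - s0) \<omega>) s0) (mk_path (m \<omega>) s1)}"
      proof -
    show ?thesis by (rule transfer_two[OF s01, of x0 x1]) (rule that)
  qed
    have BM: "standard_BM N (B 0)" using B by (auto simp: independent_BMs_def)
    have "\<not> P r (mk_path (\<lambda>v. x0 + B 0 (v - s0) \<omega>) s0) (mk_path (m \<omega>) s1)" if \<omega>: "\<omega> \<in> space N" for \<omega>
    proof
      assume *: "P r (mk_path (\<lambda>v. x0 + B 0 (v - s0) \<omega>) s0) (mk_path (m \<omega>) s1)"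
      have c0: "continuous_on {s0..} (\<lambda>v. x0 + B 0 (v - s0) \<omega>)"
        by (intro continuous_intros continuous_on_compose2[OF standard_BM_D(3)[OF BM \<omega>]]) auto
      obtain v where v: "v \<in> {s1..r}" "x0 + B 0 (v - s0) \<omega> = m \<omega> v" and ne: "x0 + B 0 (r - s0) \<omega> \<noteq> m \<omega> r"
        using * s01 by (auto simp: P_def tv_mk_path[OF c0] tv_mk_path[OF mc[OF \<omega>]] max_def split: if_splits)
      have "\<exists>v'\<in>{s1..v}. x0 + B 0 (v' - s0) \<omega> = x1 + B 1 (v' - s1) \<omega>"
      proof (rule ccontr)
        assume no: "\<not> ?thesis"
        then have "m \<omega> v = x1 + B 1 (v - s1) \<omega>" using m[OF \<omega>, of v] by simp
        then show False using no v by auto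
      qed
      then have "\<exists>v'\<in>{s1..r}. x0 + B 0 (v' - s0) \<omega> = x1 + B 1 (v' - s1) \<omega>" using v by fastforce
      then show False using m[OF \<omega>, of r] ne by simp
    qed
    then have e: "{\<omega> \<in> space N. P r (mk_path (\<lambda>v. x0 + B 0 (v - s0) \<omega>) s0) (mk_path (m \<omega>) s1)} = {}" by blast
    have "prob {\<omega> \<in> space M. P r (W (x0, s0) \<omega>) (W (x1, s1) \<omega>)} = 0"
      unfolding tr[of "P r", OF P] e by (rule measure_empty)
    moreover have "{\<omega> \<in> space M. P r (W (x0, s0) \<omega>) (W (x1, s1) \<omega>)} \<in> events"
      using measurable_sets_Collect[OF measurable_Pair[OF W_measurable W_measurable] P[of r], of "(x0, s0)" "(x1, s1)"] by simp
    ultimately have "AE \<omega> in M. \<omega> \<notin> {\<omega> \<in> space M. P r (W (x0, s0) \<omega>) (W (x1, s1) \<omega>)}" using prob_eq_0 by blast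
    then show ?thesis using AE_space by eventually_elim auto
  qed
  then have "AE \<omega> in M. \<forall>r\<in>\<rat>. \<not> P r (W (x0, s0) \<omega>) (W (x1, s1) \<omega>)"
    using countable_rat by (subst AE_ball_countable) auto
  then show ?thesis
  proof eventually_elim
    case (elim \<omega>)
    show ?case
    proof (intro allI impI)
      fix v u assume v: "s1 \<le> v" "v \<le> u" "tv (W (x0, s0) \<omega>) v = tv (W (x1, s1) \<omega>) v"
      show "tv (W (x0, s0) \<omega>) u = tv (W (x1, s1) \<omega>) u"
      proof (rule eq_on_rationals_after[OF continuous_tv continuous_tv _ v(3) v(2)])
        fix r :: real assume "r \<in> \<rat>" "v < r"
        then have "\<not> P r (W (x0, s0) \<omega>) (W (x1, s1) \<omega>)" "v \<in> {s1..r}" using elim v by auto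
        then show "tv (W (x0, s0) \<omega>) r = tv (W (x1, s1) \<omega>) r" using v(3) unfolding P_def by auto
      qed
    qed
  qed
qed

lemma AE_coalesce:
  "AE \<omega> in M. \<forall>v u. snd z0 \<le> v \<longrightarrow> snd z1 \<le> v \<longrightarrow> v \<le> u \<longrightarrow> tv (W z0 \<omega>) v = tv (W z1 \<omega>) v \<longrightarrow>
    tv (W z0 \<omega>) u = tv (W z1 \<omega>) u"
proof (cases "snd z0 \<le> snd z1")
  case True
  from AE_coalesce_ordered[OF True, of "fst z0" "fst z1"] show ?thesis
    unfolding prod.collapse by eventually_elim blast
next
  case False
  then have "snd z1 \<le> snd z0" by simp
  from AE_coalesce_ordered[OF this, of "fst z1" "fst z0"] show ?thesis
    unfolding prod.collapse by eventually_elim metis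
qed

end


context web_paths
begin

text \<open>The displacement until time \<open>u\<close> has a law that does not depend on the starting point. So the probability
  of a position below \<open>c\<close> tends to \<open>0\<close> as the starting point moves up, and likewise on the other side.\<close>

lemma AE_unbounded:
  "AE \<omega> in M. (\<exists>n::nat. tanh c < tv (W (real n, s) \<omega>) u) \<and> (\<exists>n::nat. tv (W (- real n, s) \<omega>) u < tanh c)"
  if su: "s < u"
proof -
  define \<nu> where "\<nu> = density lborel (normal_density 0 (sqrt (u - s)))"
  have fin: "prob_space \<nu>" unfolding \<nu>_def using su by (intro prob_space_normal_density) auto
  interpret \<nu>: prob_space \<nu> by fact
  have le: "prob {\<omega> \<in> space M. tv (W (x, s) \<omega>) u \<in> S} = measure \<nu> {y. tanh (x + y) \<in> S}"
    if S: "closed S" for x S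
  proof -
    obtain N :: "(nat \<Rightarrow> real \<Rightarrow> real) measure" and B where N: "prob_space N" "standard_BM N B" and
      tr: "\<And>P. {p \<in> space borel. P p} \<in> sets borel \<Longrightarrow>
        prob {\<omega> \<in> space M. P (W (x, s) \<omega>)} = measure N {\<omega> \<in> space N. P (mk_path (\<lambda>v. x + B (v - s) \<omega>) s)}"
    proof -
      show ?thesis by (rule transfer_one[of x s]) (rule that)
    qed
    have P: "{p \<in> space borel. tv p u \<in> S} \<in> sets borel" using closed_tv[OF S] by auto
    have "prob {\<omega> \<in> space M. tv (W (x, s) \<omega>) u \<in> S} = measure N {\<omega> \<in> space N. tv (mk_path (\<lambda>v. x + B (v - s) \<omega>) s) u \<in> S}"
      by (rule tr[OF P])
    also have "{\<omega> \<in> space N. tv (mk_path (\<lambda>v. x + B (v - s) \<omega>) s) u \<in> S} =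
        {\<omega> \<in> space N. B (u - s) \<omega> - B 0 \<omega> \<in> {y. tanh (x + y) \<in> S}}"
    proof (intro Collect_cong conj_cong refl)
      fix \<omega> assume \<omega>: "\<omega> \<in> space N"
      have "continuous_on {s..} (\<lambda>v. x + B (v - s) \<omega>)"
        by (intro continuous_intros continuous_on_compose2[OF standard_BM_D(3)[OF N(2) \<omega>]]) auto
      from tv_mk_path[OF this] show "(tv (mk_path (\<lambda>v. x + B (v - s) \<omega>) s) u \<in> S) = (B (u - s) \<omega> - B 0 \<omega> \<in> {y. tanh (x + y) \<in> S})"
        using su standard_BM_D(2)[OF N(2) \<omega>] by simp
    qed
    also have "measure N \<dots> = measure \<nu> {y. tanh (x + y) \<in> S}"
    proof -
      have D: "distributed N lborel (\<lambda>\<omega>. B (u - s) \<omega> - B 0 \<omega>) (normal_density 0 (sqrt (u - s)))"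
        using standard_BM_D(4)[OF N(2), of 0 "u - s"] su by simp
      have "closed {y. tanh (x + y) \<in> S}"
        using continuous_closed_vimage[OF S, of "\<lambda>y. tanh (x + y)"]
        by (simp add: vimage_def continuous_intros)
      then have S': "{y. tanh (x + y) \<in> S} \<in> sets lborel" by simp
      have "measure (distr N lborel (\<lambda>\<omega>. B (u - s) \<omega> - B 0 \<omega>)) {y. tanh (x + y) \<in> S} =
          measure N {\<omega> \<in> space N. B (u - s) \<omega> - B 0 \<omega> \<in> {y. tanh (x + y) \<in> S}}"
        by (subst measure_distr[OF distributed_measurable[OF D] S']) (simp add: vimage_def Int_def conj_commute)
      moreover have "distr N lborel (\<lambda>\<omega>. B (u - s) \<omega> - B 0 \<omega>) = \<nu>"
        using D by (simp add: distributed_def \<nu>_def)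
      ultimately show ?thesis by simp
    qed
    finally show ?thesis .
  qed
  have "(\<lambda>n. measure \<nu> {.. c - real n}) \<longlonglongrightarrow> measure \<nu> (\<Inter>n. {.. c - real n})"
    by (rule \<nu>.finite_Lim_measure_decseq) (auto simp: decseq_def \<nu>_def)
  also have "(\<Inter>n. {.. c - real n}) = {}"
  proof -
    have "\<exists>n. \<not> y \<le> c - real n" for y
    proof -
      obtain n :: nat where "c - y < real n" using reals_Archimedean2 by blast
      then show ?thesis by (intro exI[of _ n]) simp
    qed
    then show ?thesis by auto
  qed
  finally have low: "(\<lambda>n. measure \<nu> {.. c - real n}) \<longlonglongrightarrow> 0" by simp
  have "(\<lambda>n. measure \<nu> {c + real n ..}) \<longlonglongrightarrow> measure \<nu> (\<Inter>n. {c + real n ..})"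
    by (rule \<nu>.finite_Lim_measure_decseq) (auto simp: decseq_def \<nu>_def)
  also have "(\<Inter>n. {c + real n ..}) = {}"
  proof -
    have "\<exists>n. \<not> c + real n \<le> y" for y
    proof -
      obtain n :: nat where "y - c < real n" using reals_Archimedean2 by blast
      then show ?thesis by (intro exI[of _ n]) simp
    qed
    then show ?thesis by auto
  qed
  finally have high: "(\<lambda>n. measure \<nu> {c + real n ..}) \<longlonglongrightarrow> 0" by simp
  have null: "AE \<omega> in M. \<exists>n::nat. tv (W (f n, s) \<omega>) u \<notin> S"
    if S: "closed S" and lim: "(\<lambda>n. prob {\<omega> \<in> space M. tv (W (f n, s) \<omega>) u \<in> S}) \<longlonglongrightarrow> 0" for f S
  proof -
    define T where "T = {\<omega> \<in> space M. \<forall>n::nat. tv (W (f n, s) \<omega>) u \<in> S}"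
    have m: "{\<omega> \<in> space M. tv (W (f n, s) \<omega>) u \<in> S} \<in> events" for n
    proof -
      have [measurable]: "S \<in> sets borel" using S by simp
      show ?thesis by measurable
    qed
    have T: "T \<in> events" unfolding T_def by (intro sets.sets_Collect_countable_All m)
    have "prob T \<le> prob {\<omega> \<in> space M. tv (W (f n, s) \<omega>) u \<in> S}" for n
      by (rule finite_measure_mono[OF _ m]) (auto simp: T_def)
    then have "prob T \<le> 0" using LIMSEQ_le_const[OF lim] by blast
    then have "prob T = 0" using measure_nonneg[of M T] by linarith
    from prob_eq_0[THEN iffD1, OF T this] show ?thesis using AE_space by eventually_elim (auto simp: T_def)
  qed
  have "AE \<omega> in M. \<exists>n::nat. tv (W (real n, s) \<omega>) u \<notin> {..tanh c}"
  proof (rule null)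
    have "{y. tanh (real n + y) \<in> {..tanh c}} = {..c - real n}" for n by auto
    then show "(\<lambda>n. prob {\<omega> \<in> space M. tv (W (real n, s) \<omega>) u \<in> {..tanh c}}) \<longlonglongrightarrow> 0"
      using low by (subst le) auto
  qed simp
  moreover have "AE \<omega> in M. \<exists>n::nat. tv (W (- real n, s) \<omega>) u \<notin> {tanh c..}"
  proof (rule null)
    have "{y. tanh (- real n + y) \<in> {tanh c..}} = {c + real n..}" for n by auto
    then show "(\<lambda>n. prob {\<omega> \<in> space M. tv (W (- real n, s) \<omega>) u \<in> {tanh c..}}) \<longlonglongrightarrow> 0"
      using high by (subst le) auto
  qed simp
  ultimately show ?thesis by eventually_elim (auto simp: not_le)
qed

text \<open>The two paths differ at time \<open>u\<close> only if the underlying Brownian motions have not met before. The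
  factor that refers to the position of the first path at time \<open>s\<close> is kept because the estimate is
  summed over a partition of its possible positions.\<close>

lemma meeting_estimate:
  assumes s: "s0 \<le> s" "s < u" and \<delta>: "0 \<le> \<delta>" and \<sigma>: "\<sigma> \<in> {1, -1}"
  shows "prob {\<omega> \<in> space M. near \<sigma> \<delta> d s (W (x0, s0) \<omega>) \<and> tv (W (x0, s0) \<omega>) u \<noteq> tv (W (d, s) \<omega>) u} \<le>
    prob {\<omega> \<in> space M. near \<sigma> \<delta> d s (W (x0, s0) \<omega>)} * (\<delta> / sqrt (pi * (u - s)))"
proof -
  obtain N :: "(nat \<Rightarrow> real \<Rightarrow> real) measure" and B m where B: "independent_BMs 2 N B"
    and mc: "\<And>\<omega>. \<omega> \<in> space N \<Longrightarrow> continuous_on {s..} (m \<omega>)"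
    and m: "\<And>\<omega> u. \<omega> \<in> space N \<Longrightarrow> m \<omega> u = (if \<exists>v\<in>{s..u}. x0 + B 0 (v - s0) \<omega> = d + B 1 (v - s) \<omega>
      then x0 + B 0 (u - s0) \<omega> else d + B 1 (u - s) \<omega>)"
    and tr: "\<And>P. {p \<in> space (borel \<Otimes>\<^sub>M borel). P (fst p) (snd p)} \<in> sets (borel \<Otimes>\<^sub>M borel) \<Longrightarrow>
      prob {\<omega> \<in> space M. P (W (x0, s0) \<omega>) (W (d, s) \<omega>)} =
      measure N {\<omega> \<in> space N. P (mk_path (\<lambda>v. x0 + B 0 (v - s0) \<omega>) s0) (mk_path (m \<omega>) s)}"
  proof -
    show ?thesis by (rule transfer_two[OF s(1), of x0 d]) (rule that)
  qed
  interpret N: prob_space N using B by (simp add: independent_BMs_def)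
  have BM: "standard_BM N (B 0)" "standard_BM N (B 1)" using B by (auto simp: independent_BMs_def)
  define D where "D v \<omega> = (x0 + B 0 (v - s0) \<omega>) - (d + B 1 (v - s) \<omega>)" for v \<omega>
  have R: "reflectable N D s u" unfolding D_def by (rule reflectable_BM_difference[OF B s])
  have R': "reflectable N (\<lambda>v \<omega>. \<sigma> * D v \<omega>) s u"
    using \<sigma> R reflectable_minus[OF R] by auto
  define p0 where "p0 \<omega> = mk_path (\<lambda>v. x0 + B 0 (v - s0) \<omega>) s0" for \<omega>
  define p1 where "p1 \<omega> = mk_path (m \<omega>) s" for \<omega>
  have p0: "tv (p0 \<omega>) v = tanh (x0 + B 0 (v - s0) \<omega>)" if "\<omega> \<in> space N" "s \<le> v" for \<omega> v
  proof -
    have "continuous_on {s0..} (\<lambda>v. x0 + B 0 (v - s0) \<omega>)"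
      by (intro continuous_intros continuous_on_compose2[OF standard_BM_D(3)[OF BM(1) that(1)]]) auto
    then show ?thesis using that s by (simp add: p0_def tv_mk_path max_def)
  qed
  have p1: "tv (p1 \<omega>) u = tanh (m \<omega> u)" if "\<omega> \<in> space N" for \<omega>
    using tv_mk_path[OF mc[OF that]] s by (simp add: p1_def)
  have B0: "B 1 0 \<omega> = 0" if "\<omega> \<in> space N" for \<omega> using standard_BM_D(2)[OF BM(2) that] .
  have near: "near \<sigma> \<delta> d s (p0 \<omega>) \<longleftrightarrow> 0 < \<sigma> * D s \<omega> \<and> \<sigma> * D s \<omega> \<le> \<delta>" if "\<omega> \<in> space N" for \<omega>
    using p0[OF that, of s] B0[OF that] by (auto simp: near_def D_def algebra_simps)
  have ns: "{p. near \<sigma> \<delta> d s p} \<in> sets borel" by (rule near_sets[OF \<sigma>])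
  have P1: "{p \<in> space (borel \<Otimes>\<^sub>M borel). near \<sigma> \<delta> d s (fst p)} \<in> sets (borel \<Otimes>\<^sub>M (borel :: path measure))"
    by (rule measurable_sets_Collect[OF measurable_fst]) (use ns in simp)
  have P2: "{p \<in> space (borel \<Otimes>\<^sub>M borel). near \<sigma> \<delta> d s (fst p) \<and> tv (fst p) u \<noteq> tv (snd p) u} \<in> sets (borel \<Otimes>\<^sub>M borel)"
  proof (rule sets.sets_Collect_conj)
    show "{p \<in> space (borel \<Otimes>\<^sub>M borel). tv (fst p) u \<noteq> tv (snd p) u} \<in> sets (borel \<Otimes>\<^sub>M borel)" by measurable
  qed (rule P1)
  define G where "G = {\<omega> \<in> space N. near \<sigma> \<delta> d s (p0 \<omega>) \<and> (\<forall>v\<in>{s..u}. D v \<omega> \<noteq> 0)}"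
  have Ds [measurable]: "D s \<in> borel_measurable N" using reflectable_D(2,4)[OF R] by auto
  have nearN: "{\<omega> \<in> space N. near \<sigma> \<delta> d s (p0 \<omega>)} \<in> N.events"
  proof -
    have "{\<omega> \<in> space N. near \<sigma> \<delta> d s (p0 \<omega>)} = {\<omega> \<in> space N. 0 < \<sigma> * D s \<omega> \<and> \<sigma> * D s \<omega> \<le> \<delta>}" using near by auto
    also have "\<dots> \<in> N.events" by measurable
    finally show ?thesis .
  qed
  have G: "G \<in> N.events"
  proof -
    have "{\<omega> \<in> space N. \<exists>v\<in>{s..u}. D v \<omega> = 0} \<in> N.events"
      using reflectable_D(3,4)[OF R] by (intro sets_Collect_zero_on_interval) auto
    then have "{\<omega> \<in> space N. near \<sigma> \<delta> d s (p0 \<omega>)} - {\<omega> \<in> space N. \<exists>v\<in>{s..u}. D v \<omega> = 0} \<in> N.events" using nearN by auto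
    also have "{\<omega> \<in> space N. near \<sigma> \<delta> d s (p0 \<omega>)} - {\<omega> \<in> space N. \<exists>v\<in>{s..u}. D v \<omega> = 0} = G" by (auto simp: G_def)
    finally show ?thesis .
  qed
  have Gpos: "0 < \<sigma> * D v \<omega>" if "\<omega> \<in> G" "v \<in> {s..u}" for \<omega> v
  proof (rule ccontr)
    have \<omega>: "\<omega> \<in> space N" and sv: "s \<le> v" using that by (auto simp: G_def)
    assume "\<not> 0 < \<sigma> * D v \<omega>"
    then have "\<sigma> * D v \<omega> \<le> 0" by simp
    moreover have "0 \<le> \<sigma> * D s \<omega>" using near[OF \<omega>] that by (simp add: G_def)
    moreover have "continuous_on {s..v} (\<lambda>v. \<sigma> * D v \<omega>)"
      by (rule continuous_on_subset[OF reflectable_D(3)[OF R' \<omega>]]) (use that in auto)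
    ultimately obtain w where w: "s \<le> w" "w \<le> v" "\<sigma> * D w \<omega> = 0"
      using IVT2'[of "\<lambda>v. \<sigma> * D v \<omega>" v 0 s] sv by auto
    then show False using that \<sigma> by (auto simp: G_def)
  qed
  have "prob {\<omega> \<in> space M. near \<sigma> \<delta> d s (W (x0, s0) \<omega>) \<and> tv (W (x0, s0) \<omega>) u \<noteq> tv (W (d, s) \<omega>) u} =
      measure N {\<omega> \<in> space N. near \<sigma> \<delta> d s (p0 \<omega>) \<and> tv (p0 \<omega>) u \<noteq> tv (p1 \<omega>) u}"
    unfolding p0_def p1_def by (rule tr[OF P2])
  also have "\<dots> \<le> measure N G"
  proof (rule N.finite_measure_mono[OF _ G], safe)
    fix \<omega> assume *: "\<omega> \<in> space N" "near \<sigma> \<delta> d s (p0 \<omega>)" "tv (p0 \<omega>) u \<noteq> tv (p1 \<omega>) u"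
    then have "x0 + B 0 (u - s0) \<omega> \<noteq> m \<omega> u" using p0[of \<omega> u] p1[of \<omega>] s by auto
    then have "\<not> (\<exists>v\<in>{s..u}. x0 + B 0 (v - s0) \<omega> = d + B 1 (v - s) \<omega>)"
      unfolding m[OF *(1), of u] by (metis (no_types, lifting))
    then show "\<omega> \<in> G" using * by (auto simp: G_def D_def)
  qed
  also have "\<dots> \<le> measure N {\<omega> \<in> space N. 0 < \<sigma> * D s \<omega> \<and> \<sigma> * D s \<omega> \<le> \<delta>} * (\<delta> / sqrt (pi * (u - s)))"
    by (rule N.reflection_estimate[OF R' \<delta> G]) (use near Gpos in \<open>auto simp: G_def\<close>)
  also have "{\<omega> \<in> space N. 0 < \<sigma> * D s \<omega> \<and> \<sigma> * D s \<omega> \<le> \<delta>} = {\<omega> \<in> space N. near \<sigma> \<delta> d s (p0 \<omega>)}" using near by auto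
  also have "measure N \<dots> = prob {\<omega> \<in> space M. near \<sigma> \<delta> d s (W (x0, s0) \<omega>)}"
    unfolding p0_def by (rule tr[OF P1, symmetric])
  finally show ?thesis .
qed

text \<open>For each \<open>m\<close> the position at time \<open>s\<close> lies in exactly one of the cells of length \<open>1 / (m + 1)\<close>
  (event \<open>A m k\<close>). By the meeting estimate, the probability that it does and the path has not merged with
  the path from the end of that cell (event \<open>H m k\<close>) is at most \<open>C / (m + 1)\<close> times the probability of
  the cell. The sum over the cells tends to \<open>0\<close> as \<open>m\<close> grows.\<close>

lemma AE_merged_with_neighbour:
  assumes s: "s0 \<le> s" "s < u" and \<sigma>: "\<sigma> \<in> {1, -1}"
  shows "AE \<omega> in M. \<exists>d\<in>\<rat>. \<exists>y. tv (W (x0, s0) \<omega>) s = tanh y \<and> 0 < \<sigma> * (y - d) \<and>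
    tv (W (d, s) \<omega>) u = tv (W (x0, s0) \<omega>) u"
proof -
  define C where "C = 1 / sqrt (pi * (u - s))"
  have C: "0 \<le> C" using s by (simp add: C_def)
  define d where "d m k = \<sigma> * real_of_int k / real (Suc m)" for m :: nat and k :: int
  define A where "A m k = {\<omega> \<in> space M. near \<sigma> (1 / real (Suc m)) (d m k) s (W (x0, s0) \<omega>)}" for m k
  define H where "H m k = {\<omega> \<in> space M. near \<sigma> (1 / real (Suc m)) (d m k) s (W (x0, s0) \<omega>) \<and>
    tv (W (x0, s0) \<omega>) u \<noteq> tv (W (d m k, s) \<omega>) u}" for m k
  have AE: "A m k \<in> events" for m k
    unfolding A_def by (rule measurable_sets_Collect[OF W_measurable]) (use near_sets[OF \<sigma>] in simp)
  have HE: "H m k \<in> events" for m k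
  proof -
    have "{\<omega> \<in> space M. tv (W (x0, s0) \<omega>) u \<noteq> tv (W (d m k, s) \<omega>) u} \<in> events" by measurable
    then have "A m k \<inter> {\<omega> \<in> space M. tv (W (x0, s0) \<omega>) u \<noteq> tv (W (d m k, s) \<omega>) u} \<in> events"
      using AE by (intro sets.Int)
    also have "A m k \<inter> {\<omega> \<in> space M. tv (W (x0, s0) \<omega>) u \<noteq> tv (W (d m k, s) \<omega>) u} = H m k"
      by (auto simp: A_def H_def)
    finally show ?thesis .
  qed
  have \<sigma>\<sigma>: "\<sigma> * \<sigma> = 1" using \<sigma> by auto
  \<comment> \<open>a number \<open>y\<close> lies in exactly one cell\<close>
  have grid: "0 < \<sigma> * (y - d m k) \<and> \<sigma> * (y - d m k) \<le> 1 / real (Suc m) \<longleftrightarrow> k = \<lceil>\<sigma> * y * real (Suc m)\<rceil> - 1" for y m k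
  proof -
    have "\<sigma> * (y - d m k) = \<sigma> * y - (\<sigma> * \<sigma>) * real_of_int k / real (Suc m)" by (simp add: d_def algebra_simps)
    also have "\<dots> = (\<sigma> * y * real (Suc m) - real_of_int k) / real (Suc m)"
      unfolding \<sigma>\<sigma> by (simp add: diff_divide_distrib)
    finally have e: "\<sigma> * (y - d m k) = (\<sigma> * y * real (Suc m) - real_of_int k) / real (Suc m)" .
    have "0 < \<sigma> * (y - d m k) \<and> \<sigma> * (y - d m k) \<le> 1 / real (Suc m) \<longleftrightarrow>
        0 < \<sigma> * y * real (Suc m) - real_of_int k \<and> \<sigma> * y * real (Suc m) - real_of_int k \<le> 1"
      unfolding e by (simp only: zero_less_divide_iff divide_le_cancel) auto
    then show ?thesis by (auto simp: ceiling_eq_iff) linarith+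
  qed
  have disj: "disjoint_family (A m)" for m
    unfolding disjoint_family_on_def
  proof (intro ballI impI)
    fix k l :: int assume "k \<noteq> l"
    have "False" if Ak: "\<omega> \<in> A m k" and Al: "\<omega> \<in> A m l" for \<omega>
    proof -
      obtain y where y: "tv (W (x0, s0) \<omega>) s = tanh y" "0 < \<sigma> * (y - d m k) \<and> \<sigma> * (y - d m k) \<le> 1 / real (Suc m)"
        using Ak unfolding A_def near_def by blast
      obtain y' where y': "tv (W (x0, s0) \<omega>) s = tanh y'" "0 < \<sigma> * (y' - d m l) \<and> \<sigma> * (y' - d m l) \<le> 1 / real (Suc m)"
        using Al unfolding A_def near_def by blast
      have "y = y'" using y y' by simp
      then show False using y(2) y'(2) \<open>k \<noteq> l\<close> unfolding grid by simp
    qed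
    then show "A m k \<inter> A m l = {}" by blast
  qed
  define T where "T m = (\<Union>k. H m k)" for m
  have TE: "T m \<in> events" for m unfolding T_def using HE by auto
  have T: "prob (T m) \<le> C * (1 / real (Suc m))" for m
  proof -
    let ?c = "C * (1 / real (Suc m))"
    have c: "0 \<le> ?c" using C by simp
    have HA: "H m k \<subseteq> A m k" for k by (auto simp: H_def A_def)
    have "emeasure M (T m) = (\<integral>\<^sup>+k. emeasure M (H m k) \<partial>count_space UNIV)"
      unfolding T_def
    proof (rule emeasure_UN_countable)
      show "disjoint_family (H m)" using disj[of m] HA unfolding disjoint_family_on_def by blast
    qed (use HE in auto)
    also have "\<dots> \<le> (\<integral>\<^sup>+k. emeasure M (A m k) * ennreal ?c \<partial>count_space UNIV)"
    proof (rule nn_integral_mono)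
      fix k
      have "prob (H m k) \<le> prob (A m k) * ?c"
        using meeting_estimate[OF s, of "1 / real (Suc m)" \<sigma> "d m k" x0] \<sigma> unfolding H_def A_def C_def by (simp add: mult.commute)
      then show "emeasure M (H m k) \<le> emeasure M (A m k) * ennreal ?c"
        using c by (simp add: emeasure_eq_measure ennreal_mult[symmetric] ennreal_leI del: ennreal_mult'')
    qed
    also have "\<dots> = (\<integral>\<^sup>+k. emeasure M (A m k) \<partial>count_space UNIV) * ennreal ?c"
      by (rule nn_integral_multc) auto
    also have "(\<integral>\<^sup>+k. emeasure M (A m k) \<partial>count_space UNIV) = emeasure M (\<Union>k. A m k)"
      by (rule emeasure_UN_countable[symmetric]) (use AE disj in auto)
    also have "emeasure M (\<Union>k. A m k) * ennreal ?c \<le> 1 * ennreal ?c"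
      by (intro mult_right_mono emeasure_le_1) auto
    finally show ?thesis using c by (simp add: emeasure_eq_measure)
  qed
  have "prob (\<Inter>m. T m) \<le> 0"
  proof (rule LIMSEQ_le_const)
    show "(\<lambda>m. C * (1 / real (Suc m))) \<longlonglongrightarrow> 0"
      using tendsto_mult_right_zero[OF LIMSEQ_inverse_real_of_nat, of C] by (simp add: inverse_eq_divide)
    have "prob (\<Inter>m. T m) \<le> prob (T m)" for m by (rule finite_measure_mono) (use TE in auto)
    then show "\<exists>N. \<forall>n\<ge>N. prob (\<Inter>m. T m) \<le> C * (1 / real (Suc n))" using T order_trans by blast
  qed
  then have "prob (\<Inter>m. T m) = 0" using measure_nonneg[of M "\<Inter>m. T m"] by linarith
  moreover have "(\<Inter>m. T m) \<in> events" using TE by auto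
  ultimately have "AE \<omega> in M. \<omega> \<notin> (\<Inter>m. T m)" using prob_eq_0 by blast
  then show ?thesis using AE_real[of "(x0, s0)"] AE_space
  proof eventually_elim
    case (elim \<omega>)
    then obtain m where m: "\<omega> \<notin> T m" by blast
    obtain y where y: "tv (W (x0, s0) \<omega>) s = tanh y" using tanh_surj elim(2) by blast
    define k where "k = \<lceil>\<sigma> * y * real (Suc m)\<rceil> - 1"
    have k: "0 < \<sigma> * (y - d m k) \<and> \<sigma> * (y - d m k) \<le> 1 / real (Suc m)" unfolding grid k_def ..
    then have "near \<sigma> (1 / real (Suc m)) (d m k) s (W (x0, s0) \<omega>)" unfolding near_def using y by blast
    moreover have "\<omega> \<notin> H m k" using m by (auto simp: T_def)
    ultimately have "tv (W (d m k, s) \<omega>) u = tv (W (x0, s0) \<omega>) u" using elim(3) by (auto simp: H_def)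
    moreover have "d m k \<in> \<rat>" using \<sigma> by (auto simp: d_def)
    ultimately show ?case using y k by blast
  qed
qed

text \<open>On the grid of mesh \<open>1 / m!\<close> in \<open>[-A, A]\<close>, the expected number of neighbours that have not merged is at
  most \<open>2 A m!\<close> times \<open>C / m!\<close>, uniformly in \<open>m\<close>. By Fatou's lemma it stays bounded along a subsequence.
  The factorials make the grids nested and exhaust the rationals.\<close>

lemma AE_finitely_many_survivors:
  assumes su: "s < u"
  shows "AE \<omega> in M. finite {tv (W (d, s) \<omega>) u |d. d \<in> \<rat> \<and> \<bar>d\<bar> \<le> real A}"
proof -
  define C where "C = 1 / sqrt (pi * (u - s))"
  have C: "0 \<le> C" using su by (simp add: C_def)
  define x where "x m i = - real A + real i / fact m" for m i :: nat
  define jump where "jump m i = {\<omega> \<in> space M. tv (W (x m i, s) \<omega>) u \<noteq> tv (W (x m (Suc i), s) \<omega>) u}" for m i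
  have jE [measurable]: "jump m i \<in> events" for m i unfolding jump_def by measurable
  have jump: "prob (jump m i) \<le> C / fact m" for m i
  proof -
    let ?S = "{\<omega> \<in> space M. near 1 (1 / fact m) (x m i) s (W (x m (Suc i), s) \<omega>) \<and>
      tv (W (x m (Suc i), s) \<omega>) u \<noteq> tv (W (x m i, s) \<omega>) u}"
    have nE: "{\<omega> \<in> space M. near 1 (1 / fact m) (x m i) s (W (x m (Suc i), s) \<omega>)} \<in> events"
      by (rule measurable_sets_Collect[OF W_measurable]) (use near_sets[of 1] in simp)
    have "?S = {\<omega> \<in> space M. near 1 (1 / fact m) (x m i) s (W (x m (Suc i), s) \<omega>)} \<inter> jump m i"
      by (auto simp: jump_def)
    then have SE: "?S \<in> events" using nE by simp
    have "prob (jump m i) \<le> prob ?S"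
    proof (rule finite_measure_mono_AE[OF _ SE])
      show "AE \<omega> in M. \<omega> \<in> jump m i \<longrightarrow> \<omega> \<in> ?S"
        using AE_start[of "(x m (Suc i), s)"]
      proof eventually_elim
        case (elim \<omega>)
        then have "near 1 (1 / fact m) (x m i) s (W (x m (Suc i), s) \<omega>)"
          unfolding near_def by (intro exI[of _ "x m (Suc i)"]) (auto simp: x_def add_divide_distrib)
        then show ?case by (auto simp: jump_def)
      qed
    qed
    also have "\<dots> \<le> prob {\<omega> \<in> space M. near 1 (1 / fact m) (x m i) s (W (x m (Suc i), s) \<omega>)} * (1 / fact m / sqrt (pi * (u - s)))"
      using su by (intro meeting_estimate) auto
    also have "\<dots> \<le> 1 * (1 / fact m / sqrt (pi * (u - s)))"
      using su by (intro mult_right_mono prob_le_1) auto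
    finally show ?thesis by (simp add: C_def field_simps)
  qed
  define J where "J m \<omega> = (\<Sum>i<2 * A * fact m. indicator (jump m i) \<omega> :: ennreal)" for m \<omega>
  have JM [measurable]: "J m \<in> borel_measurable M" for m unfolding J_def by measurable
  have EJ: "(\<integral>\<^sup>+\<omega>. J m \<omega> \<partial>M) \<le> ennreal (2 * real A * C)" for m
  proof -
    have "(\<integral>\<^sup>+\<omega>. J m \<omega> \<partial>M) = (\<Sum>i<2 * A * fact m. emeasure M (jump m i))"
      unfolding J_def by (subst nn_integral_sum) auto
    also have "\<dots> \<le> (\<Sum>i<2 * A * fact m. ennreal (C / fact m))"
      using jump by (intro sum_mono) (simp add: emeasure_eq_measure ennreal_leI)
    also have "\<dots> = ennreal (\<Sum>i<2 * A * fact m. C / fact m)"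
      using C by (intro sum_ennreal) auto
    also have "(\<Sum>i<2 * A * fact m. C / fact m) = 2 * real A * C" by simp
    finally show ?thesis .
  qed
  have "(\<integral>\<^sup>+\<omega>. liminf (\<lambda>m. J m \<omega>) \<partial>M) \<le> liminf (\<lambda>m. \<integral>\<^sup>+\<omega>. J m \<omega> \<partial>M)"
    by (rule nn_integral_liminf) auto
  also have "\<dots> \<le> ennreal (2 * real A * C)"
    by (rule Liminf_le) (use EJ in \<open>auto intro: always_eventually\<close>)
  finally have "(\<integral>\<^sup>+\<omega>. liminf (\<lambda>m. J m \<omega>) \<partial>M) \<noteq> \<infinity>" by (auto simp: top_unique)
  then have "AE \<omega> in M. liminf (\<lambda>m. J m \<omega>) \<noteq> \<infinity>"
    by (rule nn_integral_PInf_AE[rotated]) measurable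
  then show ?thesis using AE_space
  proof eventually_elim
    case (elim \<omega>)
    define g where "g d = tv (W (d, s) \<omega>) u" for d
    define Q where "Q = {d. d \<in> \<rat> \<and> \<bar>d\<bar> \<le> real A}"
    obtain K :: nat where K: "liminf (\<lambda>m. J m \<omega>) < of_nat K"
      using elim(1) by (metis ennreal_Ex_less_of_nat infinity_ennreal_def less_top)
    have freq: "\<exists>m\<ge>m0. J m \<omega> < of_nat K" for m0
    proof (rule ccontr)
      assume "\<not> ?thesis"
      then have "eventually (\<lambda>m. of_nat K \<le> J m \<omega>) sequentially"
        unfolding eventually_sequentially by (auto simp: not_less)
      then have "of_nat K \<le> liminf (\<lambda>m. J m \<omega>)" by (rule Liminf_bounded)
      with K show False by simp
    qed
    have Jeq: "J m \<omega> = of_nat (\<Sum>i<2 * A * fact m. if g (x m i) \<noteq> g (x m (Suc i)) then 1 else 0)" for m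
      unfolding J_def of_nat_sum using elim(2) by (intro sum.cong) (auto simp: jump_def g_def)
    have "card V \<le> K" if V: "finite V" "V \<subseteq> g ` Q" for V
    proof -
      obtain F where F: "finite F" "F \<subseteq> Q" "V = g ` F" using finite_subset_image[OF V] by blast
      have "\<exists>r. \<forall>m\<ge>r. \<exists>i\<le>2 * A * fact m. d = x m i" if "d \<in> Q" for d
      proof -
        from that have "d \<in> \<rat>" "\<bar>d\<bar> \<le> real A" by (auto simp: Q_def)
        then obtain p :: int and r :: nat where d: "d = real_of_int p / real r" "r \<noteq> 0"
          unfolding Rats_eq_int_div_nat by blast
        show ?thesis
        proof (rule exI[of _ r], intro allI impI)
          fix m assume "r \<le> m"
          then have "r dvd fact m" using d(2) by (intro dvd_fact) auto
          then obtain l where l: "fact m = r * l" by (auto simp: dvd_def)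
          have lr: "(fact m :: real) = real r * real l" using l by (metis of_nat_fact of_nat_mult)
          define i where "i = nat (p * int l + int (A * fact m))"
          have di: "(d + real A) * fact m = real_of_int (p * int l + int (A * fact m))"
            using d(2) by (simp add: d(1) lr l distrib_right)
          moreover have "0 \<le> (d + real A) * fact m" using \<open>\<bar>d\<bar> \<le> real A\<close> by (intro mult_nonneg_nonneg) auto
          ultimately have i: "real i = (d + real A) * fact m" unfolding i_def by (simp only: of_int_0_le_iff of_nat_nat)
          have "(d + real A) * fact m \<le> 2 * real A * fact m" using \<open>\<bar>d\<bar> \<le> real A\<close> by (intro mult_right_mono) auto
          then have "real i \<le> real (2 * A * fact m)" unfolding i by simp
          then have "i \<le> 2 * A * fact m" by (simp only: of_nat_le_iff)
          moreover have "d = x m i" unfolding x_def i by simp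
          ultimately show "\<exists>i\<le>2 * A * fact m. d = x m i" by blast
        qed
      qed
      then obtain r where r: "\<And>d m. d \<in> Q \<Longrightarrow> r d \<le> m \<Longrightarrow> \<exists>i\<le>2 * A * fact m. d = x m i" by metis
      define m0 where "m0 = Max (insert 0 (r ` F))"
      obtain m where m: "m0 \<le> m" "J m \<omega> < of_nat K" using freq by blast
      have "F \<subseteq> x m ` {0..2 * A * fact m}"
      proof
        fix d assume d: "d \<in> F"
        then have "r d \<le> m0" unfolding m0_def using F(1) by (intro Max_ge) auto
        then show "d \<in> x m ` {0..2 * A * fact m}" using r[of d m] d F(2) m(1) by force
      qed
      then have "V \<subseteq> (\<lambda>i. g (x m i)) ` {0..2 * A * fact m}" using F(3) by blast
      then have "card V \<le> card ((\<lambda>i. g (x m i)) ` {0..2 * A * fact m})" by (intro card_mono) auto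
      also have "\<dots> \<le> 1 + (\<Sum>i<2 * A * fact m. if g (x m i) \<noteq> g (x m (Suc i)) then 1 else 0)"
        by (rule card_image_le_jumps)
      also have "\<dots> \<le> K"
      proof -
        have "(\<Sum>i<2 * A * fact m. if g (x m i) \<noteq> g (x m (Suc i)) then 1 else 0) < K"
          using m(2) unfolding Jeq by (metis (no_types, lifting) leD leI of_nat_mono)
        then show ?thesis by simp
      qed
      finally show ?thesis .
    qed
    then have "finite (g ` Q)"
      using finite_if_finite_subsets_card_bdd[of "g ` Q" K] by blast
    moreover have "{tv (W (d, s) \<omega>) u |d. d \<in> \<rat> \<and> \<bar>d\<bar> \<le> real A} = g ` Q" by (auto simp: g_def Q_def)
    ultimately show ?case by simp
  qed
qed

end


section \<open>A set of paths without additional touched points is the web\<close>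

lemma tanh_rat_between:
  assumes "a < b" "a < 1" "-1 < b"
  shows "\<exists>x\<in>\<rat>. a < tanh x \<and> tanh x < (b::real)"
proof -
  define l where "l = max a (-1)"
  define h where "h = min b 1"
  have lh: "l < h" using assms by (auto simp: l_def h_def)
  have b: "-1 \<le> l" "h \<le> 1" "a \<le> l" "h \<le> b" by (auto simp: l_def h_def)
  have "\<bar>l + (h - l) / 3\<bar> < 1" "\<bar>h - (h - l) / 3\<bar> < 1"
    using lh b by (auto simp: abs_less_iff field_simps)
  then obtain x y where xy: "l + (h - l) / 3 = tanh x" "h - (h - l) / 3 = tanh y" using tanh_surj by metis
  have "tanh x < tanh y" unfolding xy[symmetric] using lh by (simp add: field_simps)
  then have "x < y" by simp
  then obtain q where q: "q \<in> \<rat>" "x < q" "q < y" using Rats_dense_in_real by blast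
  have "tanh x < tanh q" "tanh q < tanh y" using q by simp_all
  moreover have "a < tanh x" "tanh y < b" unfolding xy[symmetric] using lh b by (auto simp: field_simps)
  ultimately have "a < tanh q" "tanh q < b" by linarith+
  then show ?thesis using q(1) by blast
qed

text \<open>Closeness is measured by \<open>\<Psi>\<close> because \<open>a\<close> may be \<open>-\<infinity>\<close>; real times close to it are very negative ones.\<close>

lemma real_time_near:
  assumes "a < (b::ereal)" "a \<noteq> \<infinity>" "0 < e"
  obtains t where "a < ereal t" "ereal t < b" "Psi (ereal t) < Psi a + e"
proof -
  define c where "c = Psi a + e"
  have "\<exists>b'. a < b' \<and> b' \<le> b \<and> (\<forall>x<b'. Psi x < c)"
  proof (cases "c < 1")
    case True
    have "-1 \<le> Psi a" using abs_tanh_ereal_le[of a] by (simp add: Psi_def)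
    then have "\<bar>c\<bar> < 1" using True assms by (simp add: c_def)
    then obtain r where r: "c = tanh r" using tanh_surj by blast
    have c: "c = Psi (ereal r)" by (simp add: Psi_def r)
    have lt: "Psi x < Psi y \<longleftrightarrow> x < y" for x y using Psi_le_iff[of y x] by (simp add: not_le[symmetric])
    have "a < ereal r" using assms(3) lt[of a "ereal r"] c by (simp add: c_def)
    then show ?thesis using assms(1) lt c by (intro exI[of _ "min b (ereal r)"]) auto
  next
    case False
    have "Psi x < c" if "x < b" for x
    proof -
      have "x \<noteq> \<infinity>" using that by auto
      then have "Psi x < 1" using tanh_real_lt_1 by (cases x) (auto simp: Psi_def)
      then show ?thesis using False by simp
    qed
    then show ?thesis using assms(1) by blast
  qed
  then obtain b' where b': "a < b'" "b' \<le> b" "\<And>x. x < b' \<Longrightarrow> Psi x < c" by blast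
  obtain t where "a < ereal t" "ereal t < b'" using ereal_dense2[OF b'(1)] by auto
  then show thesis using that b' c_def by force
qed

text \<open>A realization: \<open>W\<close> is the skeleton, \<open>X\<close> its closure and \<open>K\<close> a compact set of paths that contains it and
  has the same touched points. Statements for the two sides of a path are combined by the sign \<open>\<sigma>\<close>.\<close>

locale web_sample =
  fixes K X :: path_set and W :: "real \<times> real \<Rightarrow> path"
  assumes X_def: "paths_of X = closure (W ` (\<rat> \<times> \<rat>))"
    and XK: "paths_of X \<subseteq> paths_of K"
    and start: "\<And>x s. x \<in> \<rat> \<Longrightarrow> s \<in> \<rat> \<Longrightarrow> start (W (x, s)) = ereal s"
    and at_start: "\<And>x s. x \<in> \<rat> \<Longrightarrow> s \<in> \<rat> \<Longrightarrow> tv (W (x, s)) s = tanh x"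
    and real_valued: "\<And>z u. z \<in> \<rat> \<times> \<rat> \<Longrightarrow> \<bar>tv (W z) u\<bar> < 1"
    and coalescing: "\<And>z z' v u. z \<in> \<rat> \<times> \<rat> \<Longrightarrow> z' \<in> \<rat> \<times> \<rat> \<Longrightarrow> snd z \<le> v \<Longrightarrow> snd z' \<le> v \<Longrightarrow> v \<le> u \<Longrightarrow>
      tv (W z) v = tv (W z') v \<Longrightarrow> tv (W z) u = tv (W z') u"
    and unbounded: "\<And>\<sigma> s u c. \<sigma> \<in> {1, -1} \<Longrightarrow> s \<in> \<rat> \<Longrightarrow> u \<in> \<rat> \<Longrightarrow> s < u \<Longrightarrow> \<exists>x\<in>\<rat>. \<sigma> * tanh c < \<sigma> * tv (W (x, s)) u"
    and neighbour: "\<And>\<sigma> z s u. \<sigma> \<in> {1, -1} \<Longrightarrow> z \<in> \<rat> \<times> \<rat> \<Longrightarrow> s \<in> \<rat> \<Longrightarrow> u \<in> \<rat> \<Longrightarrow> snd z \<le> s \<Longrightarrow> s < u \<Longrightarrow>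
      \<exists>d\<in>\<rat>. \<sigma> * tanh d < \<sigma> * tv (W z) s \<and> tv (W (d, s)) u = tv (W z) u"
    and finitely_many: "\<And>s u A. s \<in> \<rat> \<Longrightarrow> u \<in> \<rat> \<Longrightarrow> s < u \<Longrightarrow> finite {tv (W (d, s)) u |d. d \<in> \<rat> \<and> \<bar>d\<bar> \<le> real A}"
    and touched: "\<And>s u a b. s \<in> \<rat> \<Longrightarrow> u \<in> \<rat> \<Longrightarrow> a \<in> \<rat> \<Longrightarrow> b \<in> \<rat> \<Longrightarrow> s < u \<Longrightarrow> a < b \<Longrightarrow>
      finite (touched_reals X s u a b) \<Longrightarrow> touched_reals K s u a b = touched_reals X s u a b"
begin

lemma W_in_X: "z \<in> \<rat> \<times> \<rat> \<Longrightarrow> W z \<in> paths_of X"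
  unfolding X_def by (rule subsetD[OF closure_subset imageI])

lemma X_approx:
  assumes "q \<in> paths_of X" "0 < e"
  obtains z where "z \<in> \<rat> \<times> \<rat>" "dist (W z) q < e"
  using assms unfolding X_def closure_approachable by auto

lemma start': "z \<in> \<rat> \<times> \<rat> \<Longrightarrow> start (W z) = ereal (snd z)"
  using start by auto

text \<open>The metric controls the starting time and, up to a factor \<open>1 + \<bar>t\<bar>\<close>, the position at each time \<open>t\<close>. An
  approximating path may start later than \<open>q\<close>, hence only before a time \<open>s'\<close> after \<open>s\<close>.\<close>

lemma X_approx_at:
  assumes q: "q \<in> paths_of X" "start q \<le> ereal s" "s < s'" and c: "0 < c1" "0 < c2"
  obtains z where "z \<in> \<rat> \<times> \<rat>" "snd z < s'" "\<bar>tv (W z) t1 - tv q t1\<bar> < c1" "\<bar>tv (W z) t2 - tv q t2\<bar> < c2"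
proof -
  define \<eta> where "\<eta> = min (c1 / (1 + \<bar>t1\<bar>)) (min (c2 / (1 + \<bar>t2\<bar>)) (Psi (ereal s') - Psi (ereal s)))"
  have "0 < c1 / (1 + \<bar>t1\<bar>)" "0 < c2 / (1 + \<bar>t2\<bar>)" using c by (auto intro!: divide_pos_pos)
  moreover have "Psi (ereal s) < Psi (ereal s')" using q(3) by (simp add: Psi_def)
  ultimately have \<eta>: "0 < \<eta>" by (simp add: \<eta>_def)
  have \<eta>le: "\<eta> \<le> c1 / (1 + \<bar>t1\<bar>)" "\<eta> \<le> c2 / (1 + \<bar>t2\<bar>)" "\<eta> \<le> Psi (ereal s') - Psi (ereal s)"
    unfolding \<eta>_def by linarith+
  obtain z where z: "z \<in> \<rat> \<times> \<rat>" "dist (W z) q < \<eta>" using X_approx[OF q(1) \<eta>] .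
  have "\<bar>Psi (start (W z)) - Psi (start q)\<bar> < \<eta>" using start_dist[of "W z" q] z(2) by linarith
  moreover have "Psi (start q) \<le> Psi (ereal s)" using q(2) by (simp only: Psi_le_iff)
  ultimately have "Psi (start (W z)) < Psi (ereal s')" using \<eta>le(3) by linarith
  then have zs: "snd z < s'" using start'[OF z(1)] by (simp add: Psi_def)
  have close: "\<bar>tv (W z) t - tv q t\<bar> < c" if "\<eta> \<le> c / (1 + \<bar>t\<bar>)" for t c
  proof -
    have "\<bar>tv (W z) t - tv q t\<bar> \<le> (1 + \<bar>t\<bar>) * dist (W z) q" by (rule tv_dist)
    also have "\<dots> < (1 + \<bar>t\<bar>) * \<eta>" using z(2) by (intro mult_strict_left_mono) auto
    also have "\<dots> \<le> (1 + \<bar>t\<bar>) * (c / (1 + \<bar>t\<bar>))" using that by (intro mult_left_mono) auto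
    also have "\<dots> = c" by (simp add: add_nonneg_eq_0_iff)
    finally show ?thesis .
  qed
  show thesis by (rule that[OF z(1) zs close[OF \<eta>le(1)] close[OF \<eta>le(2)]])
qed

lemma no_crossing:
  assumes \<sigma>: "\<sigma> \<in> {1, -1}" and z: "z \<in> \<rat> \<times> \<rat>" "z' \<in> \<rat> \<times> \<rat>" "snd z \<le> v" "snd z' \<le> v" "v \<le> u"
    and le: "\<sigma> * tv (W z) v \<le> \<sigma> * tv (W z') v"
  shows "\<sigma> * tv (W z) u \<le> \<sigma> * tv (W z') u"
proof (rule ccontr)
  let ?f = "\<lambda>t. \<sigma> * tv (W z') t - \<sigma> * tv (W z) t"
  assume "\<not> ?thesis"
  then have "?f u \<le> 0" "0 \<le> ?f v" using le by auto
  moreover have "continuous_on {v..u} ?f" by (intro continuous_intros)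
  ultimately obtain w where w: "v \<le> w" "w \<le> u" "?f w = 0"
    using IVT2'[of ?f u 0 v] z(5) by auto
  then have "tv (W z) w = tv (W z') w" using \<sigma> by auto
  then have "tv (W z) u = tv (W z') u" using coalescing[OF z(1,2), of w u] w z by auto
  with \<open>\<not> ?thesis\<close> show False by simp
qed

text \<open>The path is approximated by a skeleton path, for which the claim is \<open>no_crossing\<close>. That path may start only
  shortly after \<open>s\<close>, when the path from \<open>d\<close> has not yet moved far.\<close>

lemma squeeze:
  assumes \<sigma>: "\<sigma> \<in> {1, -1}" and q: "q \<in> paths_of X" "start q \<le> ereal s" and ds: "d \<in> \<rat>" "s \<in> \<rat>"
    and lt: "\<sigma> * tanh d < \<sigma> * tv q s" and u: "s \<le> u"
  shows "\<sigma> * tv (W (d, s)) u \<le> \<sigma> * tv q u"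
proof (rule ccontr)
  assume neg: "\<not> ?thesis"
  have \<sigma>1: "\<bar>\<sigma>\<bar> = 1" using \<sigma> by auto
  have D: "(d, s) \<in> \<rat> \<times> \<rat>" using ds by simp
  let ?r = "\<lambda>t. \<sigma> * tv (W (d, s)) t"
  have rs: "?r s = \<sigma> * tanh d" using at_start[OF ds] by simp
  have su: "s < u"
  proof (rule ccontr)
    assume "\<not> s < u"
    then have "u = s" using u by simp
    then show False using neg lt rs by simp
  qed
  define g where "g = \<sigma> * tv q s - \<sigma> * tanh d"
  have g: "0 < g" using lt by (simp add: g_def)
  have "continuous_on UNIV ?r" by (intro continuous_intros)
  then obtain h where h: "0 < h" "\<And>t. \<bar>t - s\<bar> < h \<Longrightarrow> \<bar>?r t - ?r s\<bar> < g / 2"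
    using g unfolding continuous_on_iff dist_real_def by (metis UNIV_I half_gt_zero)
  \<comment> \<open>until time \<open>s + h\<close> the skeleton path has not bridged half of the gap \<open>g\<close>\<close>
  define s'' where "s'' = min u (s + h)"
  have s'': "s < s''" using su h by (simp add: s''_def)
  obtain z where z: "z \<in> \<rat> \<times> \<rat>" and zs: "snd z < s''"
    and c1: "\<bar>tv (W z) s - tv q s\<bar> < g / 2" and c2: "\<bar>tv (W z) u - tv q u\<bar> < ?r u - \<sigma> * tv q u"
    using X_approx_at[OF q s'', of "g / 2" "?r u - \<sigma> * tv q u" s u] g neg by auto
  have absw: "\<bar>\<sigma> * x - \<sigma> * y\<bar> = \<bar>x - y\<bar>" for x y
    using \<sigma>1 by (simp add: right_diff_distrib[symmetric] abs_mult)
  define s' where "s' = max s (snd z)"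
  have "tv (W z) s' = tv (W z) s"
  proof (cases "snd z \<le> s")
    case False
    then show ?thesis unfolding s'_def using start'[OF z] by (intro tv_before_start) auto
  qed (simp add: s'_def)
  moreover have "\<bar>\<sigma> * tv (W z) s - \<sigma> * tv q s\<bar> < g / 2" unfolding absw by (rule c1)
  moreover have "\<sigma> * tv q s = \<sigma> * tanh d + g" by (simp add: g_def)
  ultimately have "\<sigma> * tanh d + g / 2 < \<sigma> * tv (W z) s'" by (simp only:)
  moreover have "\<bar>s' - s\<bar> < h"
    using zs h s'' by (auto simp: s'_def s''_def)
  then have "?r s' < \<sigma> * tanh d + g / 2" using h(2)[of s'] rs by linarith
  ultimately have "?r s' \<le> \<sigma> * tv (W z) s'" by linarith
  moreover have "s' \<le> u" using zs su by (auto simp: s'_def s''_def)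
  ultimately have "?r u \<le> \<sigma> * tv (W z) u"
    using no_crossing[OF \<sigma> D z, of s' u] by (simp add: s'_def)
  moreover have "\<bar>\<sigma> * tv (W z) u - \<sigma> * tv q u\<bar> < ?r u - \<sigma> * tv q u" unfolding absw by (rule c2)
  ultimately show False by linarith
qed

lemma squeeze_between:
  assumes q: "q \<in> paths_of X" "start q \<le> ereal s" and s: "s \<in> \<rat>" "s \<le> u" and d: "d1 \<in> \<rat>" "d2 \<in> \<rat>"
    and lt: "tanh d1 < tv q s" "tv q s < tanh d2"
  shows "tv (W (d1, s)) u \<le> tv q u" "tv q u \<le> tv (W (d2, s)) u"
  using squeeze[of 1 q s d1 u] squeeze[of "-1" q s d2 u] assms by auto

text \<open>Shortly after \<open>s\<close>, at a rational time \<open>s'\<close>, all paths under consideration are still confined to a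
  bounded interval by two skeleton paths. Skeleton paths that approximate one of them have started by
  then, and have merged until time \<open>u\<close> with skeleton paths that start in this interval at time \<open>s'\<close>. These
  have only finitely many positions at time \<open>u\<close>, so limits of them are among these positions.\<close>

lemma finite_touched_X:
  assumes su: "s \<in> \<rat>" "u \<in> \<rat>" "s < u" and ab: "a \<in> \<rat>" "b \<in> \<rat>"
  shows "finite (touched_reals X s u a b)"
    and "x \<in> touched_reals X s u a b \<Longrightarrow> \<exists>z\<in>\<rat> \<times> \<rat>. snd z \<le> u \<and> tv (W z) u = tanh x"
proof -
  let ?f = "tv (W (a - 1, s))" and ?g = "tv (W (b + 1, s))"
  have ab1: "a - 1 \<in> \<rat>" "a - 2 \<in> \<rat>" "b + 1 \<in> \<rat>" "b + 2 \<in> \<rat>" using ab by auto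
  have fs: "?f s = tanh (a - 1)" "?g s = tanh (b + 1)" using at_start ab1 su by auto
  have "continuous_on UNIV ?f" "continuous_on UNIV ?g" by (intro continuous_intros)+
  moreover have "0 < ?f s - tanh (a - 2)" "0 < tanh (b + 2) - ?g s" unfolding fs by simp_all
  ultimately obtain h1 h2 where h: "0 < h1" "\<And>t. \<bar>t - s\<bar> < h1 \<Longrightarrow> \<bar>?f t - ?f s\<bar> < ?f s - tanh (a - 2)"
    "0 < h2" "\<And>t. \<bar>t - s\<bar> < h2 \<Longrightarrow> \<bar>?g t - ?g s\<bar> < tanh (b + 2) - ?g s"
    unfolding continuous_on_iff dist_real_def by (metis UNIV_I)
  have "s < Min {s + h1, s + h2, u}" using h su by auto
  then obtain s' where s': "s' \<in> \<rat>" "s < s'" "s' < Min {s + h1, s + h2, u}" using Rats_dense_in_real by blast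
  then have s'u: "s' < u" and sh: "\<bar>s' - s\<bar> < h1" "\<bar>s' - s\<bar> < h2" by auto
  have f': "tanh (a - 2) < ?f s'" and g': "?g s' < tanh (b + 2)" using h(2)[OF sh(1)] h(4)[OF sh(2)] by linarith+
  obtain A :: nat where A: "max \<bar>a - 2\<bar> \<bar>b + 2\<bar> \<le> real A" using real_arch_simple by blast
  define V where "V = {tv (W (d, s')) u |d. d \<in> \<rat> \<and> \<bar>d\<bar> \<le> real A}"
  have V: "finite V" unfolding V_def by (rule finitely_many[OF s'(1) su(2) s'u])
  have inV: "tv q u \<in> V" if q: "q \<in> paths_of X" "start q \<le> ereal s" "tanh a \<le> tv q s" "tv q s \<le> tanh b" for q
  proof -
    have "tanh (a - 1) < tanh a" "tanh b < tanh (b + 1)" by simp_all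
    then have "tanh (a - 1) < tv q s" "tv q s < tanh (b + 1)" using q by linarith+
    from squeeze_between[OF q(1,2) su(1) less_imp_le[OF s'(2)] ab1(1,3) this]
    have qs': "tanh (a - 2) < tv q s'" "tv q s' < tanh (b + 2)" using f' g' by linarith+
    have "tv q u \<in> closure V"
      unfolding closure_approachable
    proof safe
      fix e :: real assume e: "0 < e"
      let ?c = "min (tv q s' - tanh (a - 2)) (tanh (b + 2) - tv q s')"
      obtain z where z: "z \<in> \<rat> \<times> \<rat>" and zs: "snd z < s'"
        and c1: "\<bar>tv (W z) s' - tv q s'\<bar> < ?c" and c2: "\<bar>tv (W z) u - tv q u\<bar> < e"
        using X_approx_at[OF q(1,2) s'(2), of ?c e s' u] qs' e by auto
      have zs': "tanh (a - 2) < tv (W z) s'" "tv (W z) s' < tanh (b + 2)"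
        using c1 by linarith+
      obtain d where d: "d \<in> \<rat>" "tanh d < tv (W z) s'" "tv (W (d, s')) u = tv (W z) u"
        using neighbour[of 1 z s' u] z s' su zs s'u by auto
      \<comment> \<open>\<open>d\<close> might lie below the interval; then the path from \<open>a - 2\<close> is squeezed in between\<close>
      define d' where "d' = max d (a - 2)"
      have d': "d' \<in> \<rat>" "tanh d' < tv (W z) s'" using d ab1 zs' by (auto simp: d'_def max_def)
      have "tv (W (d', s')) u = tv (W z) u"
      proof (rule antisym)
        have "1 * tv (W (d', s')) u \<le> 1 * tv (W z) u"
          by (rule no_crossing[where v = s']) (use d' z s' zs s'u at_start[of d' s'] in auto)
        then show "tv (W (d', s')) u \<le> tv (W z) u" by simp
        have "1 * tv (W (d, s')) u \<le> 1 * tv (W (d', s')) u"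
          by (rule no_crossing[where v = s']) (use d d' s' s'u at_start[of d' s'] at_start[of d s'] in \<open>auto simp: d'_def\<close>)
        then show "tv (W z) u \<le> tv (W (d', s')) u" using d(3) by simp
      qed
      moreover have "\<bar>d'\<bar> \<le> real A"
      proof -
        have "tanh d' < tanh (b + 2)" using d'(2) zs'(2) by linarith
        then have "d' < b + 2" by simp
        moreover have "a - 2 \<le> d'" by (simp add: d'_def)
        ultimately show ?thesis using A by linarith
      qed
      ultimately have "tv (W z) u \<in> V" unfolding V_def using d'(1) by (intro CollectI exI[of _ d']) auto
      moreover have "dist (tv (W z) u) (tv q u) < e" using c2 by (simp add: dist_real_def)
      ultimately show "\<exists>y\<in>V. dist y (tv q u) < e" by blast
    qed
    then show ?thesis using V by (simp add: finite_imp_closed closure_closed)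
  qed
  have sub: "tanh ` touched_reals X s u a b \<subseteq> V"
  proof
    fix y assume "y \<in> tanh ` touched_reals X s u a b"
    then obtain q where "q \<in> paths_of X" "start q \<le> ereal s" "tanh a \<le> tv q s" "tv q s \<le> tanh b" "y = tv q u"
      by (auto simp: touched_reals_def)
    then show "y \<in> V" using inV by blast
  qed
  then show "finite (touched_reals X s u a b)"
    using finite_imageD[OF finite_subset[OF sub V]] by (simp add: inj_on_def)
  assume "x \<in> touched_reals X s u a b"
  then have "tanh x \<in> V" using sub by blast
  then obtain d where "d \<in> \<rat>" "tanh x = tv (W (d, s')) u" by (auto simp: V_def)
  then show "\<exists>z\<in>\<rat> \<times> \<rat>. snd z \<le> u \<and> tv (W z) u = tanh x"
    using s' s'u by (intro bexI[of _ "(d, s')"]) auto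
qed

text \<open>Finiteness of the touched points of \<open>X\<close> allows to transfer a touched point from \<open>K\<close> to \<open>X\<close>. The interval
  at time \<open>s\<close> can be chosen as small as desired.\<close>

lemma touched_by_X:
  assumes p: "p \<in> paths_of K" "start p \<le> ereal s" and su: "s \<in> \<rat>" "u \<in> \<rat>" "s < u"
    and d: "tanh d1 < tv p s" "tv p s < tanh d2" and r: "\<bar>tv p u\<bar> < 1"
  shows "\<exists>q\<in>paths_of X. start q \<le> ereal s \<and> tanh d1 < tv q s \<and> tv q s < tanh d2 \<and> tv q u = tv p u"
    and "\<exists>z\<in>\<rat> \<times> \<rat>. snd z \<le> u \<and> tv (W z) u = tv p u"
proof -
  obtain a where a: "a \<in> \<rat>" "tanh d1 < tanh a" "tanh a < tv p s"
    using tanh_rat_between[OF d(1)] tanh_real_bounds[of d1] d tanh_real_bounds[of d2] by force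
  obtain b where b: "b \<in> \<rat>" "tv p s < tanh b" "tanh b < tanh d2"
    using tanh_rat_between[OF d(2)] tanh_real_bounds[of d1] d tanh_real_bounds[of d2] by force
  have "tanh a < tanh b" using a b by linarith
  then have ab: "a < b" by simp
  obtain x where x: "tv p u = tanh x" using tanh_surj[OF r] by blast
  have "x \<in> touched_reals K s u a b" unfolding touched_reals_def using p a b x by force
  then have "x \<in> touched_reals X s u a b"
    using touched[OF su(1,2) a(1) b(1) su(3) ab finite_touched_X(1)[OF su a(1) b(1)]] by simp
  then obtain q where q: "q \<in> paths_of X" "start q \<le> ereal s" "tanh a \<le> tv q s" "tv q s \<le> tanh b" "tv q u = tanh x"
    unfolding touched_reals_def by blast
  then show "\<exists>q\<in>paths_of X. start q \<le> ereal s \<and> tanh d1 < tv q s \<and> tv q s < tanh d2 \<and> tv q u = tv p u"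
    using x a b by (intro bexI[of _ q]) linarith+
  show "\<exists>z\<in>\<rat> \<times> \<rat>. snd z \<le> u \<and> tv (W z) u = tv p u"
    using finite_touched_X(2)[OF su a(1) b(1) \<open>x \<in> touched_reals X s u a b\<close>] x by simp
qed


text \<open>The point at time \<open>u\<close> is also touched by a path of \<open>X\<close> that passes at time \<open>s\<close> between the starting
  points of two skeleton paths which have merged with \<open>W z\<close> until time \<open>u\<close>.\<close>

lemma agrees_at_later_time:
  assumes p: "p \<in> paths_of K" "start p \<le> ereal s" and z: "z \<in> \<rat> \<times> \<rat>" "snd z \<le> s"
    and su: "s \<in> \<rat>" "u \<in> \<rat>" "s < u" and eq: "tv p s = tv (W z) s" and r: "\<bar>tv p u\<bar> < 1"
  shows "tv p u = tv (W z) u"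
proof -
  obtain d1 where d1: "d1 \<in> \<rat>" "tanh d1 < tv (W z) s" "tv (W (d1, s)) u = tv (W z) u"
    using neighbour[of 1 z s u] z su by auto
  obtain d2 where d2: "d2 \<in> \<rat>" "tv (W z) s < tanh d2" "tv (W (d2, s)) u = tv (W z) u"
    using neighbour[of "-1" z s u] z su by auto
  obtain q where q: "q \<in> paths_of X" "start q \<le> ereal s" "tanh d1 < tv q s" "tv q s < tanh d2" "tv q u = tv p u"
    using touched_by_X(1)[OF p su, of d1 d2] d1 d2 eq r by auto
  from squeeze_between[OF q(1,2) su(1) less_imp_le[OF su(3)] d1(1) d2(1) q(3,4)]
  show ?thesis using d1 d2 q by simp
qed

text \<open>The times at which \<open>p\<close> agrees with the skeleton path and the times at which it is infinite form two closed
  sets. They are disjoint, and by \<open>agrees_at_later_time\<close> and continuity they cover all times after \<open>s2\<close>.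
  As the first one contains \<open>s2\<close>, the second one is empty there.\<close>

lemma follows_skeleton:
  assumes p: "p \<in> paths_of K" "start p \<le> ereal s1" and s: "s1 \<in> \<rat>" "s2 \<in> \<rat>" "s1 < s2"
    and r: "\<bar>tv p s1\<bar> < 1" "\<bar>tv p s2\<bar> < 1"
  obtains z where "z \<in> \<rat> \<times> \<rat>" "snd z \<le> s2" "\<And>u. s2 \<le> u \<Longrightarrow> tv p u = tv (W z) u"
proof -
  obtain y where y: "tv p s1 = tanh y" using tanh_surj[OF r(1)] by blast
  have "tanh (y - 1) < tv p s1" "tv p s1 < tanh (y + 1)" by (simp_all add: y)
  from touched_by_X(2)[OF p s this r(2)] obtain z where z: "z \<in> \<rat> \<times> \<rat>" "snd z \<le> s2" "tv (W z) s2 = tv p s2" by blast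
  have p2: "start p \<le> ereal s2" using p(2) s(3) by (metis ereal_less_eq(3) less_imp_le order_trans)
  have "tv p u = tv (W z) u" if u: "s2 \<le> u" for u
  proof -
    let ?A = "{t. tv p t = tv (W z) t}" and ?B = "{t. \<bar>tv p t\<bar> = 1}"
    have cl: "closed ?A" "closed ?B" by (intro closed_Collect_eq continuous_intros)+
    have dich: "t \<in> ?A \<union> ?B" if "s2 \<le> t" for t
    proof -
      let ?f = "\<lambda>t. (tv p t - tv (W z) t) * (1 - \<bar>tv p t\<bar>)"
      have "?f t = 0"
      proof (rule eq_on_rationals_after[where v = s2 and f = ?f and g = "\<lambda>_. 0"])
        fix t assume t: "t \<in> \<rat>" "s2 < t"
        show "?f t = 0"
          using agrees_at_later_time[OF p(1) p2 z(1,2) s(2) t z(3)[symmetric]] abs_tv_le[of p t]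
          by (cases "\<bar>tv p t\<bar> = 1") auto
      qed (use z that in \<open>auto intro!: continuous_intros\<close>)
      then show ?thesis by auto
    qed
    have "\<bar>tv (W z) t\<bar> \<noteq> 1" for t using real_valued[OF z(1), of t] by simp
    then have "?A \<inter> ?B \<inter> {s2..} = {}" by auto
    moreover have "connected {s2..}" by (rule connected_Ici)
    moreover have "{s2..} \<subseteq> ?A \<union> ?B" using dich by auto
    moreover have "s2 \<in> ?A \<inter> {s2..}" using z by simp
    ultimately have "?B \<inter> {s2..} = {}" using cl unfolding connected_closed by blast
    then show ?thesis using dich[OF u] u by auto
  qed
  with z that show thesis by blast
qed

text \<open>A path that comes down from \<open>\<infinity>\<close> at time \<open>\<tau>\<close> would follow a path of the skeleton immediately afterwards, and
  lie above all skeleton paths that start at a fixed time before \<open>\<tau>\<close>, although these are unbounded. The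
  argument for \<open>-\<infinity>\<close> is symmetric.\<close>

lemma real_everywhere:
  assumes p: "p \<in> paths_of K" and t0: "start p \<le> ereal t0" "\<bar>tv p t0\<bar> < 1" and t: "start p \<le> ereal t"
  shows "\<bar>tv p t\<bar> < 1"
proof (rule ccontr)
  assume "\<not> \<bar>tv p t\<bar> < 1"
  then have t1: "\<bar>tv p t\<bar> = 1" using abs_tv_le[of p t] by linarith
  have cp: "continuous_on UNIV (\<lambda>t. \<bar>tv p t\<bar>)" by (intro continuous_intros)
  then obtain h where h: "0 < h" "\<And>v. \<bar>v - t0\<bar> < h \<Longrightarrow> \<bar>\<bar>tv p v\<bar> - \<bar>tv p t0\<bar>\<bar> < 1 - \<bar>tv p t0\<bar>"
    using t0(2) unfolding continuous_on_iff dist_real_def by (metis UNIV_I diff_gt_0_iff_gt)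
  obtain s1 where s1: "s1 \<in> \<rat>" "t0 < s1" "s1 < t0 + h" using Rats_dense_in_real[of t0 "t0 + h"] h by auto
  obtain s2 where s2: "s2 \<in> \<rat>" "s1 < s2" "s2 < t0 + h" using Rats_dense_in_real[of s1 "t0 + h"] s1 by auto
  have r12: "\<bar>tv p s1\<bar> < 1" "\<bar>tv p s2\<bar> < 1"
  proof -
    have "\<bar>s1 - t0\<bar> < h" "\<bar>s2 - t0\<bar> < h" using s1 s2 by auto
    from h(2)[OF this(1)] h(2)[OF this(2)] show "\<bar>tv p s1\<bar> < 1" "\<bar>tv p s2\<bar> < 1" by linarith+
  qed
  have ps1: "start p \<le> ereal s1" using t0(1) s1(2) by (metis ereal_less_eq(3) less_imp_le order_trans)
  obtain z where z: "z \<in> \<rat> \<times> \<rat>" "snd z \<le> s2" "\<And>u. s2 \<le> u \<Longrightarrow> tv p u = tv (W z) u"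
    using follows_skeleton[OF p ps1 s1(1) s2(1,2) r12] by blast
  have ts2: "t < s2" using z(3)[of t] real_valued[OF z(1), of t] t1 by force
  define B where "B = {v \<in> {t..s2}. \<bar>tv p v\<bar> = 1}"
  have "closed B" unfolding B_def by (intro continuous_closed_preimage_constant continuous_intros closed_atLeastAtMost)
  moreover have "t \<in> B" using t1 ts2 by (simp add: B_def)
  then have B: "B \<noteq> {}" "bdd_above B" by (auto simp: B_def intro!: bdd_aboveI[of _ s2])
  ultimately have "Sup B \<in> B" using closed_contains_Sup[OF B] by blast
  \<comment> \<open>the last time at which the path is infinite\<close>
  define \<tau> where "\<tau> = Sup B"
  have \<tau>: "t \<le> \<tau>" "\<tau> < s2" "\<bar>tv p \<tau>\<bar> = 1" and after: "\<And>v. \<tau> < v \<Longrightarrow> v \<le> s2 \<Longrightarrow> \<bar>tv p v\<bar> < 1"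
  proof -
    show "t \<le> \<tau>" "\<bar>tv p \<tau>\<bar> = 1" using \<open>Sup B \<in> B\<close> by (auto simp: B_def \<tau>_def)
    then show "\<tau> < s2" using \<open>Sup B \<in> B\<close> r12 by (auto simp: B_def \<tau>_def less_le)
    fix v assume v: "\<tau> < v" "v \<le> s2"
    have "v \<notin> B" using v cSup_upper[OF _ B(2), of v] by (auto simp: \<tau>_def)
    then show "\<bar>tv p v\<bar> < 1" using v \<open>t \<le> \<tau>\<close> abs_tv_le[of p v] by (auto simp: B_def)
  qed
  define \<sigma> where "\<sigma> = tv p \<tau>"
  have \<sigma>: "\<sigma> \<in> {1, -1}" using \<tau>(3) by (auto simp: \<sigma>_def)
  then have \<sigma>\<sigma>: "\<sigma> * \<sigma> = 1" by auto
  have p\<tau>: "start p \<le> ereal \<tau>" using t \<tau>(1) by (metis ereal_less_eq(3) order_trans)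
  obtain \<tau>' where \<tau>': "\<tau>' \<in> \<rat>" "\<tau>' < \<tau>" using Rats_dense_in_real[of "\<tau> - 1" \<tau>] by auto
  have above: "\<sigma> * tv (W (x, \<tau>')) s2 \<le> \<sigma> * tv p s2" if x: "x \<in> \<rat>" for x
  proof -
    have xD: "(x, \<tau>') \<in> \<rat> \<times> \<rat>" using x \<tau>' by simp
    let ?f = "\<lambda>v. \<sigma> * tv p v - \<sigma> * tv (W (x, \<tau>')) v"
    have "0 < ?f \<tau>" using real_valued[OF xD, of \<tau>] \<sigma> \<sigma>\<sigma> by (auto simp: \<sigma>_def[symmetric])
    moreover have "continuous_on UNIV ?f" by (intro continuous_intros)
    ultimately obtain k where k: "0 < k" "\<And>v. \<bar>v - \<tau>\<bar> < k \<Longrightarrow> \<bar>?f v - ?f \<tau>\<bar> < ?f \<tau>"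
      unfolding continuous_on_iff dist_real_def by (metis UNIV_I)
    have "\<tau> < min s2 (\<tau> + k)" using \<tau> k by auto
    then obtain v1 where v1: "v1 \<in> \<rat>" "\<tau> < v1" "v1 < min s2 (\<tau> + k)" using Rats_dense_in_real by blast
    then obtain v2 where v2: "v2 \<in> \<rat>" "v1 < v2" "v2 < min s2 (\<tau> + k)" using Rats_dense_in_real by blast
    have pv1: "start p \<le> ereal v1" using p\<tau> v1(2) by (metis ereal_less_eq(3) less_imp_le order_trans)
    obtain z' where z': "z' \<in> \<rat> \<times> \<rat>" "snd z' \<le> v2" "\<And>u. v2 \<le> u \<Longrightarrow> tv p u = tv (W z') u"
      using follows_skeleton[OF p pv1 v1(1) v2(1,2) after after] v1 v2 by auto
    have "0 < ?f v2" using k(2)[of v2] v1 v2 by auto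
    then have "\<sigma> * tv (W (x, \<tau>')) v2 \<le> \<sigma> * tv (W z') v2" using z'(3)[of v2] by simp
    then have "\<sigma> * tv (W (x, \<tau>')) s2 \<le> \<sigma> * tv (W z') s2"
      using no_crossing[OF \<sigma> xD z'(1), of v2 s2] z'(2) v1(2) v2(2,3) \<tau>'(2) by simp
    then show ?thesis using z'(3)[of s2] v2 by simp
  qed
  obtain c where "tv p s2 = tanh c" using tanh_surj[OF r12(2)] by blast
  then show False using unbounded[OF \<sigma> \<tau>'(1) s2(1), of c] above \<tau>'(2) \<tau>(2) by force
qed

text \<open>Two skeleton paths that start close to \<open>p\<close> at time \<open>s\<close> confine the approximating path for a short while. Its
  starting point is chosen so close to \<open>p\<close> that the paths have merged by the end of this while.\<close>

lemma skeleton_approx: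
  assumes s: "s \<in> \<rat>" and z: "z \<in> \<rat> \<times> \<rat>" "snd z \<le> s" and eq: "\<And>u. s \<le> u \<Longrightarrow> tv p u = tv (W z) u" and e: "0 < e"
  obtains d where "d \<in> \<rat>" "\<And>t. s \<le> t \<Longrightarrow> \<bar>tv (W (d, s)) t - tv p t\<bar> \<le> e"
proof -
  define y where "y = tv p s"
  have y: "\<bar>y\<bar> < 1" using eq[of s] real_valued[OF z(1), of s] by (simp add: y_def)
  then have y': "-1 < y" "y < 1" by (auto simp: abs_less_iff)
  obtain d1 where d1: "d1 \<in> \<rat>" "y - e/4 < tanh d1" "tanh d1 < y"
    using tanh_rat_between[of "y - e/4" y] e y' by auto
  obtain d2 where d2: "d2 \<in> \<rat>" "y < tanh d2" "tanh d2 < y + e/4"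
    using tanh_rat_between[of y "y + e/4"] e y' by auto
  have D: "(d1, s) \<in> \<rat> \<times> \<rat>" "(d2, s) \<in> \<rat> \<times> \<rat>" using d1 d2 s by auto
  have osc: "\<exists>h>0. \<forall>t. \<bar>t - s\<bar> < h \<longrightarrow> \<bar>tv q t - tv q s\<bar> < e/4" for q
    using continuous_tv[of q] e unfolding continuous_on_iff dist_real_def by (metis UNIV_I divide_pos_pos zero_less_numeral)
  obtain h0 h1 h2 where h: "0 < h0" "\<And>t. \<bar>t - s\<bar> < h0 \<Longrightarrow> \<bar>tv p t - tv p s\<bar> < e/4"
    "0 < h1" "\<And>t. \<bar>t - s\<bar> < h1 \<Longrightarrow> \<bar>tv (W (d1, s)) t - tv (W (d1, s)) s\<bar> < e/4"
    "0 < h2" "\<And>t. \<bar>t - s\<bar> < h2 \<Longrightarrow> \<bar>tv (W (d2, s)) t - tv (W (d2, s)) s\<bar> < e/4"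
    using osc[of p] osc[of "W (d1, s)"] osc[of "W (d2, s)"] by auto
  have "s < min (s + h0) (min (s + h1) (s + h2))" using h by auto
  then obtain u where u: "u \<in> \<rat>" "s < u" "u < min (s + h0) (min (s + h1) (s + h2))" using Rats_dense_in_real by blast
  obtain d1' where d1': "d1' \<in> \<rat>" "tanh d1' < y" "tv (W (d1', s)) u = tv (W z) u"
    using neighbour[of 1 z s u] z s u eq[of s] by (auto simp: y_def)
  obtain d2' where d2': "d2' \<in> \<rat>" "y < tanh d2'" "tv (W (d2', s)) u = tv (W z) u"
    using neighbour[of "-1" z s u] z s u eq[of s] by (auto simp: y_def)
  \<comment> \<open>the path from \<open>d\<close> stays close to \<open>p\<close> until time \<open>u\<close>, being between those from \<open>d1\<close> and \<open>d2\<close>, and has merged with it by then\<close>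
  define d where "d = max d1 d1'"
  have d: "d \<in> \<rat>" "d1 \<le> d" "d1' \<le> d" "tanh d < y" using d1 d1' by (auto simp: d_def max_def)
  have dD: "(d, s) \<in> \<rat> \<times> \<rat>" "(d1', s) \<in> \<rat> \<times> \<rat>" "(d2', s) \<in> \<rat> \<times> \<rat>" using d s d1' d2' by auto
  have ord: "tv (W (a, s)) t \<le> tv (W (b, s)) t" if "a \<in> \<rat>" "b \<in> \<rat>" "a \<le> b" "s \<le> t" for a b t
    using no_crossing[of 1 "(a, s)" "(b, s)" s t] that s at_start by auto
  have "tanh d < tanh d2" "tanh d < tanh d2'" using d d2 d2' by linarith+
  then have dd: "d \<le> d2" "d \<le> d2'" by simp_all
  have at_u: "tv (W (d, s)) u = tv (W z) u"
    using ord[OF d1'(1) d(1) d(3), of u] ord[OF d(1) d2'(1) dd(2), of u] u d1' d2' by simp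
  show thesis
  proof (rule that[OF d(1)])
    fix t assume t: "s \<le> t"
    show "\<bar>tv (W (d, s)) t - tv p t\<bar> \<le> e"
    proof (cases "u \<le> t")
      case True
      have "tv (W (d, s)) t = tv (W z) t"
        by (rule coalescing[OF dD(1) z(1), of u t]) (use at_u z u True in auto)
      then show ?thesis using eq[OF t] e by simp
    next
      case False
      then have th: "\<bar>t - s\<bar> < h0" "\<bar>t - s\<bar> < h1" "\<bar>t - s\<bar> < h2" using t u by auto
      have "tv (W (d1, s)) t \<le> tv (W (d, s)) t" "tv (W (d, s)) t \<le> tv (W (d2, s)) t"
        using ord d d1 d2 dd t by auto
      moreover have "tv (W (d1, s)) s = tanh d1" "tv (W (d2, s)) s = tanh d2" using at_start d1 d2 s by auto
      ultimately show ?thesis using h(2)[OF th(1)] h(4)[OF th(2)] h(6)[OF th(3)] d1 d2 unfolding y_def by linarith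
    qed
  qed
qed

lemma in_X_if_approx:
  assumes "\<And>e. 0 < e \<Longrightarrow> \<exists>q\<in>paths_of X. dist q p \<le> e"
  shows "p \<in> paths_of X"
proof -
  have "p \<in> closure (paths_of X)"
    unfolding closure_approachable using assms by (metis field_lbound_gt_zero le_less_trans)
  then show ?thesis using compact_imp_closed[OF compact_paths_of[of X]] by (simp add: closure_closed)
qed

text \<open>Before time \<open>s\<close> the skeleton path is constant. There the path \<open>p\<close> either hardly moves, or the time is so
  negative that the metric damps all differences.\<close>

lemma dist_W_le:
  assumes d: "d \<in> \<rat>" and s: "s \<in> \<rat>" "start p \<le> ereal s" "Psi (ereal s) \<le> Psi (start p) + e"
    and after: "\<And>t. s \<le> t \<Longrightarrow> \<bar>tv (W (d, s)) t - tv p t\<bar> \<le> e"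
    and before: "\<And>t. t < s \<Longrightarrow> \<bar>tv p t - tv p s\<bar> \<le> e \<or> 2 \<le> e * (1 + \<bar>t\<bar>)"
    and e: "0 \<le> e"
  shows "dist (W (d, s)) p \<le> 2 * e"
proof (rule dist_path_leI)
  have "Psi (start p) \<le> Psi (ereal s)" using s(2) by (simp only: Psi_le_iff)
  then show "\<bar>Psi (start (W (d, s))) - Psi (start p)\<bar> \<le> 2 * e" using s(3) start[OF d s(1)] e by auto
  fix t
  have e1: "2 * e \<le> 2 * e * (1 + \<bar>t\<bar>)" using e by (simp add: distrib_left)
  show "\<bar>tv (W (d, s)) t - tv p t\<bar> \<le> 2 * e * (1 + \<bar>t\<bar>)"
  proof (cases "s \<le> t")
    case True
    show ?thesis using after[OF True] e1 e by linarith
  next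
    case False
    have W: "tv (W (d, s)) t = tv (W (d, s)) s"
      by (rule tv_before_start) (use False start[OF d s(1)] in auto)
    from before[of t] False consider "\<bar>tv p t - tv p s\<bar> \<le> e" | "2 \<le> e * (1 + \<bar>t\<bar>)" by auto
    then show ?thesis
    proof cases
      case 1
      then show ?thesis using W after[of s] e1 by linarith
    next
      case 2
      then show ?thesis using abs_tv_le[of "W (d, s)" t] abs_tv_le[of p t] e by auto
    qed
  qed
qed

text \<open>The path follows the skeleton from rational times \<open>s\<close> on that are arbitrarily close to its start, and is
  there approximated by skeleton paths that start at time \<open>s\<close>.\<close>

lemma real_paths_in_X:
  assumes p: "p \<in> paths_of K" and fin: "start p \<noteq> \<infinity>" and r: "\<And>t. start p \<le> ereal t \<Longrightarrow> \<bar>tv p t\<bar> < 1"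
  shows "p \<in> paths_of X"
proof (rule in_X_if_approx)
  fix e :: real assume "0 < e"
  define e' where "e' = e / 2"
  have e': "0 < e'" using \<open>0 < e\<close> by (simp add: e'_def)
  have "\<exists>b. start p < b \<and> (\<forall>s. start p < ereal s \<and> ereal s < b \<longrightarrow> (\<forall>t<s. \<bar>tv p t - tv p s\<bar> \<le> e' \<or> 2 \<le> e' * (1 + \<bar>t\<bar>)))"
  proof (cases "start p")
    case (real \<sigma>)
    obtain h where h: "0 < h" "\<And>t. \<bar>t - \<sigma>\<bar> < h \<Longrightarrow> \<bar>tv p t - tv p \<sigma>\<bar> < e' / 2"
      using continuous_tv[of p] e' unfolding continuous_on_iff dist_real_def by (metis UNIV_I half_gt_zero)
    have "\<bar>tv p t - tv p s\<bar> \<le> e'" if s: "\<sigma> < s" "s < \<sigma> + h" and t: "t < s" for s t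
    proof -
      have "\<bar>tv p s - tv p \<sigma>\<bar> < e' / 2" using h(2)[of s] s by auto
      moreover have "\<bar>tv p t - tv p \<sigma>\<bar> < e' / 2"
      proof (cases "t < \<sigma>")
        case True
        then have "tv p t = tv p \<sigma>" by (intro tv_before_start) (auto simp: real)
        then show ?thesis using e' by simp
      next
        case False
        then show ?thesis using h(2)[of t] s t by auto
      qed
      ultimately show ?thesis by linarith
    qed
    then show ?thesis using h(1) by (intro exI[of _ "ereal (\<sigma> + h)"]) (auto simp: real)
  next
    case MInf
    have "2 \<le> e' * (1 + \<bar>t\<bar>)" if "t < - (2 / e')" for t
    proof -
      have "2 / e' < \<bar>t\<bar>" using that e' by linarith
      then have "2 < e' * \<bar>t\<bar>" using e' by (simp add: divide_less_eq mult.commute)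
      then show ?thesis using e' by (simp add: distrib_left)
    qed
    then show ?thesis by (intro exI[of _ "ereal (- (2 / e'))"]) (auto simp: MInf)
  qed (use fin in simp)
  then obtain b where b: "start p < b" "\<And>s t. start p < ereal s \<Longrightarrow> ereal s < b \<Longrightarrow> t < s \<Longrightarrow> \<bar>tv p t - tv p s\<bar> \<le> e' \<or> 2 \<le> e' * (1 + \<bar>t\<bar>)"
    by blast
  obtain t where t: "start p < ereal t" "ereal t < b" "Psi (ereal t) < Psi (start p) + e'"
    using real_time_near[OF b(1) fin e'] .
  obtain s0 where s0: "start p < ereal s0" "s0 < t" using ereal_dense2[OF t(1)] by auto
  obtain s1 where s1: "s1 \<in> \<rat>" "s0 < s1" "s1 < t" using Rats_dense_in_real[OF s0(2)] by auto
  obtain s where s: "s \<in> \<rat>" "s1 < s" "s < t" using Rats_dense_in_real[OF s1(3)] by auto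
  have ps1: "start p < ereal s1" using s0 s1 by (metis ereal_less_eq(3) less_imp_le less_le_trans)
  have ps: "start p < ereal s" using ps1 s by (metis ereal_less_eq(3) less_imp_le less_le_trans)
  have sb: "ereal s < b" using s(3) t(2) by (metis less_ereal.simps(1) less_trans)
  have "Psi (ereal s) \<le> Psi (ereal t)" using s by (simp add: Psi_le_iff)
  then have Ps: "Psi (ereal s) \<le> Psi (start p) + e'" using t(3) by linarith
  obtain z where z: "z \<in> \<rat> \<times> \<rat>" "snd z \<le> s" "\<And>u. s \<le> u \<Longrightarrow> tv p u = tv (W z) u"
    using follows_skeleton[OF p less_imp_le[OF ps1] s1(1) s(1,2) r r] ps ps1 by (metis less_imp_le)
  obtain d where d: "d \<in> \<rat>" "\<And>t. s \<le> t \<Longrightarrow> \<bar>tv (W (d, s)) t - tv p t\<bar> \<le> e'"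
    using skeleton_approx[OF s(1) z e'] by blast
  have "dist (W (d, s)) p \<le> 2 * e'"
    using dist_W_le[OF d(1) s(1) less_imp_le[OF ps] Ps d(2)] b(2)[OF ps sb] e' by auto
  then show "\<exists>q\<in>paths_of X. dist q p \<le> e" using W_in_X[of "(d, s)"] d s by (auto simp: e'_def)
qed

text \<open>The paths from \<open>(\<plusminus>\<infinity>, s)\<close> that stay at infinity are limits of skeleton paths, by compactness.\<close>

lemma infinite_path_exists:
  assumes \<sigma>: "\<sigma> \<in> {1, -1}" and s: "s \<in> \<rat>"
  shows "\<exists>q\<in>paths_of X. start q = ereal s \<and> (\<forall>t. tv q t = \<sigma>)"
proof -
  define x where "x n = \<sigma> * real n" for n :: nat
  have x: "x n \<in> \<rat>" for n using \<sigma> by (auto simp: x_def)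
  have "\<forall>n. W (x n, s) \<in> paths_of X" using W_in_X x s by auto
  then obtain q f where q: "q \<in> paths_of X" "strict_mono (f :: nat \<Rightarrow> nat)" "((\<lambda>n. W (x n, s)) \<circ> f) \<longlonglongrightarrow> q"
    using compact_paths_of[of X] unfolding compact_def by metis
  have lim: "(\<lambda>n. tv (W (x (f n), s)) t) \<longlonglongrightarrow> tv q t" for t
    using continuous_on_tendsto_compose[OF continuous_tv_path[of t] q(3)] by (simp add: comp_def)
  have "start q = ereal s"
    using closed_sequentially[OF closed_start_eq, of "\<lambda>n. W (x (f n), s)" "ereal s" q] q(3) start[OF x s] by (simp add: comp_def)
  moreover have r: "tv q u = \<sigma>" if u: "u \<in> \<rat>" "s < u" for u
  proof -
    have "tanh c \<le> \<sigma> * tv q u" for c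
    proof (rule LIMSEQ_le_const[OF tendsto_mult_left[OF lim]])
      obtain y where y: "y \<in> \<rat>" "\<sigma> * tanh (\<sigma> * c) < \<sigma> * tv (W (y, s)) u" using unbounded[OF \<sigma> s u] by blast
      obtain m :: nat where m: "\<bar>y\<bar> \<le> real m" using real_arch_simple by blast
      have "tanh c \<le> \<sigma> * tv (W (x (f n), s)) u" if n: "m \<le> n" for n
      proof -
        have "real m \<le> real (f n)" using n seq_suble[OF q(2), of n] by simp
        then have "\<sigma> * y \<le> real (f n)" using m \<sigma> by auto
        then have "tanh (\<sigma> * y) \<le> tanh (real (f n))" by (simp only: tanh_real_le_iff)
        moreover have "tanh (\<sigma> * y) = \<sigma> * tanh y" using \<sigma> by auto
        moreover have "tanh (real (f n)) = \<sigma> * tanh (x (f n))" using \<sigma> by (auto simp: x_def)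
        ultimately have "\<sigma> * tanh y \<le> \<sigma> * tanh (x (f n))" by simp
        then have "\<sigma> * tv (W (y, s)) u \<le> \<sigma> * tv (W (x (f n), s)) u"
          using no_crossing[OF \<sigma>, of "(y, s)" "(x (f n), s)" s u] x[of "f n"] y(1) s u(2)
            at_start[OF y(1) s] at_start[OF x[of "f n"] s] by simp
        moreover have "\<sigma> * tanh (\<sigma> * c) = tanh c" using \<sigma> by auto
        ultimately show ?thesis using y(2) by simp
      qed
      then show "\<exists>N. \<forall>n\<ge>N. tanh c \<le> \<sigma> * tv (W (x (f n), s)) u" by blast
    qed
    then have "1 \<le> \<sigma> * tv q u"
      using tendsto_upperbound[OF tanh_real_at_top, of "\<sigma> * tv q u"] by (simp add: always_eventually)
    then show ?thesis using \<sigma> abs_tv_le[of q u] by auto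
  qed
  moreover have s\<sigma>: "tv q s = \<sigma>"
  proof -
    have "continuous_on UNIV (tv q)" "continuous_on UNIV (\<lambda>_::real. \<sigma>)" by (intro continuous_intros)+
    have "closed {t. tv q t = \<sigma>}" by (intro closed_Collect_eq continuous_intros)
    moreover have "s \<in> closure {t. tv q t = \<sigma>}"
      unfolding closure_approachable
    proof safe
      fix e :: real assume "0 < e"
      then obtain u where "u \<in> \<rat>" "s < u" "u < s + e" using Rats_dense_in_real[of s "s + e"] by auto
      then show "\<exists>y\<in>{t. tv q t = \<sigma>}. dist y s < e" using r by (intro bexI[of _ u]) (auto simp: dist_real_def)
    qed
    ultimately show ?thesis by (simp add: closure_closed)
  qed
  ultimately have "tv q t = \<sigma>" for t
  proof (cases "s \<le> t")
    case True
    show ?thesis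
      by (rule eq_on_rationals_after[where f = "tv q" and g = "\<lambda>_. \<sigma>" and v = s])
        (use r s\<sigma> True in \<open>auto intro: continuous_intros\<close>)
  next
    case False
    then show ?thesis using tv_before_start[of t q s] \<open>start q = ereal s\<close> s\<sigma> by simp
  qed
  then show ?thesis using q \<open>start q = ereal s\<close> by blast
qed

text \<open>By continuity such a path is constantly \<open>\<infinity>\<close> or constantly \<open>-\<infinity>\<close>, so it is a limit of the paths of
  \<open>infinite_path_exists\<close>.\<close>

lemma infinite_paths_in_X:
  assumes fin: "start p \<noteq> \<infinity>" and r: "\<And>t. start p \<le> ereal t \<Longrightarrow> \<bar>tv p t\<bar> = 1"
  shows "p \<in> paths_of X"
proof -
  obtain t0 where t0: "start p < ereal t0" using fin ereal_dense2[of "start p" \<infinity>] by auto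
  define \<sigma> where "\<sigma> = tv p t0"
  have \<sigma>: "\<sigma> \<in> {1, -1}" using r[OF less_imp_le[OF t0]] by (auto simp: \<sigma>_def abs_if split: if_splits)
  have eq: "tv p t = \<sigma>" if t: "start p \<le> ereal t" for t
  proof (rule ccontr)
    assume ne: "tv p t \<noteq> \<sigma>"
    then have neg: "tv p t = - tv p t0" using r[OF t] \<sigma> by (auto simp: \<sigma>_def)
    \<comment> \<open>a change of sign would require a finite value in between\<close>
    have 0: "\<exists>w\<in>{min t t0..max t t0}. tv p w = 0"
    proof -
      have "connected (tv p ` {min t t0..max t t0})" by (intro connected_continuous_image continuous_intros) auto
      moreover have "tv p t \<in> tv p ` {min t t0..max t t0}" "tv p t0 \<in> tv p ` {min t t0..max t t0}" by auto
      ultimately have "0 \<in> tv p ` {min t t0..max t t0}"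
        using connectedD_interval[of "tv p ` {min t t0..max t t0}" "tv p t" "tv p t0" 0]
          connectedD_interval[of "tv p ` {min t t0..max t t0}" "tv p t0" "tv p t" 0] neg \<sigma> by (auto simp: \<sigma>_def)
      then show ?thesis by force
    qed
    then obtain w where w: "min t t0 \<le> w" "tv p w = 0" by auto
    have "start p \<le> ereal (min t t0)" using t less_imp_le[OF t0] by (simp add: min_def)
    then have "start p \<le> ereal w" using w(1) by (metis ereal_less_eq(3) order_trans)
    then show False using r w(2) by fastforce
  qed
  have all: "tv p t = \<sigma>" for t
  proof (cases "start p \<le> ereal t")
    case False
    then obtain r where "start p = ereal r" using fin by (cases "start p") auto
    then show ?thesis using tv_before_start[of t p r] eq[of r] False by auto
  qed (rule eq)
  show ?thesis
  proof (rule in_X_if_approx)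
    fix e :: real assume e: "0 < e"
    have "start p < \<infinity>" using fin by auto
    obtain t where t: "start p < ereal t" "Psi (ereal t) < Psi (start p) + e"
      using real_time_near[OF \<open>start p < \<infinity>\<close> fin e] by blast
    obtain s0 where s0: "start p < ereal s0" "s0 < t" using ereal_dense2[OF t(1)] by auto
    obtain s where s: "s \<in> \<rat>" "s0 < s" "s < t" using Rats_dense_in_real[OF s0(2)] by auto
    obtain q where q: "q \<in> paths_of X" "start q = ereal s" "\<And>t. tv q t = \<sigma>" using infinite_path_exists[OF \<sigma> s(1)] by blast
    have "start p \<le> ereal s" using s0 s by (metis ereal_less_eq(3) less_imp_le order_trans)
    then have "Psi (start p) \<le> Psi (ereal s)" "Psi (ereal s) \<le> Psi (ereal t)" using s by (simp_all add: Psi_le_iff)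
    then have "dist q p \<le> e" using t(2) e by (intro dist_path_leI) (auto simp: q all)
    then show "\<exists>q\<in>paths_of X. dist q p \<le> e" using q by blast
  qed
qed

text \<open>Such a path is determined by its position at time \<open>\<infinity>\<close>. Skeleton paths that start near that position
  at a late time converge to it, whatever they do afterwards, because late times hardly count in the metric.\<close>

lemma final_paths_in_X:
  assumes "start p = \<infinity>"
  shows "p \<in> paths_of X"
proof (rule in_X_if_approx)
  fix e :: real assume e: "0 < e"
  define \<kappa> where "\<kappa> = tv p 0"
  have \<kappa>: "tv p t = \<kappa>" for t unfolding \<kappa>_def using assms by (intro tv_before_start) auto
  have "\<bar>\<kappa>\<bar> \<le> 1" unfolding \<kappa>_def by (rule abs_tv_le)
  then have "-1 \<le> \<kappa>" "\<kappa> \<le> 1" by (auto simp: abs_le_iff)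
  then obtain x where x: "x \<in> \<rat>" "\<kappa> - e < tanh x" "tanh x < \<kappa> + e"
    using tanh_rat_between[of "\<kappa> - e" "\<kappa> + e"] e by auto
  obtain y where y: "1 - e < tanh y" using tanh_rat_between[of "1 - e" 2] e by auto
  obtain n :: nat where n: "max y (2 / e) \<le> real n" using real_arch_simple by blast
  have "tanh y \<le> tanh (real n)" using n by simp
  then have ty: "1 - e < tanh (real n)" using y by linarith
  have st: "start (W (x, real n)) = ereal (real n)" using start x(1) by simp
  have "dist (W (x, real n)) p \<le> e"
  proof (rule dist_path_leI)
    show "\<bar>Psi (start (W (x, real n))) - Psi (start p)\<bar> \<le> e"
      unfolding st assms using ty tanh_real_lt_1[of "real n"] by (simp add: Psi_def)
    fix t
    show "\<bar>tv (W (x, real n)) t - tv p t\<bar> \<le> e * (1 + \<bar>t\<bar>)"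
    proof (cases "t \<le> real n")
      case True
      then have "tv (W (x, real n)) t = tanh x"
        using tv_before_start[of t "W (x, real n)" "real n"] st at_start[of x "real n"] x(1) by simp
      then have "\<bar>tv (W (x, real n)) t - tv p t\<bar> \<le> e" using x \<kappa> by auto
      also have "e \<le> e * (1 + \<bar>t\<bar>)" using e by simp
      finally show ?thesis .
    next
      case False
      then have "2 / e \<le> 1 + \<bar>t\<bar>" using n by auto
      then have "2 \<le> e * (1 + \<bar>t\<bar>)" using e by (simp add: divide_le_eq mult.commute)
      then show ?thesis using abs_tv_le[of "W (x, real n)" t] abs_tv_le[of p t] by linarith
    qed
  qed
  then show "\<exists>q\<in>paths_of X. dist q p \<le> e" using W_in_X[of "(x, real n)"] x by auto
qed

lemma web_sample_unique: "K = X"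
proof -
  have "p \<in> paths_of X" if p: "p \<in> paths_of K" for p
  proof (cases "start p = \<infinity>")
    case fin: False
    show ?thesis
    proof (cases "\<exists>t0. start p \<le> ereal t0 \<and> \<bar>tv p t0\<bar> < 1")
      case True
      then obtain t0 where "start p \<le> ereal t0" "\<bar>tv p t0\<bar> < 1" by blast
      from real_paths_in_X[OF p fin real_everywhere[OF p this]] show ?thesis .
    next
      case False
      have "\<bar>tv p t\<bar> = 1" if "start p \<le> ereal t" for t
        using False that abs_tv_le[of p t] by (auto simp: less_le)
      from infinite_paths_in_X[OF fin this] show ?thesis .
    qed
  qed (rule final_paths_in_X)
  then have "paths_of K = paths_of X" using XK by blast
  then show ?thesis by (simp only: paths_of_inject)
qed

end


section \<open>Comparison of laws\<close>

lemma integral_bounded_limit: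
  fixes X :: "'a \<Rightarrow> 'b::metric_space"
  assumes M: "prob_space M" and Xn: "\<And>n. Xn n \<in> borel_measurable M" and X: "X \<in> borel_measurable M"
    and lim: "AE \<omega> in M. (\<lambda>n. Xn n \<omega>) \<longlonglongrightarrow> X \<omega>"
    and f: "continuous_on UNIV f" "\<And>x. \<bar>f x\<bar> \<le> (1::real)"
  shows "(\<lambda>n. \<integral>\<omega>. f (Xn n \<omega>) \<partial>M) \<longlonglongrightarrow> (\<integral>\<omega>. f (X \<omega>) \<partial>M)"
proof -
  interpret prob_space M by fact
  have fm: "f \<in> borel_measurable borel" by (rule borel_measurable_continuous_onI[OF f(1)])
  show ?thesis
  proof (rule integral_dominated_convergence[where w = "\<lambda>_. 1"])
    show "AE \<omega> in M. (\<lambda>n. f (Xn n \<omega>)) \<longlonglongrightarrow> f (X \<omega>)"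
      using lim by eventually_elim (use continuous_on_tendsto_compose[OF f(1)] in auto)
  qed (use f measurable_compose[OF Xn fm] measurable_compose[OF X fm] in auto)
qed

text \<open>Laws converge along almost surely convergent sequences. Closed sets generate the Borel sets, and
  the indicator of a closed set is a limit of bounded continuous functions of the distance to it.\<close>

lemma distr_limit_eq:
  fixes X :: "'a \<Rightarrow> 'c::metric_space" and Y :: "'b \<Rightarrow> 'c"
  assumes M: "prob_space M" and N: "prob_space N"
    and Xn: "\<And>n. Xn n \<in> borel_measurable M" and X: "X \<in> borel_measurable M"
    and Yn: "\<And>n. Yn n \<in> borel_measurable N" and Y: "Y \<in> borel_measurable N"
    and limX: "AE \<omega> in M. (\<lambda>n. Xn n \<omega>) \<longlonglongrightarrow> X \<omega>" and limY: "AE \<omega> in N. (\<lambda>n. Yn n \<omega>) \<longlonglongrightarrow> Y \<omega>"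
    and eq: "\<And>n. distr M borel (Xn n) = distr N borel (Yn n)"
  shows "distr M borel X = distr N borel Y"
proof -
  interpret M: prob_space M by fact
  interpret N: prob_space N by fact
  have int_eq: "(\<integral>\<omega>. f (X \<omega>) \<partial>M) = (\<integral>\<omega>. f (Y \<omega>) \<partial>N)"
    if f: "continuous_on UNIV f" "\<And>x. \<bar>f x\<bar> \<le> (1::real)" for f
  proof -
    have fm: "f \<in> borel_measurable borel" by (rule borel_measurable_continuous_onI[OF f(1)])
    have "(\<integral>\<omega>. f (Xn n \<omega>) \<partial>M) = (\<integral>\<omega>. f (Yn n \<omega>) \<partial>N)" for n
      using integral_distr[OF Xn fm, of n] integral_distr[OF Yn fm, of n] eq[of n] by simp
    then show ?thesis
      using LIMSEQ_unique[OF integral_bounded_limit[OF M Xn X limX f]] integral_bounded_limit[OF N Yn Y limY f] by simp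
  qed
  have closed_eq: "emeasure (distr M borel X) C = emeasure (distr N borel Y) C" if C: "closed C" for C
  proof (cases "C = {}")
    case False
    define f where "f k x = max 0 (1 - real k * infdist x C)" for k x
    have f: "continuous_on UNIV (f k)" "\<bar>f k x\<bar> \<le> 1" for k x
      unfolding f_def by (intro continuous_intros) (auto simp: infdist_nonneg)
    have lim: "(\<lambda>k. f k x) \<longlonglongrightarrow> indicator C x" for x
    proof (cases "x \<in> C")
      case True
      then show ?thesis by (simp add: f_def)
    next
      case nC: False
      then have pos: "0 < infdist x C"
        using in_closed_iff_infdist_zero[OF C False, of x] infdist_nonneg[of x C] by linarith
      obtain k0 :: nat where k0: "1 / infdist x C < real k0" using reals_Archimedean2 by blast
      have "f k x = 0" if "k0 \<le> k" for k
      proof -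
        have "1 / infdist x C < real k" using k0 that by linarith
        then have "1 < real k * infdist x C" using pos by (simp add: divide_less_eq)
        then show ?thesis by (simp add: f_def)
      qed
      then show ?thesis using nC by (intro tendsto_eventually) (auto simp: eventually_sequentially)
    qed
    have conv: "(\<lambda>k. \<integral>\<omega>. f k (Z \<omega>) \<partial>L) \<longlonglongrightarrow> measure (distr L borel Z) C"
      if L: "prob_space L" and Z: "Z \<in> borel_measurable L" for L :: "'z measure" and Z
    proof -
      interpret L: prob_space L by fact
      have CB: "C \<in> sets borel" using C by simp
      have "(\<lambda>k. \<integral>\<omega>. f k (Z \<omega>) \<partial>L) \<longlonglongrightarrow> (\<integral>\<omega>. indicator C (Z \<omega>) \<partial>L)"
      proof (rule integral_dominated_convergence[where w = "\<lambda>_. 1"])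
        show "(\<lambda>\<omega>. f k (Z \<omega>)) \<in> borel_measurable L" for k
          by (rule measurable_compose[OF Z borel_measurable_continuous_onI[OF f(1)]])
        show "(\<lambda>\<omega>. indicator C (Z \<omega>) :: real) \<in> borel_measurable L"
          by (rule measurable_compose[OF Z]) (use CB in simp)
      qed (use f lim in auto)
      also have "(\<integral>\<omega>. indicator C (Z \<omega>) \<partial>L) = measure (distr L borel Z) C"
        using integral_distr[OF Z, of "indicator C :: 'c \<Rightarrow> real"] CB by simp
      finally show ?thesis .
    qed
    have "(\<lambda>k. \<integral>\<omega>. f k (X \<omega>) \<partial>M) = (\<lambda>k. \<integral>\<omega>. f k (Y \<omega>) \<partial>N)"
      using int_eq[OF f] by (intro ext)
    then have "measure (distr M borel X) C = measure (distr N borel Y) C"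
      using LIMSEQ_unique[OF conv[OF M X]] conv[OF N Y] by simp
    then show ?thesis
      using M.prob_space_distr[OF X] N.prob_space_distr[OF Y]
      by (simp add: finite_measure.emeasure_eq_measure prob_space.finite_measure)
  qed simp
  show ?thesis
  proof (rule measure_eqI_generator_eq[where E = "Collect closed" and \<Omega> = UNIV and A = "\<lambda>_. UNIV"])
    show "Int_stable (Collect closed :: 'c set set)" by (auto simp: Int_stable_def)
    show "sets (distr M borel X) = sigma_sets UNIV (Collect closed)" "sets (distr N borel Y) = sigma_sets UNIV (Collect closed)"
      by (simp_all add: borel_eq_closed)
    show "emeasure (distr M borel X) UNIV \<noteq> \<infinity>" for i :: nat
      using prob_space.emeasure_space_1[OF M.prob_space_distr[OF X]] by simp
  qed (use closed_eq in auto)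
qed

text \<open>Otherwise a rational number would lie strictly between the two variables with positive
  probability, and the larger one would exceed it more often.\<close>

lemma (in prob_space) AE_eq_if_le_and_same_law:
  fixes Y Z :: "'a \<Rightarrow> ereal"
  assumes [measurable]: "Y \<in> borel_measurable M" "Z \<in> borel_measurable M"
    and le: "AE \<omega> in M. Y \<omega> \<le> Z \<omega>" and law: "distr M borel Y = distr M borel Z"
  shows "AE \<omega> in M. Y \<omega> = Z \<omega>"
proof -
  have "AE \<omega> in M. ereal r < Z \<omega> \<longrightarrow> ereal r < Y \<omega>" for r
  proof -
    have pr: "prob {\<omega> \<in> space M. ereal r < V \<omega>} = measure (distr M borel V) {ereal r<..}"
      if "V \<in> borel_measurable M" for V :: "'a \<Rightarrow> ereal"
      using that by (subst measure_distr) (auto simp: vimage_def Int_def conj_commute)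
    let ?S = "{\<omega> \<in> space M. ereal r < Z \<omega> \<and> \<not> ereal r < Y \<omega>}"
    have S: "?S \<in> events" by measurable
    have "prob {\<omega> \<in> space M. ereal r < Z \<omega>} = prob {\<omega> \<in> space M. ereal r < Y \<omega>}"
      unfolding pr[OF assms(1)] pr[OF assms(2)] law ..
    moreover have "prob {\<omega> \<in> space M. ereal r < Z \<omega>} = prob (?S \<union> {\<omega> \<in> space M. ereal r < Y \<omega>})"
      by (rule measure_eq_AE) (use le in \<open>auto elim!: eventually_mono\<close>)
    moreover have "prob (?S \<union> {\<omega> \<in> space M. ereal r < Y \<omega>}) = prob ?S + prob {\<omega> \<in> space M. ereal r < Y \<omega>}"
      by (rule finite_measure_Union) auto
    ultimately have "prob ?S = 0" by simp
    then have "AE \<omega> in M. \<omega> \<notin> ?S" using iffD1[OF prob_eq_0[OF S]] by blast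
    then show ?thesis using AE_space by eventually_elim auto
  qed
  then have "AE \<omega> in M. \<forall>r::rat. ereal (of_rat r) < Z \<omega> \<longrightarrow> ereal (of_rat r) < Y \<omega>"
    by (simp add: AE_all_countable)
  then show ?thesis using le
  proof eventually_elim
    case (elim \<omega>)
    show ?case
    proof (rule ccontr)
      assume "Y \<omega> \<noteq> Z \<omega>"
      then have "Y \<omega> < Z \<omega>" using elim by simp
      then obtain r :: rat where "Y \<omega> < ereal (of_rat r)" "ereal (of_rat r) < Z \<omega>" using ereal_dense3 by blast
      then show False using elim(1) by force
    qed
  qed
qed

text \<open>By compactness, finitely many of the paths form an \<open>e\<close>-net of the closure.\<close>

lemma finite_path_set_tendsto:
  assumes "compact (closure (range p))"
  shows "(\<lambda>n. finite_path_set n p) \<longlonglongrightarrow> Abs_path_set (closure (range p))"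
proof (rule metric_LIMSEQ_I)
  fix e :: real assume e: "0 < e"
  have ne: "closure (range p) \<noteq> {}" by simp
  have "closure (range p) \<subseteq> (\<Union>i\<in>UNIV. ball (p i) (e / 2))"
  proof
    fix x assume "x \<in> closure (range p)"
    then obtain i where "dist (p i) x < e / 2" using e unfolding closure_approachable by (metis half_gt_zero rangeE)
    then show "x \<in> (\<Union>i\<in>UNIV. ball (p i) (e / 2))" by auto
  qed
  then obtain I where I: "finite I" "closure (range p) \<subseteq> (\<Union>i\<in>I. ball (p i) (e / 2))"
    using compactE_image[OF assms, of UNIV "\<lambda>i. ball (p i) (e / 2)"] by auto
  have "dist (finite_path_set n p) (Abs_path_set (closure (range p))) < e" if n: "Max (insert 0 I) \<le> n" for n
  proof -
    have "hausdorff_dist (p ` {..n}) (closure (range p)) \<le> e / 2"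
    proof (rule hausdorff_dist_le)
      fix x assume "x \<in> p ` {..n}"
      then have "x \<in> closure (range p)" by (intro subsetD[OF closure_subset]) auto
      then show "infdist x (closure (range p)) \<le> e / 2" using e by simp
    next
      fix x assume "x \<in> closure (range p)"
      then obtain i where i: "i \<in> I" "dist (p i) x < e / 2" using subsetD[OF I(2)] by auto
      then have "i \<le> n" using n I(1) Max_ge[of "insert 0 I" i] by simp
      then show "infdist x (p ` {..n}) \<le> e / 2" using i by (intro infdist_le2[of "p i"]) (auto simp: dist_commute)
    qed auto
    then show ?thesis using e
      by (simp add: dist_path_set.rep_eq paths_of_finite_path_set paths_of_Abs[OF assms ne])
  qed
  then show "\<exists>n0. \<forall>n\<ge>n0. dist (finite_path_set n p) (Abs_path_set (closure (range p))) < e" by blast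
qed

definition rat_point :: "nat \<Rightarrow> real \<times> real" where
  "rat_point = from_nat_into (\<rat> \<times> \<rat>)"

lemma countable_rat_points: "countable (\<rat> \<times> \<rat> :: (real \<times> real) set)"
  using countable_rat by auto

lemma range_rat_point: "range rat_point = \<rat> \<times> \<rat>"
  unfolding rat_point_def by (rule range_from_nat_into[OF _ countable_rat_points]) (auto intro: Rats_0)

lemma rat_point: "rat_point n \<in> \<rat> \<times> \<rat>"
  using range_rat_point by blast

context web_paths
begin

definition partial_web :: "nat \<Rightarrow> 'a \<Rightarrow> path_set" where
  "partial_web n \<omega> = finite_path_set n (\<lambda>i. W (rat_point i) \<omega>)"

text \<open>The closure of the skeleton. It is compact if the paths from all rational points exist; on the null
  set where this fails any measurable default will do.\<close>

definition skeleton_web :: "'a \<Rightarrow> path_set" where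
  "skeleton_web \<omega> = (if \<forall>i. uniq_from (X \<omega>) (rat_point i)
    then Abs_path_set (closure ((\<lambda>z. W z \<omega>) ` (\<rat> \<times> \<rat>))) else partial_web 0 \<omega>)"

lemma partial_web_measurable [measurable]: "partial_web n \<in> borel_measurable M"
  unfolding partial_web_def
  by (rule measurable_compose[OF _ measurable_finite_path_set]) (intro measurable_PiM_single', auto)

lemma skeleton_closure:
  assumes "\<And>z. z \<in> \<rat> \<times> \<rat> \<Longrightarrow> uniq_from (X \<omega>) z"
  shows "closure ((\<lambda>z. W z \<omega>) ` (\<rat> \<times> \<rat>)) \<subseteq> paths_of (X \<omega>)"
    and "compact (closure ((\<lambda>z. W z \<omega>) ` (\<rat> \<times> \<rat>)))"
proof -
  have "(\<lambda>z. W z \<omega>) ` (\<rat> \<times> \<rat>) \<subseteq> paths_of (X \<omega>)" using path_from_uniq(1)[OF assms] by (auto simp: W_def)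
  then show sub: "closure ((\<lambda>z. W z \<omega>) ` (\<rat> \<times> \<rat>)) \<subseteq> paths_of (X \<omega>)"
    using compact_imp_closed[OF compact_paths_of] by (intro closure_minimal)
  show "compact (closure ((\<lambda>z. W z \<omega>) ` (\<rat> \<times> \<rat>)))"
    using compact_Int_closed[OF compact_paths_of[of "X \<omega>"] closed_closure] sub by (metis Int_absorb1)
qed

lemma partial_web_tendsto:
  assumes "\<And>z. z \<in> \<rat> \<times> \<rat> \<Longrightarrow> uniq_from (X \<omega>) z"
  shows "(\<lambda>n. partial_web n \<omega>) \<longlonglongrightarrow> Abs_path_set (closure ((\<lambda>z. W z \<omega>) ` (\<rat> \<times> \<rat>)))"
proof -
  have "range (\<lambda>i. W (rat_point i) \<omega>) = (\<lambda>z. W z \<omega>) ` (\<rat> \<times> \<rat>)"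
    unfolding range_rat_point[symmetric] by auto
  then show ?thesis
    using finite_path_set_tendsto[of "\<lambda>i. W (rat_point i) \<omega>"] skeleton_closure(2)[OF assms] by (simp add: partial_web_def)
qed

lemma AE_uniq_rat: "AE \<omega> in M. \<forall>z\<in>\<rat> \<times> \<rat>. uniq_from (X \<omega>) z"
  by (intro AE_ball_countable[THEN iffD2] countable_rat_points ballI AE_uniq_from)

lemma skeleton_web_measurable [measurable]: "skeleton_web \<in> borel_measurable M"
proof (rule borel_measurable_LIMSEQ_metric)
  let ?G = "{\<omega> \<in> space M. \<forall>i. uniq_from (X \<omega>) (rat_point i)}"
  have G: "?G \<in> events"
  proof (rule sets.sets_Collect_countable_All)
    fix i
    show "{\<omega> \<in> space M. uniq_from (X \<omega>) (rat_point i)} \<in> events"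
      by (rule measurable_sets_Collect[OF X_measurable]) (use sets_uniq_from in simp)
  qed
  show "(\<lambda>\<omega>. if \<forall>i. uniq_from (X \<omega>) (rat_point i) then partial_web n \<omega> else partial_web 0 \<omega>) \<in> borel_measurable M" for n
    by (rule measurable_If[OF partial_web_measurable partial_web_measurable G])
  fix \<omega>
  show "(\<lambda>n. if \<forall>i. uniq_from (X \<omega>) (rat_point i) then partial_web n \<omega> else partial_web 0 \<omega>) \<longlonglongrightarrow> skeleton_web \<omega>"
  proof (cases "\<forall>i. uniq_from (X \<omega>) (rat_point i)")
    case True
    then have "uniq_from (X \<omega>) z" if "z \<in> \<rat> \<times> \<rat>" for z using that unfolding range_rat_point[symmetric] by auto
    from partial_web_tendsto[OF this] True show ?thesis by (simp add: skeleton_web_def)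
  next
    case False
    then show ?thesis by (simp only: skeleton_web_def if_False) simp
  qed
qed

lemma AE_skeleton_web:
  "AE \<omega> in M. paths_of (skeleton_web \<omega>) = closure ((\<lambda>z. W z \<omega>) ` (\<rat> \<times> \<rat>)) \<and>
    paths_of (skeleton_web \<omega>) \<subseteq> paths_of (X \<omega>) \<and> (\<lambda>n. partial_web n \<omega>) \<longlonglongrightarrow> skeleton_web \<omega>"
  using AE_uniq_rat
proof eventually_elim
  case (elim \<omega>)
  then have u: "\<And>z. z \<in> \<rat> \<times> \<rat> \<Longrightarrow> uniq_from (X \<omega>) z" by blast
  have eq: "skeleton_web \<omega> = Abs_path_set (closure ((\<lambda>z. W z \<omega>) ` (\<rat> \<times> \<rat>)))"
    using u rat_point by (simp add: skeleton_web_def)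
  have "(0, 0) \<in> (\<rat> \<times> \<rat> :: (real \<times> real) set)" by simp
  then have ne: "closure ((\<lambda>z. W z \<omega>) ` (\<rat> \<times> \<rat>)) \<noteq> {}" unfolding closure_eq_empty by blast
  have pa: "paths_of (skeleton_web \<omega>) = closure ((\<lambda>z. W z \<omega>) ` (\<rat> \<times> \<rat>))"
    unfolding eq by (rule paths_of_Abs[OF skeleton_closure(2) ne]) (rule u)
  show ?case
    using pa skeleton_closure(1)[of \<omega>] partial_web_tendsto[of \<omega>] u by (simp add: eq)
qed

lemma AE_web_sample:
  assumes "AE \<omega> in M. \<forall>s\<in>\<rat>. \<forall>u\<in>\<rat>. \<forall>a\<in>\<rat>. \<forall>b\<in>\<rat>. s < u \<longrightarrow> a < b \<longrightarrow>
    finite (touched_reals (skeleton_web \<omega>) s u a b) \<longrightarrow> touched_reals (X \<omega>) s u a b = touched_reals (skeleton_web \<omega>) s u a b"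
  shows "AE \<omega> in M. web_sample (X \<omega>) (skeleton_web \<omega>) (\<lambda>z. W z \<omega>)"
proof -
  note AEI = AE_ball_countable[THEN iffD2, OF countable_rat, rule_format]
  note AEI2 = AE_ball_countable[THEN iffD2, OF countable_rat_points, rule_format]
  have 1: "AE \<omega> in M. \<forall>z\<in>\<rat> \<times> \<rat>. start (W z \<omega>) = ereal (snd z) \<and> tv (W z \<omega>) (snd z) = tanh (fst z)"
    by (rule AEI2) (rule AE_start)
  have 2: "AE \<omega> in M. \<forall>z\<in>\<rat> \<times> \<rat>. \<forall>u. \<bar>tv (W z \<omega>) u\<bar> < 1"
    by (rule AEI2) (rule AE_real)
  have 3: "AE \<omega> in M. \<forall>z0\<in>\<rat> \<times> \<rat>. \<forall>z1\<in>\<rat> \<times> \<rat>. \<forall>v u. snd z0 \<le> v \<longrightarrow> snd z1 \<le> v \<longrightarrow> v \<le> u \<longrightarrow>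
      tv (W z0 \<omega>) v = tv (W z1 \<omega>) v \<longrightarrow> tv (W z0 \<omega>) u = tv (W z1 \<omega>) u"
    by (rule AEI2, rule AEI2) (rule AE_coalesce)
  have 4: "AE \<omega> in M. \<forall>s\<in>\<rat>. \<forall>u\<in>\<rat>. \<forall>c\<in>\<rat>. s < u \<longrightarrow>
      (\<exists>n::nat. tanh c < tv (W (real n, s) \<omega>) u) \<and> (\<exists>n::nat. tv (W (- real n, s) \<omega>) u < tanh c)"
    by (rule AEI, rule AEI, rule AEI, rule AE_impI) (rule AE_unbounded)
  have 5: "AE \<omega> in M. \<forall>\<sigma>\<in>{1, -1}. \<forall>z\<in>\<rat> \<times> \<rat>. \<forall>s\<in>\<rat>. \<forall>u\<in>\<rat>. snd z \<le> s \<and> s < u \<longrightarrow>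
      (\<exists>d\<in>\<rat>. \<exists>y. tv (W z \<omega>) s = tanh y \<and> 0 < \<sigma> * (y - d) \<and> tv (W (d, s) \<omega>) u = tv (W z \<omega>) u)"
  proof (rule AE_ball_countable[THEN iffD2, rule_format], simp, rule AEI2, rule AEI, rule AEI, rule AE_impI)
    fix \<sigma> s u :: real and z :: "real \<times> real" assume *: "\<sigma> \<in> {1, -1}" "snd z \<le> s \<and> s < u"
    then show "AE \<omega> in M. \<exists>d\<in>\<rat>. \<exists>y. tv (W z \<omega>) s = tanh y \<and> 0 < \<sigma> * (y - d) \<and> tv (W (d, s) \<omega>) u = tv (W z \<omega>) u"
      using AE_merged_with_neighbour[of "snd z" s u \<sigma> "fst z"] by simp
  qed
  have 6: "AE \<omega> in M. \<forall>s\<in>\<rat>. \<forall>u\<in>\<rat>. \<forall>A. s < u \<longrightarrow> finite {tv (W (d, s) \<omega>) u |d. d \<in> \<rat> \<and> \<bar>d\<bar> \<le> real A}"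
    by (rule AEI, rule AEI, rule AE_all_countable[THEN iffD2], rule allI, rule AE_impI) (rule AE_finitely_many_survivors)
  from 1 2 3 4 5 6 assms AE_skeleton_web show ?thesis
  proof eventually_elim
    case (elim \<omega>)
    show ?case
    proof
      show "paths_of (skeleton_web \<omega>) = closure ((\<lambda>z. W z \<omega>) ` (\<rat> \<times> \<rat>))" "paths_of (skeleton_web \<omega>) \<subseteq> paths_of (X \<omega>)"
        using elim(8) by auto
      show "start (W (x, s) \<omega>) = ereal s" "tv (W (x, s) \<omega>) s = tanh x" if "x \<in> \<rat>" "s \<in> \<rat>" for x s
        using bspec[OF elim(1), of "(x, s)"] that by auto
      show "\<bar>tv (W z \<omega>) u\<bar> < 1" if "z \<in> \<rat> \<times> \<rat>" for z u using bspec[OF elim(2) that] by blast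
      show "tv (W z \<omega>) u = tv (W z' \<omega>) u"
        if "z \<in> \<rat> \<times> \<rat>" "z' \<in> \<rat> \<times> \<rat>" "snd z \<le> v" "snd z' \<le> v" "v \<le> u" "tv (W z \<omega>) v = tv (W z' \<omega>) v" for z z' v u
        using bspec[OF bspec[OF elim(3) that(1)] that(2)] that(3-6) by blast
      show "\<exists>x\<in>\<rat>. \<sigma> * tanh c < \<sigma> * tv (W (x, s) \<omega>) u" if \<sigma>: "\<sigma> \<in> {1, -1}" and su: "s \<in> \<rat>" "u \<in> \<rat>" "s < u" for \<sigma> s u c
      proof -
        obtain c1 where c1: "c1 \<in> \<rat>" "c < c1" using Rats_dense_in_real[of c "c + 1"] by auto
        obtain c2 where c2: "c2 \<in> \<rat>" "c2 < c" using Rats_dense_in_real[of "c - 1" c] by auto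
        obtain n1 where n1: "tanh c1 < tv (W (real n1, s) \<omega>) u"
          using bspec[OF bspec[OF bspec[OF elim(4) su(1)] su(2)] c1(1)] su(3) by blast
        obtain n2 where n2: "tv (W (- real n2, s) \<omega>) u < tanh c2"
          using bspec[OF bspec[OF bspec[OF elim(4) su(1)] su(2)] c2(1)] su(3) by blast
        have "tanh c < tanh c1" "tanh c2 < tanh c" using c1 c2 by simp_all
        then have "tanh c < tv (W (real n1, s) \<omega>) u" "tv (W (- real n2, s) \<omega>) u < tanh c" using n1 n2 by linarith+
        moreover have "real n1 \<in> \<rat>" "- real n2 \<in> \<rat>" by auto
        ultimately show ?thesis using \<sigma> by auto
      qed
      show "\<exists>d\<in>\<rat>. \<sigma> * tanh d < \<sigma> * tv (W z \<omega>) s \<and> tv (W (d, s) \<omega>) u = tv (W z \<omega>) u"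
        if \<sigma>: "\<sigma> \<in> {1, -1}" and z: "z \<in> \<rat> \<times> \<rat>" "s \<in> \<rat>" "u \<in> \<rat>" "snd z \<le> s" "s < u" for \<sigma> z s u
      proof -
        obtain d y where d: "d \<in> \<rat>" "tv (W z \<omega>) s = tanh y" "0 < \<sigma> * (y - d)" "tv (W (d, s) \<omega>) u = tv (W z \<omega>) u"
          using bspec[OF bspec[OF bspec[OF bspec[OF elim(5) \<sigma>] z(1)] z(2)] z(3)] z(4,5) by blast
        then have "\<sigma> * tanh d < \<sigma> * tv (W z \<omega>) s" using \<sigma> by auto
        then show ?thesis using d by blast
      qed
      show "finite {tv (W (d, s) \<omega>) u |d. d \<in> \<rat> \<and> \<bar>d\<bar> \<le> real A}" if "s \<in> \<rat>" "u \<in> \<rat>" "s < u" for s u A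
        using bspec[OF bspec[OF elim(6) that(1)] that(2)] that(3) by blast
      show "touched_reals (X \<omega>) s u a b = touched_reals (skeleton_web \<omega>) s u a b"
        if "s \<in> \<rat>" "u \<in> \<rat>" "a \<in> \<rat>" "b \<in> \<rat>" "s < u" "a < b" "finite (touched_reals (skeleton_web \<omega>) s u a b)" for s u a b
        using bspec[OF bspec[OF bspec[OF bspec[OF elim(7) that(1)] that(2)] that(3)] that(4)] that(5-7) by blast
    qed
  qed
qed

end

lemma partial_web_same_law:
  assumes "web_paths M X" "web_paths N Y"
  shows "distr M borel (web_paths.partial_web X n) = distr N borel (web_paths.partial_web Y n)"
proof -
  interpret A: web_paths M X by fact
  interpret B: web_paths N Y by fact
  let ?Pi = "Pi\<^sub>M {..<Suc n} (\<lambda>_. borel) :: (nat \<Rightarrow> path) measure"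
  let ?f = "\<lambda>\<omega>. \<lambda>j\<in>{..<Suc n}. A.W (rat_point j) \<omega>" and ?g = "\<lambda>\<omega>. \<lambda>j\<in>{..<Suc n}. B.W (rat_point j) \<omega>"
  have law: "distr M ?Pi ?f = distr N ?Pi ?g"
    using A.marginals B.marginals
    by (intro coalescing_BM_law_unique[of "Suc n" rat_point])
      (auto simp: coalescing_BM_marginals_def A.W_def B.W_def)
  have f: "?f \<in> measurable M ?Pi" and g: "?g \<in> measurable N ?Pi"
    by (intro measurable_restrict A.W_measurable B.W_measurable)+
  let ?G = "\<lambda>p. finite_path_set n (\<lambda>i. if i < Suc n then p i else undefined)"
  have G: "?G \<in> borel_measurable ?Pi"
  proof (rule measurable_compose[OF _ measurable_finite_path_set], rule measurable_PiM_single')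
    fix i :: nat
    show "(\<lambda>p. if i < Suc n then p i else undefined) \<in> borel_measurable ?Pi"
      by (cases "i < Suc n") (auto intro: measurable_component_singleton)
  qed auto
  have fs: "finite_path_set n p = finite_path_set n q" if "\<And>i. i \<le> n \<Longrightarrow> p i = q i" for p q
    using that unfolding finite_path_set_def by (intro arg_cong[where f = Abs_path_set] image_cong) auto
  have "A.partial_web n = ?G \<circ> ?f" "B.partial_web n = ?G \<circ> ?g"
    by (auto simp: fun_eq_iff A.partial_web_def B.partial_web_def intro!: fs)
  then show ?thesis using distr_distr[OF G f] distr_distr[OF G g] law by simp
qed

text \<open>Equal counting variables, if finite, force a set to be equal to its subset.\<close>

lemma same_touched_reals:
  assumes t: "0 < t" and eta: "eta_hat K s t a b = eta_hat L s t a b"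
    and sub: "paths_of L \<subseteq> paths_of K" and fin: "finite (touched_reals L s (s + t) a b)"
  shows "touched_reals K s (s + t) a b = touched_reals L s (s + t) a b"
proof -
  have LK: "touched_reals L s (s + t) a b \<subseteq> touched_reals K s (s + t) a b"
    using sub unfolding touched_reals_def by blast
  have "ereal_of_enat (eta K s t a b) = ereal_of_enat (eta L s t a b)"
    using eta unfolding eta_hat_def
    by (cases "ereal_of_enat (eta K s t a b)"; cases "ereal_of_enat (eta L s t a b)") (auto simp: one_ereal_def)
  then have e: "eta K s t a b = eta L s t a b" by (metis antisym order_refl ereal_of_enat_le_iff)
  have "eta L s t a b = enat (card (touched_reals L s (s + t) a b))"
    using fin by (simp add: eta_eq[OF t])
  then have K: "eta K s t a b = enat (card (touched_reals L s (s + t) a b))" using e by simp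
  then have finK: "finite (touched_reals K s (s + t) a b)"
    unfolding eta_eq[OF t] Let_def by (auto split: if_splits)
  then have "card (touched_reals K s (s + t) a b) = card (touched_reals L s (s + t) a b)"
    using K by (simp add: eta_eq[OF t])
  then show ?thesis using card_subset_eq[OF finK LK] by simp
qed

lemma eta_hat_mono:
  assumes "0 < t" "paths_of L \<subseteq> paths_of K"
  shows "eta_hat L s t a b \<le> eta_hat K s t a b"
proof -
  have LK: "touched_reals L s (s + t) a b \<subseteq> touched_reals K s (s + t) a b"
    using assms(2) unfolding touched_reals_def by blast
  then have "eta L s t a b \<le> eta K s t a b"
    unfolding eta_eq[OF assms(1)] Let_def using finite_subset[OF LK] by (auto intro: card_mono)
  then have "ereal_of_enat (eta L s t a b) \<le> ereal_of_enat (eta K s t a b)" by simp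
  then show ?thesis unfolding eta_hat_def by (rule ereal_minus_mono) simp
qed

theorem theorem4p1:
  fixes M :: "'a measure" and W' :: "'a \<Rightarrow> path_set"
    and N :: "'b measure" and Wbar :: "'b \<Rightarrow> path_set"
  assumes web: "brownian_web N Wbar"
    and rv: "random_path_set M W'"
    and o: "unique_paths M W'"
    and i: "coalescing_BM_marginals M W'"
    and ii: "\<And>t0 t a b. t > 0 \<Longrightarrow> a < b \<Longrightarrow>
      distr M borel (\<lambda>\<omega>. eta_hat (W' \<omega>) t0 t a b) =
      distr N borel (\<lambda>\<omega>. eta_hat (Wbar \<omega>) t0 t a b)"
  shows "distr M borel W' = distr N borel Wbar"
proof -
  have webs: "web_paths M W'" "web_paths N Wbar"
    using web rv o i
    by (auto simp: web_paths_def web_paths_axioms_def brownian_web_def random_path_set_def)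
  interpret A: web_paths M W' by fact
  interpret B: web_paths N Wbar by fact
  have WB [measurable]: "Wbar \<in> borel_measurable N" and WA [measurable]: "W' \<in> borel_measurable M"
    by (fact B.X_measurable A.X_measurable)+
  have limB: "AE \<omega> in N. (\<lambda>n. B.partial_web n \<omega>) \<longlonglongrightarrow> Wbar \<omega>"
  proof -
    have "closure (\<rat> \<times> \<rat>) = (UNIV :: (real \<times> real) set)" by (simp add: closure_Times Rats_closure_real)
    then have "AE \<omega> in N. paths_of (Wbar \<omega>) = closure (path_from (Wbar \<omega>) ` (\<rat> \<times> \<rat>))"
      using web countable_rat_points unfolding brownian_web_def by blast
    then show ?thesis using B.AE_skeleton_web
    proof eventually_elim
      case (elim \<omega>)
      then have "paths_of (Wbar \<omega>) = paths_of (B.skeleton_web \<omega>)" by (simp add: B.W_def)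
      then have "Wbar \<omega> = B.skeleton_web \<omega>" by (simp only: paths_of_inject)
      then show ?case using elim(2) by simp
    qed
  qed
  have limA: "AE \<omega> in M. (\<lambda>n. A.partial_web n \<omega>) \<longlonglongrightarrow> A.skeleton_web \<omega>"
    using A.AE_skeleton_web by eventually_elim blast
  have law: "distr M borel A.skeleton_web = distr N borel Wbar"
    by (rule distr_limit_eq[OF A.prob_space_axioms B.prob_space_axioms A.partial_web_measurable
      A.skeleton_web_measurable B.partial_web_measurable WB limA limB partial_web_same_law[OF webs]])
  have "AE \<omega> in M. eta_hat (A.skeleton_web \<omega>) s (u - s) a b = eta_hat (W' \<omega>) s (u - s) a b"
    if su: "s < u" and ab: "a < b" for s u a b
  proof (rule A.AE_eq_if_le_and_same_law)
    have t: "0 < u - s" using su by simp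
    note m = measurable_eta_hat[OF t, of s a b]
    show "(\<lambda>\<omega>. eta_hat (A.skeleton_web \<omega>) s (u - s) a b) \<in> borel_measurable M"
      "(\<lambda>\<omega>. eta_hat (W' \<omega>) s (u - s) a b) \<in> borel_measurable M"
      by (rule measurable_compose[OF A.skeleton_web_measurable m] measurable_compose[OF WA m])+
    show "AE \<omega> in M. eta_hat (A.skeleton_web \<omega>) s (u - s) a b \<le> eta_hat (W' \<omega>) s (u - s) a b"
      using A.AE_skeleton_web by eventually_elim (use eta_hat_mono[OF t] in blast)
    have "distr M borel (\<lambda>\<omega>. eta_hat (A.skeleton_web \<omega>) s (u - s) a b) =
        distr (distr M borel A.skeleton_web) borel (\<lambda>K. eta_hat K s (u - s) a b)"
      using distr_distr[OF m A.skeleton_web_measurable] by (simp add: comp_def)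
    also have "\<dots> = distr N borel (\<lambda>\<omega>. eta_hat (Wbar \<omega>) s (u - s) a b)"
      unfolding law using distr_distr[OF m WB] by (simp add: comp_def)
    also have "\<dots> = distr M borel (\<lambda>\<omega>. eta_hat (W' \<omega>) s (u - s) a b)"
      using ii[OF t ab] by simp
    finally show "distr M borel (\<lambda>\<omega>. eta_hat (A.skeleton_web \<omega>) s (u - s) a b) =
        distr M borel (\<lambda>\<omega>. eta_hat (W' \<omega>) s (u - s) a b)" .
  qed
  then have "AE \<omega> in M. \<forall>s\<in>\<rat>. \<forall>u\<in>\<rat>. \<forall>a\<in>\<rat>. \<forall>b\<in>\<rat>. s < u \<longrightarrow> a < b \<longrightarrow>
      eta_hat (A.skeleton_web \<omega>) s (u - s) a b = eta_hat (W' \<omega>) s (u - s) a b"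
    by (intro AE_ball_countable[THEN iffD2] countable_rat ballI AE_impI)
  then have "AE \<omega> in M. \<forall>s\<in>\<rat>. \<forall>u\<in>\<rat>. \<forall>a\<in>\<rat>. \<forall>b\<in>\<rat>. s < u \<longrightarrow> a < b \<longrightarrow>
      finite (touched_reals (A.skeleton_web \<omega>) s u a b) \<longrightarrow>
      touched_reals (W' \<omega>) s u a b = touched_reals (A.skeleton_web \<omega>) s u a b"
    using A.AE_skeleton_web
  proof eventually_elim
    case (elim \<omega>)
    show ?case
    proof (intro ballI impI)
      fix s u a b :: real
      assume *: "s \<in> \<rat>" "u \<in> \<rat>" "a \<in> \<rat>" "b \<in> \<rat>" "s < u" "a < b"
        and fin: "finite (touched_reals (A.skeleton_web \<omega>) s u a b)"
      have "eta_hat (W' \<omega>) s (u - s) a b = eta_hat (A.skeleton_web \<omega>) s (u - s) a b" using elim(1) * by simp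
      moreover have "paths_of (A.skeleton_web \<omega>) \<subseteq> paths_of (W' \<omega>)" using elim(2) by blast
      ultimately show "touched_reals (W' \<omega>) s u a b = touched_reals (A.skeleton_web \<omega>) s u a b"
        using same_touched_reals[of "u - s" "W' \<omega>" s a b "A.skeleton_web \<omega>"] * fin by simp
    qed
  qed
  from A.AE_web_sample[OF this] have "AE \<omega> in M. W' \<omega> = A.skeleton_web \<omega>"
    by eventually_elim (rule web_sample.web_sample_unique)
  then have "distr M borel W' = distr M borel A.skeleton_web"
    by (intro distr_cong_AE) auto
  then show ?thesis using law by simp
qed

end
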